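(* There exists $\lambda_0>0$ such that for every $\lambda\ge\lambda_0$, every maximizer $\omega^\lambda$ of $E$ over $K_\lambda$ is a local maximizer of the kinetic energy $E$ in its rearrangement class $F_{\omega^\lambda}$; that is, there exists $\delta_0>0$ such that $E(\omega)\le E(\omega^\lambda)$ for every $\omega\in F_{\omega^\lambda}$ with $\|\omega-\omega^\lambda\|_{L^1(D)}<\delta_0$.
   Context: $D\subset\mathbb R^2$ is a bounded simply connected domain with smooth boundary; $G$ is the Green function of $-\Delta$ in $D$ with zero Dirichlet boundary condition, written $G(x,y)=\frac1{2\pi}\ln\frac1{|x-y|}-h(x,y)$, where $h$ is the regular part. Real numbers $\kappa_1>0$ and $\kappa_2<0$ are fixed, and the Kirchhoff–Routh function is $H(x_1,x_2)=-2\kappa_1\kappa_2G(x_1,x_2)+\sum_{i=1}^2\kappa_i^2h(x_i,x_i)$ for $x_1,x_2\in D$, $x_1\ne x_2$. The point $(\bar x_1,\bar x_2)\in D\times D$, $\bar x_1\neq\bar x_2$, is a strict local minimum point of $H$. A number $\delta>0$ is fixed so small that, writing $B_i=B_\delta(\bar x_i)$: $\overline{B_i}\subset D$ for $i=1,2$; $\overline{B_1}\cap\overline{B_2}=\varnothing$; and $(\bar x_1,\bar x_2)$ is the unique minimum point of $H$ in $\overline{B_1}\times\overline{B_2}$. For $\lambda>0$, $K_\lambda$ is the set of all $\omega=\omega_1+\omega_2$ with $\omega_i\in L^\infty(D)$, $0\le \mathrm{sgn}(\kappa_i)\omega_i\le\lambda$ a.e., $\int_D\omega_i=\kappa_i$,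 and $\omega_i$ supported in $B_i$ (meaning $\omega_i=0$ a.e. in $D\setminus B_i$), $i=1,2$. The kinetic energy is $E(\omega)=\frac12\int_D\int_DG(x,y)\omega(x)\omega(y)\,dx\,dy$. A maximizer $\omega^\lambda$ of $E$ over $K_\lambda$ exists whenever $K_\lambda\neq\varnothing$. $I_A$ denotes the characteristic function of $A$. Put $\psi^\lambda(x)=\int_DG(x,y)\omega^\lambda(y)\,dy$. If $\lambda\pi\delta^2>\max(|\kappa_1|,|\kappa_2|)$, every maximizer $\omega^\lambda$ of $E$ over $K_\lambda$ satisfies $\omega^\lambda I_{B_i}=\mathrm{sgn}(\kappa_i)\lambda I_{\Omega_i}$ a.e. with $\Omega_i=\{\mathrm{sgn}(\kappa_i)\psi^\lambda>\mu_i^\lambda\}\cap B_i$ for uniquely determined real numbers $\mu_i^\lambda$, $i=1,2$. The number $\delta$ is moreover chosen so small that $\mu_1^\lambda>0$ and $\mu_2^\lambda>0$ for every maximizer $\omega^\lambda$ and all sufficiently large $\lambda$ (such a choice is possible). For a measurable function $\omega$ on $D$, its rearrangement class is $F_\omega=\{v \text{ measurable on } D : |\{v>a\}|=|\{\omega>a\}|\ \ \forall a\in\mathbb R\}$, where $|\cdot|$ is Lebesgue measure. *)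

theory Defs
  imports "HOL-Analysis.Analysis"
begin

section \<open>Smooth domains and harmonic functions\<close>

text \<open>\<open>Ck_on k f S\<close>: the function \<open>f\<close> is of class \<open>C^k\<close> on \<open>S\<close>. This is meant for open \<open>S\<close> only
  (derivatives are taken with respect to the full neighbourhood).\<close>

primrec Ck_on :: "nat \<Rightarrow> ('a::euclidean_space \<Rightarrow> real) \<Rightarrow> 'a set \<Rightarrow> bool" where
  "Ck_on 0 f S \<longleftrightarrow> continuous_on S f"
| "Ck_on (Suc k) f S \<longleftrightarrow>
     f differentiable_on S \<and> (\<forall>b\<in>Basis. Ck_on k (\<lambda>x. frechet_derivative f (at x) b) S)"

definition smooth_fun_on :: "('a::euclidean_space \<Rightarrow> real) \<Rightarrow> 'a set \<Rightarrow> bool" where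
  "smooth_fun_on f S \<longleftrightarrow> (\<forall>k. Ck_on k f S)"

text \<open>Near each boundary point, \<open>D\<close> is the negativity set of a smooth local defining function
  without critical points. This forces \<open>D\<close> to lie locally on one side of its boundary.\<close>

definition smooth_boundary :: "'a::euclidean_space set \<Rightarrow> bool" where
  "smooth_boundary D \<longleftrightarrow>
     (\<forall>p\<in>frontier D. \<exists>U \<rho>. open U \<and> p \<in> U \<and> smooth_fun_on \<rho> U \<and>
        (\<forall>x\<in>U. frechet_derivative \<rho> (at x) \<noteq> (\<lambda>_. 0)) \<and>
        D \<inter> U = {x\<in>U. \<rho> x < 0})"

definition laplacian :: "('a::euclidean_space \<Rightarrow> real) \<Rightarrow> 'a \<Rightarrow> real" where
  "laplacian u x =
     (\<Sum>b\<in>Basis. frechet_derivative (\<lambda>z. frechet_derivative u (at z) b) (at x) b)"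

definition harmonic_on :: "'a::euclidean_space set \<Rightarrow> ('a \<Rightarrow> real) \<Rightarrow> bool" where
  "harmonic_on D u \<longleftrightarrow> Ck_on 2 u D \<and> (\<forall>x\<in>D. laplacian u x = 0)"


section \<open>Green function and Kirchhoff--Routh function\<close>

text \<open>\<open>G\<close> is the Green function of the negative Laplacian in \<open>D\<close> with zero Dirichlet boundary
  condition, and \<open>h\<close> is its regular part. The values \<open>h x x\<close> are determined because \<open>h\<close> is
  harmonic across the pole; the values \<open>G x x\<close> are left unspecified, as they do not influence any
  of the integrals below.\<close>

definition green_function ::
  "(real^2) set \<Rightarrow> (real^2 \<Rightarrow> real^2 \<Rightarrow> real) \<Rightarrow> (real^2 \<Rightarrow> real^2 \<Rightarrow> real) \<Rightarrow> bool" where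
  "green_function D G h \<longleftrightarrow>
     (\<forall>x\<in>D. \<forall>y\<in>D. x \<noteq> y \<longrightarrow> G x y = 1 / (2 * pi) * ln (1 / norm (x - y)) - h x y) \<and>
     (\<forall>y\<in>D. harmonic_on D (\<lambda>x. h x y)) \<and>
     (\<forall>y\<in>D. \<forall>p\<in>frontier D. ((\<lambda>x. G x y) \<longlongrightarrow> 0) (at p within D))"

definition kirchhoff_routh ::
  "(real^2 \<Rightarrow> real^2 \<Rightarrow> real) \<Rightarrow> (real^2 \<Rightarrow> real^2 \<Rightarrow> real) \<Rightarrow> real \<Rightarrow> real \<Rightarrow>
     (real^2) \<times> (real^2) \<Rightarrow> real" where
  "kirchhoff_routh G h \<kappa>1 \<kappa>2 = (\<lambda>(x1, x2).
     - 2 * \<kappa>1 * \<kappa>2 * G x1 x2 + (\<kappa>1\<^sup>2 * h x1 x1 + \<kappa>2\<^sup>2 * h x2 x2))"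

definition off_diagonal :: "'a set \<Rightarrow> ('a \<times> 'a) set" where
  "off_diagonal D = {(x1, x2). x1 \<in> D \<and> x2 \<in> D \<and> x1 \<noteq> x2}"

definition strict_local_min_on ::
  "'a::topological_space set \<Rightarrow> ('a \<Rightarrow> real) \<Rightarrow> 'a \<Rightarrow> bool" where
  "strict_local_min_on S f p \<longleftrightarrow> p \<in> S \<and> (\<forall>\<^sub>F q in at p within S. f p < f q)"

definition unique_min_on :: "'a set \<Rightarrow> ('a \<Rightarrow> real) \<Rightarrow> 'a \<Rightarrow> bool" where
  "unique_min_on S f p \<longleftrightarrow> p \<in> S \<and> (\<forall>q\<in>S. q \<noteq> p \<longrightarrow> f p < f q)"


section \<open>Vorticities, energy and admissible class\<close>

text \<open>Functions on \<open>D\<close> are represented by total functions whose values outside \<open>D\<close> are irrelevant.\<close>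

definition Linfty :: "(real^2) set \<Rightarrow> (real^2 \<Rightarrow> real) set" where
  "Linfty D = {f. f \<in> borel_measurable (lebesgue_on D) \<and>
     (\<exists>C. AE x in lebesgue_on D. \<bar>f x\<bar> \<le> C)}"

definition stream_function ::
  "(real^2) set \<Rightarrow> (real^2 \<Rightarrow> real^2 \<Rightarrow> real) \<Rightarrow> (real^2 \<Rightarrow> real) \<Rightarrow> real^2 \<Rightarrow> real" where
  "stream_function D G \<omega> x = (LINT y|lebesgue_on D. G x y * \<omega> y)"

definition energy ::
  "(real^2) set \<Rightarrow> (real^2 \<Rightarrow> real^2 \<Rightarrow> real) \<Rightarrow> (real^2 \<Rightarrow> real) \<Rightarrow> real" where
  "energy D G \<omega> =
     1 / 2 * (LINT x|lebesgue_on D. (LINT y|lebesgue_on D. G x y * \<omega> x * \<omega> y))"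

definition component_class ::
  "(real^2) set \<Rightarrow> (real^2) set \<Rightarrow> real \<Rightarrow> real \<Rightarrow> (real^2 \<Rightarrow> real) set" where
  "component_class D B \<kappa> l = {w \<in> Linfty D.
     (AE x in lebesgue_on D. 0 \<le> sgn \<kappa> * w x \<and> sgn \<kappa> * w x \<le> l) \<and>
     (LINT x|lebesgue_on D. w x) = \<kappa> \<and>
     (AE x in lebesgue_on D. x \<notin> B \<longrightarrow> w x = 0)}"

definition admissible_class ::
  "(real^2) set \<Rightarrow> (real^2) set \<Rightarrow> (real^2) set \<Rightarrow> real \<Rightarrow> real \<Rightarrow> real \<Rightarrow>
     (real^2 \<Rightarrow> real) set" where
  "admissible_class D B1 B2 \<kappa>1 \<kappa>2 l = {\<omega>.
     \<exists>\<omega>1 \<in> component_class D B1 \<kappa>1 l. \<exists>\<omega>2 \<in> component_class D B2 \<kappa>2 l.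
       \<forall>x\<in>D. \<omega> x = \<omega>1 x + \<omega>2 x}"

definition is_maximizer :: "('a \<Rightarrow> real) \<Rightarrow> 'a set \<Rightarrow> 'a \<Rightarrow> bool" where
  "is_maximizer F K w \<longleftrightarrow> w \<in> K \<and> (\<forall>v\<in>K. F v \<le> F w)"

text \<open>\<open>\<mu>\<close> is the level describing \<open>\<omega>\<close> on \<open>B\<close>: up to null sets,
  \<open>\<omega> I_B = sgn(\<kappa>) l I_\<Omega>\<close> with \<open>\<Omega> = {sgn(\<kappa>) \<psi> > \<mu>} \<inter> B\<close>, where \<open>\<psi>\<close> is the stream function of
  \<open>\<omega>\<close>.\<close>

definition patch_level ::
  "(real^2) set \<Rightarrow> (real^2 \<Rightarrow> real^2 \<Rightarrow> real) \<Rightarrow> (real^2) set \<Rightarrow> real \<Rightarrow> real \<Rightarrow>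
     (real^2 \<Rightarrow> real) \<Rightarrow> real \<Rightarrow> bool" where
  "patch_level D G B \<kappa> l \<omega> \<mu> \<longleftrightarrow>
     (AE x in lebesgue_on D. \<omega> x * indicator B x =
        sgn \<kappa> * l * indicator ({z. sgn \<kappa> * stream_function D G \<omega> z > \<mu>} \<inter> B) x)"

definition rearrangement_class :: "(real^2) set \<Rightarrow> (real^2 \<Rightarrow> real) \<Rightarrow> (real^2 \<Rightarrow> real) set" where
  "rearrangement_class D \<omega> = {v \<in> borel_measurable (lebesgue_on D).
     \<forall>a::real. emeasure lebesgue {x\<in>D. v x > a} = emeasure lebesgue {x\<in>D. \<omega> x > a}}"

text \<open>For \<open>v\<close> in the rearrangement class of a bounded function on a bounded domain the integrand
  below is integrable, so the totalised Bochner integral is the true \<open>L^1\<close> distance.\<close>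

definition L1_dist :: "(real^2) set \<Rightarrow> (real^2 \<Rightarrow> real) \<Rightarrow> (real^2 \<Rightarrow> real) \<Rightarrow> real" where
  "L1_dist D v \<omega> = (LINT x|lebesgue_on D. \<bar>v x - \<omega> x\<bar>)"

end

theory Submission
  imports Defs
begin

text \<open>
  By the maximum principle \<open>0 \<le> G x y \<le> ln (R / |x - y|) / (2 \<pi>)\<close>, \<open>h\<close> is continuous, and \<open>G\<close> is symmetric.
  Comparing the energy of a maximizer with that of two discs of radius \<open>eps_i\<close>, where
  \<open>l \<pi> eps_i\<^sup>2 = |\<kappa>_i|\<close>, shows that the deficit of \<open>sgn \<kappa>_i \<psi>\<close> from its maximal possible
  value \<open>U_i\<close>, which tends to infinity with \<open>l\<close>, is bounded on average over the core. Hence \<open>\<mu>_i \<ge> U_i - O(1)\<close>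
  and the cores have diameter \<open>O(eps_i)\<close>. Translating the cores to \<open>x1\<close>, \<open>x2\<close> and using that \<open>(x1, x2)\<close> is
  the only minimum point of the Kirchhoff--Routh function, one sees that they shrink to these points. Outside the
  balls \<open>sgn \<kappa>_i \<psi>\<close> then stays bounded, so it is below \<open>\<mu>_i - 1\<close> for large \<open>l\<close>. A rearrangement \<open>v\<close> close
  to \<open>\<omega>\<close> in \<open>L\<^sup>1\<close> can thus be improved by moving its mass outside the balls into the cores, which yields an
  admissible competitor of \<open>\<omega>\<close>.
\<close>

section \<open>The five-point Laplacian and the maximum principle\<close>

text \<open>Two obstacles shape the proof. First, \<open>green_function\<close> describes
  \<open>G x y\<close> through the variable \<open>x\<close> alone. Continuity in the pole, joint
  measurability and symmetry have to be derived; symmetry makes the energy a symmetric bilinear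
  form, so that its first variation is read off from the stream function. Second, the logarithmic
  part of the energy diverges with \<open>l\<close>, while the bounded regular part decides where
  the cores lie. Hence there are two kinds of comparison. Crude bounds that lose a constant (a
  layer-cake estimate in place of symmetrization) suffice for the level and the diameter of a core,
  since the terms with \<open>ln eps\<close> cancel. The location of a core needs a comparison
  without loss in the divergent part: translation, which leaves the logarithm exactly invariant. The
  last step is a balance of constants: moving mass \<open>S\<close> gains at least \<open>S\<close>
  to first order, and the remainder costs at most \<open>S\<close> once \<open>v\<close> is close to
  the maximizer. How close it must be depends only on \<open>l\<close> and on the domain.\<close>

text \<open>The five-point Laplacian makes sense for functions that are merely continuous. It is used because
  nothing is known about the regularity of \<open>h x\<close> in its second variable.\<close>

definition stencil :: "('a::euclidean_space \<Rightarrow> real) \<Rightarrow> 'a \<Rightarrow> real \<Rightarrow> real" where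
  "stencil u y r = (\<Sum>b\<in>Basis. u (y + r *\<^sub>R b) + u (y - r *\<^sub>R b) - 2 * u y)"

definition stencil_harmonic :: "('a::euclidean_space \<Rightarrow> real) \<Rightarrow> 'a \<Rightarrow> bool" where
  "stencil_harmonic u y \<longleftrightarrow> ((\<lambda>r. stencil u y r / r\<^sup>2) \<longlongrightarrow> 0) (at_right 0)"

lemma stencil_add: "stencil (\<lambda>x. u x + v x) y r = stencil u y r + stencil v y r"
  unfolding stencil_def by (simp add: algebra_simps sum.distrib sum_subtractf)

lemma stencil_cmult: "stencil (\<lambda>x. c * u x) y r = c * stencil u y r"
  unfolding stencil_def by (simp add: algebra_simps sum.distrib sum_subtractf sum_distrib_left)

lemma stencil_harmonic_add:
  "stencil_harmonic u y \<Longrightarrow> stencil_harmonic v y \<Longrightarrow> stencil_harmonic (\<lambda>x. u x + v x) y"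
  unfolding stencil_harmonic_def stencil_add add_divide_distrib
  using tendsto_add[of "\<lambda>r. stencil u y r / r\<^sup>2" 0 "at_right 0" "\<lambda>r. stencil v y r / r\<^sup>2" 0] by simp

lemma stencil_harmonic_cmult: "stencil_harmonic u y \<Longrightarrow> stencil_harmonic (\<lambda>x. c * u x) y"
  unfolding stencil_harmonic_def stencil_cmult
  using tendsto_mult_left[of "\<lambda>r. stencil u y r / r\<^sup>2" 0 "at_right 0" c] by simp

lemma stencil_harmonic_const: "stencil_harmonic (\<lambda>x. c) y"
  unfolding stencil_harmonic_def stencil_def by simp

lemma stencil_harmonic_minus: "stencil_harmonic u y \<Longrightarrow> stencil_harmonic (\<lambda>x. - u x) y"
  using stencil_harmonic_cmult[of u y "- 1"] by simp

lemma stencil_harmonic_diff: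
  "stencil_harmonic u y \<Longrightarrow> stencil_harmonic v y \<Longrightarrow> stencil_harmonic (\<lambda>x. u x - v x) y"
  using stencil_harmonic_add[of u y "\<lambda>x. - v x"] stencil_harmonic_minus[of v y] by simp

lemma stencil_harmonic_sum:
  "(\<And>i. i \<in> I \<Longrightarrow> stencil_harmonic (u i) y) \<Longrightarrow> stencil_harmonic (\<lambda>x. \<Sum>i\<in>I. u i x) y"
  by (induction I rule: infinite_finite_induct) (auto intro: stencil_harmonic_add stencil_harmonic_const)

text \<open>Supplies the strictly subharmonic perturbation for the maximum principle; its stencil is
  exact, without a remainder in \<open>r\<close>.\<close>

lemma stencil_norm_sq:
  fixes y :: "'a::euclidean_space"
  shows "stencil (\<lambda>x. (norm x)\<^sup>2) y r = 2 * r\<^sup>2 * DIM('a)"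
proof -
  have "(norm (y + r *\<^sub>R b))\<^sup>2 + (norm (y - r *\<^sub>R b))\<^sup>2 - 2 * (norm y)\<^sup>2 = 2 * r\<^sup>2" if "b \<in> Basis" for b
    using that unfolding power2_norm_eq_inner
    by (simp add: inner_simps algebra_simps inner_commute power2_eq_square del: dot_square_norm)
  then show ?thesis unfolding stencil_def by simp
qed

text \<open>At an interior maximum of \<open>u + eta * |y|^2\<close> all second differences are at
  most 0, while the quadratic term contributes at least \<open>2 * eta * r^2\<close>. So
  \<open>stencil u z r / r^2\<close> stays below \<open>- 2 * eta\<close> and cannot tend to 0. The
  frontier enters only through a one-sided eventual bound, so functions tending to minus infinity
  there are covered as well.\<close>

lemma stencil_max_principle:
  fixes u :: "'a::euclidean_space \<Rightarrow> real"
  assumes D: "open D" "bounded D" and cont: "continuous_on D u"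
    and harm: "\<And>y. y \<in> D \<Longrightarrow> stencil_harmonic u y"
    and bdry: "\<And>p e. p \<in> frontier D \<Longrightarrow> e > 0 \<Longrightarrow> \<forall>\<^sub>F x in at p within D. u x \<le> c + e"
    and x0: "x0 \<in> D"
  shows "u x0 \<le> c"
proof (rule ccontr)
  assume "\<not> u x0 \<le> c"
  define m where "m = u x0 - c"
  have m: "m > 0" using \<open>\<not> u x0 \<le> c\<close> by (simp add: m_def)
  obtain R where R: "R > 0" "\<And>y. y \<in> D \<Longrightarrow> norm y \<le> R"
    using D(2) bounded_pos by metis
  \<comment> \<open>With this choice the perturbation is at most \<open>m / 4\<close> on
    \<open>D\<close>: near the frontier \<open>w\<close> stays below \<open>c + m / 2\<close>, while
    \<open>w x0\<close> is at least \<open>c + m\<close>.\<close>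
  define eta where "eta = m / (4 * R\<^sup>2)"
  have eta: "eta > 0" "eta * R\<^sup>2 = m / 4" using m R by (auto simp: eta_def)
  define w where "w y = u y + eta * (norm y)\<^sup>2" for y
  have w_le: "w y \<le> u y + m / 4" if "y \<in> D" for y
  proof -
    have "(norm y)\<^sup>2 \<le> R\<^sup>2" using R(2)[OF that] by (simp add: power_mono)
    then have "eta * (norm y)\<^sup>2 \<le> eta * R\<^sup>2" using eta by (simp add: mult_left_mono)
    then show ?thesis using eta by (simp add: w_def)
  qed
  \<comment> \<open>This superlevel set keeps away from the frontier, so it is closed in the whole
    space and a maximum exists although no extension of \<open>u\<close> to the closure is
    assumed.\<close>
  define S where "S = {y \<in> D. w x0 \<le> w y}"
  have wx0: "w x0 \<ge> c + m" using eta by (simp add: w_def m_def)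
  have contw: "continuous_on D w" unfolding w_def by (intro continuous_intros cont)
  have "closed S"
  proof -
    have "y \<in> S" if y: "y \<in> closure S" for y
    proof (cases "y \<in> D")
      case True
      have "closedin (top_of_set D) (D \<inter> w -` {w x0..})"
        by (rule continuous_closedin_preimage[OF contw]) auto
      moreover have "D \<inter> w -` {w x0..} = S" by (auto simp: S_def)
      ultimately obtain T where T: "closed T" "S = D \<inter> T" by (auto simp: closedin_closed)
      then have "y \<in> T" using y closure_minimal[of S T] by auto
      then show ?thesis using True T by auto
    next
      case False
      have SD: "S \<subseteq> D" by (auto simp: S_def)
      have "y \<in> closure D" using y SD closure_mono by blast
      then have fr: "y \<in> frontier D" using False D by (simp add: frontier_def interior_open)
      have "\<forall>\<^sub>F x in at y within D. u x \<le> c + m/4" using bdry[OF fr, of "m/4"] m by simp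
      then have "\<forall>\<^sub>F x in at y within S. u x \<le> c + m/4"
        using SD at_le filter_leD by metis
      moreover have "\<forall>\<^sub>F x in at y within S. x \<in> S" by (simp add: eventually_at_filter)
      ultimately have "\<forall>\<^sub>F x in at y within S. False"
      proof eventually_elim
        case (elim x)
        then have "w x \<le> c + m / 2" using w_le[of x] by (auto simp: S_def)
        moreover have "w x \<ge> c + m" using elim wx0 by (auto simp: S_def)
        ultimately show False using m by simp
      qed
      then have "\<not> y islimpt S"
        using trivial_limit_within[of y S] by (simp add: eventually_False)
      then show ?thesis using y by (simp add: closure_def)
    qed
    then show ?thesis by (metis closure_subset closure_eq subsetI subset_antisym)
  qed
  moreover have "bounded S" using D(2) by (rule bounded_subset) (auto simp: S_def)
  ultimately have "compact S" by (simp add: compact_eq_bounded_closed)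
  moreover have "S \<noteq> {}" using x0 by (auto simp: S_def)
  moreover have "continuous_on S w" by (rule continuous_on_subset[OF contw]) (auto simp: S_def)
  ultimately obtain z where z: "z \<in> S" "\<And>y. y \<in> S \<Longrightarrow> w y \<le> w z"
    using continuous_attains_sup by metis
  have zD: "z \<in> D" and zmax: "w y \<le> w z" if "y \<in> D" for y
    using z that by (force simp: S_def)+
  obtain d where d: "d > 0" "ball z d \<subseteq> D" using D(1) zD[OF x0] open_contains_ball by blast
  have le: "stencil u z r / r\<^sup>2 \<le> - 2 * eta" if r: "r > 0" "r < d" for r
  proof -
    have "stencil w z r \<le> 0"
      unfolding stencil_def
    proof (rule sum_nonpos)
      fix b :: 'a assume b: "b \<in> Basis"
      have "z + r *\<^sub>R b \<in> D" "z - r *\<^sub>R b \<in> D"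
        using d(2) r b by (auto simp: dist_norm subset_iff)
      then show "w (z + r *\<^sub>R b) + w (z - r *\<^sub>R b) - 2 * w z \<le> 0"
        using zmax[of "z + r *\<^sub>R b"] zmax[of "z - r *\<^sub>R b"] by linarith
    qed
    moreover have "stencil w z r = stencil u z r + eta * (2 * r\<^sup>2 * DIM('a))"
      unfolding w_def[abs_def] stencil_add stencil_cmult stencil_norm_sq by simp
    ultimately have "stencil u z r \<le> - (2 * eta * DIM('a) * r\<^sup>2)" by (simp add: algebra_simps)
    also have "\<dots> \<le> - (2 * eta * r\<^sup>2)"
    proof -
      have "1 \<le> real DIM('a)" using DIM_positive[where 'a='a] by linarith
      then have "2 * eta * r\<^sup>2 * 1 \<le> 2 * eta * r\<^sup>2 * DIM('a)" using eta
        by (intro mult_left_mono) auto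
      then show ?thesis by (simp add: algebra_simps)
    qed
    finally show ?thesis using r by (simp add: divide_le_eq)
  qed
  have "\<forall>\<^sub>F r in at_right 0. stencil u z r / r\<^sup>2 \<le> - 2 * eta"
    using eventually_at_right_less eventually_at_right_real[OF d(1)]
    by (rule eventually_elim2) (use le in auto)
  moreover have "((\<lambda>r. stencil u z r / r\<^sup>2) \<longlongrightarrow> 0) (at_right 0)"
    using harm[OF zD[OF x0]] by (simp add: stencil_harmonic_def)
  ultimately have "0 \<le> - 2 * eta"
    using tendsto_upperbound trivial_limit_at_right_real by blast
  then show False using eta by simp
qed

text \<open>The second derivative is only given at 0, so l'Hopital is applied once; the resulting
  quotient \<open>(g' r - g' (- r)) / (2 * r)\<close> is the mean of two difference quotients of
  \<open>g'\<close> at 0.\<close>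

lemma second_difference_tendsto:
  fixes g :: "real \<Rightarrow> real"
  assumes d: "d > 0" and g: "\<And>t. \<bar>t\<bar> < d \<Longrightarrow> (g has_real_derivative g' t) (at t)"
    and g': "(g' has_real_derivative c) (at 0)"
  shows "((\<lambda>r. (g r + g (- r) - 2 * g 0) / r\<^sup>2) \<longlongrightarrow> c) (at_right 0)"
proof (rule lhopital_right_0[where f' = "\<lambda>r. g' r - g' (- r)" and g' = "\<lambda>r. 2 * r"])
  have c0: "isCont g 0" using g[of 0] d DERIV_isCont by auto
  have l1: "(g \<longlongrightarrow> g 0) (at_right 0)"
    using c0 by (simp add: isCont_def filterlim_at_split)
  have "((\<lambda>r. g (- r)) \<longlongrightarrow> g 0) (at_right 0)"
    using c0 unfolding isCont_def filterlim_at_split at_left_minus[of 0] filterlim_filtermap by simp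
  with l1 show "((\<lambda>r. g r + g (- r) - 2 * g 0) \<longlongrightarrow> 0) (at_right 0)"
    using tendsto_diff[OF tendsto_add[OF l1], of _ "g 0" "\<lambda>_. 2 * g 0" "2 * g 0"] by simp
  show "((\<lambda>r::real. r\<^sup>2) \<longlongrightarrow> 0) (at_right 0)"
    by (rule tendsto_eq_intros refl | simp)+
  show "\<forall>\<^sub>F x::real in at_right 0. x\<^sup>2 \<noteq> 0"
    using eventually_at_right_less by (rule eventually_mono) auto
  show "\<forall>\<^sub>F x::real in at_right 0. 2 * x \<noteq> 0"
    using eventually_at_right_less by (rule eventually_mono) auto
  show "\<forall>\<^sub>F x in at_right 0. ((\<lambda>r. g r + g (- r) - 2 * g 0) has_real_derivative g' x - g' (- x)) (at x)"
    using eventually_at_right_real[OF d]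
  proof (rule eventually_mono)
    fix x assume x: "x \<in> {0<..<d}"
    show "((\<lambda>r. g r + g (- r) - 2 * g 0) has_real_derivative g' x - g' (- x)) (at x)"
      using x by (auto intro!: derivative_eq_intros g DERIV_chain2[of g "g' (-x)" "\<lambda>r. -r" x "- 1"])
  qed
  show "\<forall>\<^sub>F x::real in at_right 0. ((\<lambda>r. r\<^sup>2) has_real_derivative 2 * x) (at x)"
    by (intro always_eventually allI) (auto intro!: derivative_eq_intros)
  have q: "((\<lambda>r. (g' r - g' 0) / r) \<longlongrightarrow> c) (at 0)"
    using g' by (simp add: has_field_derivative_iff)
  then have q1: "((\<lambda>r. (g' r - g' 0) / r) \<longlongrightarrow> c) (at_right 0)"
    and q2: "((\<lambda>r. (g' (-r) - g' 0) / (-r)) \<longlongrightarrow> c) (at_right 0)"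
    unfolding filterlim_at_split at_left_minus[of 0] filterlim_filtermap by auto
  have "((\<lambda>r. ((g' r - g' 0) / r + (g' (-r) - g' 0) / (-r)) / 2) \<longlongrightarrow> (c + c) / 2) (at_right 0)"
    by (intro tendsto_intros q1 q2) auto
  then show "((\<lambda>x. (g' x - g' (- x)) / (2 * x)) \<longlongrightarrow> c) (at_right 0)"
    by (simp add: field_simps diff_divide_distrib add_divide_distrib)
qed

text \<open>On each coordinate line through \<open>y\<close> the second difference quotient tends to
  the pure second derivative, and these derivatives add up to the Laplacian.\<close>

lemma harmonic_on_imp_stencil_harmonic:
  assumes "open D" "harmonic_on D u" "y \<in> D"
  shows "stencil_harmonic u y"
proof -
  have C2: "Ck_on (Suc (Suc 0)) u D" and lap: "laplacian u y = 0"
    using assms by (auto simp: harmonic_on_def numeral_2_eq_2)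
  have du: "u differentiable (at x)" if "x \<in> D" for x
    using C2 that assms(1) by (simp add: differentiable_on_eq_differentiable_at)
  have ddu: "(\<lambda>x. frechet_derivative u (at x) b) differentiable (at x)" if "x \<in> D" "b \<in> Basis" for x b
    using C2 that assms(1) by (simp add: differentiable_on_eq_differentiable_at)
  obtain d where d: "d > 0" "ball y d \<subseteq> D" using assms open_contains_ball by blast
  have lim: "((\<lambda>r. (u (y + r *\<^sub>R b) + u (y - r *\<^sub>R b) - 2 * u y) / r\<^sup>2) \<longlongrightarrow>
      frechet_derivative (\<lambda>z. frechet_derivative u (at z) b) (at y) b) (at_right 0)"
    if b: "b \<in> Basis" for b
  proof -
    have line: "((\<lambda>t. y + t *\<^sub>R b) has_derivative (\<lambda>s. s *\<^sub>R b)) (at t)" for t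
      by (auto intro!: derivative_eq_intros)
    have der: "((\<lambda>t. f (y + t *\<^sub>R b)) has_real_derivative frechet_derivative f (at (y + t *\<^sub>R b)) b) (at t)"
      if "f differentiable (at (y + t *\<^sub>R b))" for f :: "'a \<Rightarrow> real" and t
    proof -
      have F: "(f has_derivative frechet_derivative f (at (y + t *\<^sub>R b))) (at (y + t *\<^sub>R b))"
        using that by (simp add: frechet_derivative_works)
      have L: "linear (frechet_derivative f (at (y + t *\<^sub>R b)))"
        using F has_derivative_linear by blast
      have "((\<lambda>t. f (y + t *\<^sub>R b)) has_derivative
          (\<lambda>s. frechet_derivative f (at (y + t *\<^sub>R b)) (s *\<^sub>R b))) (at t)"
        using diff_chain_at[OF line F] by (simp add: o_def)
      then show ?thesis
        using linear_scale[OF L] by (simp add: has_field_derivative_def mult.commute[of _ "frechet_derivative f (at (y + t *\<^sub>R b)) b"])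
    qed
    have inD: "y + t *\<^sub>R b \<in> D" if "\<bar>t\<bar> < d" for t
      using d(2) that b by (auto simp: subset_iff dist_norm)
    have "((\<lambda>r. (u (y + r *\<^sub>R b) + u (y + (- r) *\<^sub>R b) - 2 * u (y + 0 *\<^sub>R b)) / r\<^sup>2) \<longlongrightarrow>
      frechet_derivative (\<lambda>z. frechet_derivative u (at z) b) (at y) b) (at_right 0)"
      apply (rule second_difference_tendsto[OF d(1),
           where g' = "\<lambda>t. frechet_derivative u (at (y + t *\<^sub>R b)) b"])
      subgoal using der[OF du[OF inD]] by simp
      subgoal using der[of "\<lambda>z. frechet_derivative u (at z) b" 0] ddu[OF assms(3) b] by simp
      done
    then show ?thesis by simp
  qed
  have "((\<lambda>r. \<Sum>b\<in>Basis. (u (y + r *\<^sub>R b) + u (y - r *\<^sub>R b) - 2 * u y) / r\<^sup>2) \<longlongrightarrow> laplacian u y) (at_right 0)"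
    unfolding laplacian_def by (rule tendsto_sum) (rule lim)
  then show ?thesis unfolding stencil_harmonic_def stencil_def lap sum_divide_distrib .
qed

section \<open>The stencil of the planar logarithm\<close>

lemma sum_Basis_real2:
  fixes f :: "real^2 \<Rightarrow> 'a::comm_monoid_add"
  shows "(\<Sum>b\<in>Basis. f b) = f (axis 1 1) + f (axis 2 1)"
proof -
  have B: "(Basis :: (real^2) set) = {axis 1 1, axis 2 1}"
    by (auto simp: Basis_vec_def UNIV_2)
  have "axis 1 1 \<noteq> (axis 2 1 :: real^2)" by (simp add: axis_eq_axis)
  then show ?thesis unfolding B by (subst sum.insert) auto
qed

lemma norm_sq_real2: "(norm (z::real^2))\<^sup>2 = (z$1)\<^sup>2 + (z$2)\<^sup>2"
  unfolding power2_norm_eq_inner by (simp add: inner_vec_def sum_2 power2_eq_square)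

text \<open>In complex notation the four neighbours \<open>z \<plusminus> r\<close>, \<open>z \<plusminus> \<i> r\<close> multiply to \<open>z^4 - r^4\<close>, so the
  stencil of \<open>ln |z|\<close> is \<open>ln |1 - (r/z)^4|\<close>.\<close>

lemma stencil_ln_norm_bound:
  fixes z :: "real^2"
  assumes z: "z \<noteq> 0" and r: "r^4 \<le> (norm z)^4 / 2"
  shows "\<bar>stencil (\<lambda>z. ln (norm z)) z r\<bar> \<le> 2 * r^4 / (norm z)^4"
proof -
  define t where "t = r^4 / (norm z)^4"
  have nz: "norm z > 0" using z by simp
  have t: "0 \<le> t" "t \<le> 1/2" using r nz by (auto simp: t_def field_simps)
  define N where "N = (norm z)\<^sup>2"
  define a b where "a = z$1" and "b = z$2"
  have N: "N = a\<^sup>2 + b\<^sup>2" by (simp add: N_def norm_sq_real2 a_def b_def)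
  have N0: "N > 0" using nz by (simp add: N_def)
  have rt: "r^4 = t * N^2" using nz by (simp add: t_def N_def flip: power_mult)
  define n1 n2 n3 n4 where "n1 = norm (z + r *\<^sub>R axis 1 1)" and "n2 = norm (z - r *\<^sub>R axis 1 1)"
    and "n3 = norm (z + r *\<^sub>R axis 2 1)" and "n4 = norm (z - r *\<^sub>R axis 2 1)"
  have sq: "n1\<^sup>2 = (a + r)\<^sup>2 + b\<^sup>2" "n2\<^sup>2 = (a - r)\<^sup>2 + b\<^sup>2"
     "n3\<^sup>2 = a\<^sup>2 + (b + r)\<^sup>2" "n4\<^sup>2 = a\<^sup>2 + (b - r)\<^sup>2"
    by (simp_all add: n1_def n2_def n3_def n4_def norm_sq_real2 axis_def a_def b_def)
  define P where "P = (n1 * n2 * n3 * n4)\<^sup>2"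
  define s where "s = r\<^sup>2"
  have st2: "s^2 = t * N^2" using rt by (simp add: s_def flip: power_mult)
  have n12: "n1\<^sup>2 * n2\<^sup>2 = (N + s)^2 - 4 * a^2 * s"
    unfolding sq N s_def by (simp add: power2_eq_square algebra_simps)
  have n34: "n3\<^sup>2 * n4\<^sup>2 = (N + s)^2 - 4 * b^2 * s"
    unfolding sq N s_def by (simp add: power2_eq_square algebra_simps)
  have "P = (n1\<^sup>2 * n2\<^sup>2) * (n3\<^sup>2 * n4\<^sup>2)"
    by (simp add: P_def power_mult_distrib)
  also have "\<dots> = ((N + s)^2)^2 - 4 * s * (a^2 + b^2) * (N + s)^2 + 16 * a^2 * b^2 * s^2"
    unfolding n12 n34 by (simp add: power2_eq_square algebra_simps)
  also have "\<dots> = (N^2 - s^2)^2 + 16 * a^2 * b^2 * s^2"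
    unfolding N[symmetric] by (simp add: power2_eq_square algebra_simps)
  \<comment> \<open>This is the squared modulus of \<open>z^4 - r^4\<close> in real coordinates. The
    modulus lies between \<open>N^2 - s^2\<close> and \<open>N^2 + s^2\<close>, where
    \<open>N^2 = |z|^4\<close> and \<open>s^2 = r^4\<close>.\<close>
  finally have P: "P = (N^2 - s^2)^2 + 16 * a^2 * b^2 * s^2" .
  have "4 * a^2 * b^2 \<le> N^2"
    using zero_le_power2[of "a^2 - b^2"] unfolding N by (simp add: power2_eq_square algebra_simps)
  then have "4 * a^2 * b^2 * (4 * s^2) \<le> N^2 * (4 * s^2)" by (rule mult_right_mono) simp
  then have "P \<le> (N^2 + s^2)^2"
    unfolding P by (simp add: power2_eq_square algebra_simps)
  moreover have "(N^2 - s^2)^2 \<le> P" unfolding P by simp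
  moreover have "(1 - t) * N^2 = N^2 - s^2" "(1 + t) * N^2 = N^2 + s^2"
    unfolding st2 by (simp_all add: algebra_simps)
  ultimately have lo: "((1 - t) * N^2)\<^sup>2 \<le> P" and up: "P \<le> ((1 + t) * N^2)\<^sup>2"
    by metis+
  have Ppos: "P > 0"
  proof -
    have "((1 - t) * N^2)\<^sup>2 > 0" using t N0 by simp
    then show ?thesis using lo by linarith
  qed
  have ge: "n1 \<ge> 0" "n2 \<ge> 0" "n3 \<ge> 0" "n4 \<ge> 0"
    by (simp_all add: n1_def n2_def n3_def n4_def)
  have "n1 * n2 * n3 * n4 \<noteq> 0" using Ppos unfolding P_def by simp
  then have nn: "n1 > 0" "n2 > 0" "n3 > 0" "n4 > 0"
    using ge by (simp_all add: less_le)
  have prod_lo: "(1 - t) * N^2 \<le> n1 * n2 * n3 * n4"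
    by (rule power2_le_imp_le[OF lo[unfolded P_def]]) (use ge in simp)
  have prod_up: "n1 * n2 * n3 * n4 \<le> (1 + t) * N^2"
    by (rule power2_le_imp_le[OF up[unfolded P_def]]) (use t in simp)
  have st: "stencil (\<lambda>z. ln (norm z)) z r = ln (n1 * n2 * n3 * n4) - ln (N^2)"
  proof -
    have "ln (N^2) = 4 * ln (norm z)" using nz by (simp add: N_def ln_realpow flip: power_mult)
    moreover have "ln (n1 * n2 * n3 * n4) = ln n1 + ln n2 + ln n3 + ln n4"
      using nn by (simp add: ln_mult)
    ultimately show ?thesis
      unfolding stencil_def sum_Basis_real2
      unfolding n1_def[symmetric] n2_def[symmetric] n3_def[symmetric] n4_def[symmetric] by linarith
  qed
  have "ln (n1 * n2 * n3 * n4) \<le> ln ((1 + t) * N^2)"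
    using prod_up nn t N0 by (intro ln_mono) auto
  also have "\<dots> = ln (1 + t) + ln (N^2)" using t N0 by (intro ln_mult_pos) auto
  finally have "stencil (\<lambda>z. ln (norm z)) z r \<le> t" using st ln_add_one_self_le_self[OF t(1)] by simp
  moreover have "ln ((1 - t) * N^2) \<le> ln (n1 * n2 * n3 * n4)"
    using prod_lo t N0 by (intro ln_mono) auto
  moreover have "ln ((1 - t) * N^2) = ln (1 - t) + ln (N^2)" using t N0 by (intro ln_mult_pos) auto
  \<comment> \<open>Here \<open>t \<le> 1/2\<close> absorbs the quadratic term; this lower bound is
    the source of the factor 2 in the claim.\<close>
  moreover have "- 2 * t \<le> ln (1 - t)"
  proof -
    have "- t - 2 * t\<^sup>2 \<le> ln (1 - t)" by (rule ln_one_minus_pos_lower_bound) (use t in auto)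
    moreover have "2 * t\<^sup>2 \<le> t" using t mult_right_mono[of "2*t" 1 t] by (simp add: power2_eq_square)
    ultimately show ?thesis by simp
  qed
  ultimately show ?thesis using st t by (simp add: t_def abs_le_iff)
qed

section \<open>The Green function\<close>

lemma stencil_shift: "stencil (\<lambda>x. u (x - c)) y r = stencil u (y - c) r"
  unfolding stencil_def by (simp add: algebra_simps)

lemma stencil_ln_dist: "stencil (\<lambda>y. ln (norm (p - y))) y r = stencil (\<lambda>z. ln (norm z)) (y - p) r"
  using stencil_shift[of "\<lambda>z. ln (norm z)" p y r] by (simp add: norm_minus_commute)

text \<open>The stencil is of order \<open>r^4\<close>, so it vanishes even after division by
  \<open>r^2\<close>.\<close>

lemma stencil_harmonic_ln_norm:
  fixes x y :: "real^2"
  assumes "x \<noteq> y"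
  shows "stencil_harmonic (\<lambda>x. ln (norm (x - y))) x"
proof -
  define n where "n = norm (x - y)"
  have n: "n > 0" using assms by (simp add: n_def)
  show ?thesis unfolding stencil_harmonic_def
  proof (rule Lim_null_comparison)
    show "((\<lambda>r::real. 2 * r\<^sup>2 / n^4) \<longlongrightarrow> 0) (at_right 0)"
      using n by (auto intro!: tendsto_eq_intros)
    have "((\<lambda>r::real. r^4) \<longlongrightarrow> 0) (at_right 0)" by (auto intro!: tendsto_eq_intros)
    then have "\<forall>\<^sub>F r::real in at_right 0. r^4 < n^4 / 2"
      by (rule order_tendstoD) (use n in simp)
    then show "\<forall>\<^sub>F r in at_right 0. norm (stencil (\<lambda>x. ln (norm (x - y))) x r / r\<^sup>2) \<le> 2 * r\<^sup>2 / n^4"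
      using eventually_at_right_less
    proof eventually_elim
      case (elim r)
      have "\<bar>stencil (\<lambda>x. ln (norm (x - y))) x r\<bar> \<le> 2 * r^4 / n^4"
        using stencil_ln_norm_bound[of "x - y" r] assms elim
        unfolding stencil_shift[of "\<lambda>z. ln (norm z)"] by (simp add: n_def)
      then have "\<bar>stencil (\<lambda>x. ln (norm (x - y))) x r\<bar> / r\<^sup>2 \<le> 2 * r^4 / n^4 / r\<^sup>2"
        by (rule divide_right_mono) simp
      also have "\<dots> = 2 * r\<^sup>2 / n^4" using elim by (simp add: power4_eq_xxxx power2_eq_square)
      finally show ?case by simp
    qed
  qed
qed

lemma ln_diff_le:
  fixes a b d :: real
  assumes "d > 0" "a \<ge> d" "b \<ge> d"
  shows "\<bar>ln a - ln b\<bar> \<le> \<bar>a - b\<bar> / d"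
proof -
  have *: "ln a - ln b \<le> \<bar>a - b\<bar> / d" if "a \<ge> d" "b \<ge> d" for a b
  proof -
    have "ln a - ln b = ln (a / b)" using that assms(1) by (simp add: ln_div)
    also have "\<dots> \<le> a / b - 1" using that assms(1) by (intro ln_le_minus_one) auto
    also have "\<dots> = (a - b) / b" using that assms(1) by (simp add: field_simps)
    also have "\<dots> \<le> \<bar>a - b\<bar> / b" using that assms(1) by (intro divide_right_mono) auto
    also have "\<dots> \<le> \<bar>a - b\<bar> / d" using that assms(1) by (intro divide_left_mono) auto
    finally show ?thesis .
  qed
  show ?thesis using *[of a b] *[of b a] assms by (auto simp: abs_le_iff abs_minus_commute)
qed

locale green_domain =
  fixes D :: "(real^2) set" and G h :: "real^2 \<Rightarrow> real^2 \<Rightarrow> real"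
  assumes open_D: "open D" and bounded_D: "bounded D" and green: "green_function D G h"
begin

lemma G_eq: "x \<in> D \<Longrightarrow> y \<in> D \<Longrightarrow> x \<noteq> y \<Longrightarrow> G x y = - ln (norm (x - y)) / (2 * pi) - h x y"
  using green by (auto simp: green_function_def ln_div)

lemma h_harmonic: "y \<in> D \<Longrightarrow> harmonic_on D (\<lambda>x. h x y)"
  using green by (auto simp: green_function_def)

lemma G_boundary: "y \<in> D \<Longrightarrow> p \<in> frontier D \<Longrightarrow> ((\<lambda>x. G x y) \<longlongrightarrow> 0) (at p within D)"
  using green by (auto simp: green_function_def)

lemma frontier_not_in_D: "p \<in> frontier D \<Longrightarrow> p \<notin> D"
  using open_D by (simp add: frontier_def interior_open)

text \<open>The Dirichlet problem in a form that is linear in its data: a linear combination of the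
  functions \<open>h x y\<close> over several poles \<open>y\<close> is again of this kind, and is
  therefore controlled by the same combination of logarithms on the frontier.\<close>

definition harmonic_extension :: "(real^2 \<Rightarrow> real) \<Rightarrow> (real^2 \<Rightarrow> real) \<Rightarrow> bool" where
  "harmonic_extension u \<phi> \<longleftrightarrow> continuous_on D u \<and> (\<forall>x\<in>D. stencil_harmonic u x) \<and>
     (\<forall>p\<in>frontier D. (u \<longlongrightarrow> \<phi> p) (at p within D))"

lemma harmonic_extension_le:
  assumes "harmonic_extension u \<phi>" "\<And>p. p \<in> frontier D \<Longrightarrow> \<phi> p \<le> C" "x \<in> D"
  shows "u x \<le> C"
proof (rule stencil_max_principle[OF open_D bounded_D _ _ _ assms(3)])
  fix p e assume p: "p \<in> frontier D" and e: "(e::real) > 0"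
  have "(u \<longlongrightarrow> \<phi> p) (at p within D)" using assms(1) p by (simp add: harmonic_extension_def)
  moreover have "\<phi> p < C + e" using assms(2)[OF p] e by simp
  ultimately have "\<forall>\<^sub>F x in at p within D. u x < C + e" by (rule order_tendstoD)
  then show "\<forall>\<^sub>F x in at p within D. u x \<le> C + e" by eventually_elim simp
qed (use assms(1) in \<open>auto simp: harmonic_extension_def\<close>)

lemma harmonic_extension_cmult:
  "harmonic_extension u \<phi> \<Longrightarrow> harmonic_extension (\<lambda>x. c * u x) (\<lambda>p. c * \<phi> p)"
  unfolding harmonic_extension_def
  by (auto intro!: continuous_intros stencil_harmonic_cmult tendsto_mult_left)

lemma harmonic_extension_add:
  "harmonic_extension u \<phi> \<Longrightarrow> harmonic_extension v \<theta> \<Longrightarrow>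
    harmonic_extension (\<lambda>x. u x + v x) (\<lambda>p. \<phi> p + \<theta> p)"
  unfolding harmonic_extension_def
  by (auto intro!: continuous_intros stencil_harmonic_add tendsto_add)

lemma harmonic_extension_diff:
  "harmonic_extension u \<phi> \<Longrightarrow> harmonic_extension v \<theta> \<Longrightarrow>
    harmonic_extension (\<lambda>x. u x - v x) (\<lambda>p. \<phi> p - \<theta> p)"
  unfolding harmonic_extension_def
  by (auto intro!: continuous_intros stencil_harmonic_diff tendsto_diff)

lemma harmonic_extension_sum:
  "(\<And>i. i \<in> I \<Longrightarrow> harmonic_extension (u i) (\<phi> i)) \<Longrightarrow>
    harmonic_extension (\<lambda>x. \<Sum>i\<in>I. u i x) (\<lambda>p. \<Sum>i\<in>I. \<phi> i p)"
  unfolding harmonic_extension_def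
  by (auto intro!: continuous_intros stencil_harmonic_sum tendsto_sum)

lemma harmonic_extension_abs_le:
  assumes "harmonic_extension u \<phi>" "\<And>p. p \<in> frontier D \<Longrightarrow> \<bar>\<phi> p\<bar> \<le> C" "x \<in> D"
  shows "\<bar>u x\<bar> \<le> C"
proof -
  have "u x \<le> C" using harmonic_extension_le[OF assms(1) _ assms(3)] assms(2) by (force simp: abs_le_iff)
  moreover have "-1 * u x \<le> C"
    using harmonic_extension_le[OF harmonic_extension_cmult[OF assms(1), of "-1"] _ assms(3)] assms(2)
    by (force simp: abs_le_iff)
  ultimately show ?thesis by (simp add: abs_le_iff)
qed

section \<open>Regularity of the regular part; sign and symmetry of the Green function\<close>

lemma continuous_h_fst: "y \<in> D \<Longrightarrow> continuous_on D (\<lambda>x. h x y)"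
  using h_harmonic[of y] by (auto simp: harmonic_on_def numeral_2_eq_2 intro: differentiable_imp_continuous_on)

lemma stencil_harmonic_h_fst: "x \<in> D \<Longrightarrow> y \<in> D \<Longrightarrow> stencil_harmonic (\<lambda>x. h x y) x"
  using harmonic_on_imp_stencil_harmonic[OF open_D h_harmonic] by blast

text \<open>Near the frontier \<open>h\<close> is the logarithm minus \<open>G\<close>, and
  \<open>G\<close> tends to 0 there.\<close>

lemma harmonic_extension_h:
  assumes y: "y \<in> D"
  shows "harmonic_extension (\<lambda>x. h x y) (\<lambda>p. - ln (norm (p - y)) / (2 * pi))"
  unfolding harmonic_extension_def
proof (intro conjI ballI)
  fix p assume p: "p \<in> frontier D"
  have py: "p \<noteq> y" using frontier_not_in_D[OF p] y by auto
  have "((\<lambda>x. - ln (norm (x - y)) / (2 * pi) - G x y) \<longlongrightarrow> - ln (norm (p - y)) / (2 * pi) - 0) (at p within D)"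
    using py by (intro tendsto_intros G_boundary[OF y p]) auto
  moreover have "\<forall>\<^sub>F x in at p within D. - ln (norm (x - y)) / (2 * pi) - G x y = h x y"
  proof -
    have "\<forall>\<^sub>F x in at p within D. x \<in> D" by (simp add: eventually_at_filter)
    moreover have "\<forall>\<^sub>F x in at p within D. x \<noteq> y"
      using py tendsto_imp_eventually_ne[OF tendsto_ident_at] by blast
    ultimately show ?thesis by eventually_elim (use G_eq y in auto)
  qed
  ultimately show "((\<lambda>x. h x y) \<longlongrightarrow> - ln (norm (p - y)) / (2 * pi)) (at p within D)"
    using tendsto_cong by force
qed (use y continuous_h_fst stencil_harmonic_h_fst in auto)

text \<open>The maximum principle is applied to \<open>- G\<close> on the punctured domain. The pole
  becomes a frontier point at which \<open>- G\<close> tends to minus infinity, which the one-sided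
  boundary condition admits.\<close>

lemma G_nonneg:
  assumes x: "x \<in> D" and y: "y \<in> D" and xy: "x \<noteq> y"
  shows "0 \<le> G x y"
proof -
  define u where "u z = ln (norm (z - y)) / (2 * pi) + h z y" for z
  have uG: "u z = - G z y" if "z \<in> D" "z \<noteq> y" for z
    using G_eq[OF that(1) y that(2)] by (simp add: u_def)
  have "u x \<le> 0"
  proof (rule stencil_max_principle[where u = u and D = "D - {y}" and c = 0 and ?x0.0 = x])
    show "open (D - {y})" "bounded (D - {y})" "x \<in> D - {y}"
      using open_D bounded_D x xy by auto
    show "continuous_on (D - {y}) u" unfolding u_def
      by (intro continuous_intros continuous_on_subset[OF continuous_h_fst[OF y]]) auto
    fix z assume "z \<in> D - {y}"
    then show "stencil_harmonic u z"
      using stencil_harmonic_add[OF stencil_harmonic_cmult[OF stencil_harmonic_ln_norm[of z y], of "1/(2*pi)"]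
          stencil_harmonic_h_fst[of z y]] y by (auto simp: u_def[abs_def])
  next
    fix p e assume p: "p \<in> frontier (D - {y})" and e: "(e::real) > 0"
    have "p \<in> frontier D \<or> p = y"
    proof (cases "p = y")
      case False
      have "p \<in> closure D" using p closure_mono[of "D - {y}" D] by (auto simp: frontier_def)
      moreover have "p \<notin> D - {y}" using p open_D
        by (simp add: frontier_def interior_open open_delete)
      ultimately show ?thesis using open_D by (auto simp: frontier_def interior_open)
    qed simp
    moreover have in_D: "\<forall>\<^sub>F z in at p within (D - {y}). z \<in> D - {y}" by (simp add: eventually_at_filter)
    ultimately show "\<forall>\<^sub>F z in at p within (D - {y}). u z \<le> 0 + e"
    proof (elim disjE)
      assume "p \<in> frontier D"
      then have "((\<lambda>z. G z y) \<longlongrightarrow> 0) (at p within (D - {y}))"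
        using tendsto_within_subset[OF G_boundary[OF y]] by blast
      then have "\<forall>\<^sub>F z in at p within (D - {y}). - e < G z y"
        using e by (intro order_tendstoD) auto
      then show ?thesis using in_D by eventually_elim (use uG in auto)
    next
      assume py: "p = y"
      have "isCont (\<lambda>z. h z y) y"
        using continuous_h_fst[OF y] open_D y by (simp add: continuous_on_eq_continuous_at)
      then have "((\<lambda>z. h z y) \<longlongrightarrow> h y y) (at y within (D - {y}))"
        unfolding isCont_def by (rule tendsto_within_subset) simp
      then have h1: "\<forall>\<^sub>F z in at p within (D - {y}). h z y < h y y + 1"
        unfolding py by (rule order_tendstoD) simp
      have "((\<lambda>z. norm (z - y)) \<longlongrightarrow> 0) (at y within (D - {y}))"
        by (auto intro!: tendsto_eq_intros)
      \<comment> \<open>Within this radius the logarithmic term is at most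
        \<open>- (h y y + 1)\<close>, which outweighs \<open>h z y < h y y + 1\<close>.\<close>
      then have "\<forall>\<^sub>F z in at p within (D - {y}). norm (z - y) < exp (- 2 * pi * (h y y + 1))"
        unfolding py by (rule order_tendstoD) simp
      then show ?thesis using h1 in_D
      proof eventually_elim
        case (elim z)
        have "ln (norm (z - y)) \<le> ln (exp (- 2 * pi * (h y y + 1)))"
          using elim by (subst ln_le_cancel_iff) auto
        then have "ln (norm (z - y)) / (2 * pi) \<le> - (h y y + 1)" by (simp add: field_simps)
        then show ?case using elim e by (simp add: u_def)
      qed
    qed
  qed
  then show ?thesis using uG x xy by simp
qed

text \<open>No frontier point is farther than \<open>R\<close> from the pole, so \<open>- h\<close>
  is at most \<open>ln R / (2 * pi)\<close> on the frontier and hence inside.\<close>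

lemma h_lower:
  assumes R: "\<And>p q. p \<in> closure D \<Longrightarrow> q \<in> closure D \<Longrightarrow> dist p q \<le> R" and x: "x \<in> D" and y: "y \<in> D"
  shows "- ln R / (2 * pi) \<le> h x y"
proof -
  have "-1 * h x y \<le> ln R / (2 * pi)"
  proof (rule harmonic_extension_le[OF harmonic_extension_cmult[OF harmonic_extension_h[OF y]] _ x])
    fix p assume p: "p \<in> frontier D"
    then have "0 < norm (p - y)" using frontier_not_in_D y by auto
    moreover have "norm (p - y) \<le> R" using R[of p y] p y closure_subset by (auto simp: dist_norm frontier_def)
    ultimately have "ln (norm (p - y)) \<le> ln R" by (intro ln_mono) auto
    then show "- 1 * (- ln (norm (p - y)) / (2 * pi)) \<le> ln R / (2 * pi)"
      by (simp add: divide_right_mono)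
  qed
  then show ?thesis by simp
qed

text \<open>Moving the pole changes the boundary data by a difference of logarithms, which is
  Lipschitz as long as both poles stay at distance \<open>d\<close> from the frontier. The maximum
  principle carries this to the interior, uniformly in \<open>x\<close>.\<close>

lemma h_lipschitz_snd:
  assumes "x \<in> D" "y \<in> D" "y' \<in> D" "d > 0"
    and "\<And>p. p \<in> frontier D \<Longrightarrow> norm (p - y) \<ge> d \<and> norm (p - y') \<ge> d"
  shows "\<bar>h x y - h x y'\<bar> \<le> norm (y - y') / d"
proof (rule harmonic_extension_abs_le[OF harmonic_extension_diff[OF harmonic_extension_h harmonic_extension_h] _ assms(1)])
  fix p assume p: "p \<in> frontier D"
  have "\<bar>ln (norm (p - y')) - ln (norm (p - y))\<bar> \<le> \<bar>norm (p - y') - norm (p - y)\<bar> / d"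
    using assms(5)[OF p] by (intro ln_diff_le assms) auto
  also have "\<dots> \<le> norm (y - y') / d"
    using norm_triangle_ineq3[of "p - y'" "p - y"] assms(4) by (intro divide_right_mono) auto
  finally have *: "\<bar>ln (norm (p - y')) - ln (norm (p - y))\<bar> \<le> norm (y - y') / d" .
  have "\<bar>- ln (norm (p - y)) / (2 * pi) - - ln (norm (p - y')) / (2 * pi)\<bar>
      = \<bar>ln (norm (p - y')) - ln (norm (p - y))\<bar> / (2 * pi)"
    by (simp add: field_simps abs_divide flip: diff_divide_distrib)
  also have "\<dots> \<le> \<bar>ln (norm (p - y')) - ln (norm (p - y))\<bar> / 1"
    using pi_gt3 by (intro divide_left_mono) auto
  finally show "\<bar>- ln (norm (p - y)) / (2 * pi) - - ln (norm (p - y')) / (2 * pi)\<bar> \<le> norm (y - y') / d"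
    using * by simp
qed (use assms in auto)

lemma frontier_dist:
  assumes "ball y d \<subseteq> D" "p \<in> frontier D"
  shows "norm (p - y) \<ge> d"
  using assms frontier_not_in_D[OF assms(2)] by (force simp: dist_norm norm_minus_commute)

text \<open>Continuity in the first variable at a fixed pole combines with the Lipschitz bound in
  the pole because the latter is uniform in the first variable.\<close>

lemma continuous_h: "continuous_on (D \<times> D) (\<lambda>z. h (fst z) (snd z))"
proof -
  have "isCont (\<lambda>z. h (fst z) (snd z)) (x0, y0)" if x0: "x0 \<in> D" and y0: "y0 \<in> D" for x0 y0
  proof -
    obtain e where e: "e > 0" "ball y0 e \<subseteq> D" using open_D y0 open_contains_ball by blast
    \<comment> \<open>Half of the radius: every pole within \<open>d\<close> of \<open>y0\<close>
      still has a ball of radius \<open>d\<close> inside \<open>D\<close>.\<close>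
    define d where "d = e / 2"
    have d: "d > 0" using e by (simp add: d_def)
    have lim1: "((\<lambda>z. fst z) \<longlongrightarrow> x0) (at (x0, y0))" "((\<lambda>z. snd z) \<longlongrightarrow> y0) (at (x0, y0))"
      by (auto intro!: tendsto_eq_intros)
    have c: "isCont (\<lambda>x. h x y0) x0"
      using continuous_h_fst[OF y0] open_D x0 by (simp add: continuous_on_eq_continuous_at)
    have "((\<lambda>z. h (fst z) y0) \<longlongrightarrow> h x0 y0) (at (x0, y0))"
      using isCont_tendsto_compose[OF c lim1(1)] .
    moreover have "((\<lambda>z. h (fst z) (snd z) - h (fst z) y0) \<longlongrightarrow> 0) (at (x0, y0))"
    proof (rule Lim_null_comparison)
      have "((\<lambda>z. norm (snd z - y0) / d) \<longlongrightarrow> norm (y0 - y0) / d) (at (x0, y0))"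
        using d by (intro tendsto_intros lim1) auto
      then show "((\<lambda>z. norm (snd z - y0) / d) \<longlongrightarrow> 0) (at (x0, y0))" by simp
      have "\<forall>\<^sub>F z in at (x0, y0). fst z \<in> D" using lim1(1) open_D x0 by (rule topological_tendstoD)
      moreover have "\<forall>\<^sub>F z in at (x0, y0). snd z \<in> ball y0 d"
        using topological_tendstoD[OF lim1(2), of "ball y0 d"] d by simp
      ultimately show "\<forall>\<^sub>F z in at (x0, y0). norm (h (fst z) (snd z) - h (fst z) y0) \<le> norm (snd z - y0) / d"
      proof eventually_elim
        case (elim z)
        have sub: "ball (snd z) d \<subseteq> D" "ball y0 d \<subseteq> D"
          using elim(2) e(2) d by (auto simp: d_def subset_iff) (smt (verit) dist_triangle field_sum_of_halves)
        show ?case unfolding real_norm_def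
          by (rule h_lipschitz_snd[OF elim(1) _ y0 d])
            (use sub(1) d y0 frontier_dist[OF sub(1)] frontier_dist[OF sub(2)] in auto)
      qed
    qed
    ultimately have "((\<lambda>z. (h (fst z) (snd z) - h (fst z) y0) + h (fst z) y0) \<longlongrightarrow> 0 + h x0 y0) (at (x0, y0))"
      by (intro tendsto_add)
    then show ?thesis by (simp add: isCont_def)
  qed
  then show ?thesis by (auto intro!: continuous_at_imp_continuous_on)
qed

text \<open>The stencil in the pole is a linear combination of \<open>h\<close> over five poles, so
  as a function of \<open>x\<close> it extends the stencil of the logarithm from the frontier. There
  the latter is of order \<open>r^4\<close> uniformly, and the maximum principle gives the same
  bound inside.\<close>

lemma stencil_harmonic_h_snd:
  assumes x: "x \<in> D" and y: "y \<in> D"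
  shows "stencil_harmonic (\<lambda>y. h x y) y"
proof -
  obtain d where d: "d > 0" "ball y d \<subseteq> D" using open_D y open_contains_ball by blast
  have bound: "\<bar>stencil (\<lambda>y. h x y) y r\<bar> \<le> 2 * r^4 / d^4" if r: "0 < r" "r < d" "r^4 < d^4/2" for r
  proof -
    have inD: "y + r *\<^sub>R b \<in> D" "y - r *\<^sub>R b \<in> D" if "b \<in> Basis" for b
      using d(2) r that by (auto simp: dist_norm subset_iff)
    have "harmonic_extension (\<lambda>x. stencil (\<lambda>y. h x y) y r)
        (\<lambda>p. stencil (\<lambda>y. - ln (norm (p - y)) / (2 * pi)) y r)"
      unfolding stencil_def
      by (intro harmonic_extension_sum harmonic_extension_add harmonic_extension_diff
          harmonic_extension_cmult harmonic_extension_h inD y)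
    then show ?thesis
    proof (rule harmonic_extension_abs_le[OF _ _ x])
      fix p assume p: "p \<in> frontier D"
      have dn: "d \<le> norm (y - p)" using frontier_dist[OF d(2) p] by (simp add: norm_minus_commute)
      then have d4: "d^4 \<le> norm (y - p)^4" using d(1) by (intro power_mono) auto
      have "\<bar>stencil (\<lambda>z. ln (norm z)) (y - p) r\<bar> \<le> 2 * r^4 / norm (y - p)^4"
      proof (rule stencil_ln_norm_bound)
        show "y - p \<noteq> 0" using dn d(1) by auto
        show "r^4 \<le> norm (y - p)^4 / 2" using d4 r(3) by linarith
      qed
      also have "\<dots> \<le> 2 * r^4 / d^4" using d4 d(1) dn by (intro divide_left_mono mult_pos_pos zero_less_power) auto
      finally have *: "\<bar>stencil (\<lambda>z. ln (norm z)) (y - p) r\<bar> \<le> 2 * r^4 / d^4" .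
      have "stencil (\<lambda>y. - ln (norm (p - y)) / (2 * pi)) y r = (- 1 / (2 * pi)) * stencil (\<lambda>z. ln (norm z)) (y - p) r"
        using stencil_cmult[of "- 1 / (2 * pi)" "\<lambda>y. ln (norm (p - y))" y r] by (simp add: stencil_ln_dist)
      then have "\<bar>stencil (\<lambda>y. - ln (norm (p - y)) / (2 * pi)) y r\<bar> = \<bar>stencil (\<lambda>z. ln (norm z)) (y - p) r\<bar> / (2 * pi)"
        by (simp add: abs_mult)
      also have "\<dots> \<le> \<bar>stencil (\<lambda>z. ln (norm z)) (y - p) r\<bar> / 1"
        using pi_gt3 by (intro divide_left_mono) auto
      finally show "\<bar>stencil (\<lambda>y. - ln (norm (p - y)) / (2 * pi)) y r\<bar> \<le> 2 * r^4 / d^4" using * by simp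
    qed
  qed
  show ?thesis unfolding stencil_harmonic_def
  proof (rule Lim_null_comparison)
    show "((\<lambda>r::real. 2 * r\<^sup>2 / d^4) \<longlongrightarrow> 0) (at_right 0)"
      using d by (auto intro!: tendsto_eq_intros)
    have "((\<lambda>r::real. r^4) \<longlongrightarrow> 0) (at_right 0)" by (auto intro!: tendsto_eq_intros)
    then have "\<forall>\<^sub>F r::real in at_right 0. r^4 < d^4 / 2"
      by (rule order_tendstoD) (use d in simp)
    then show "\<forall>\<^sub>F r in at_right 0. norm (stencil (\<lambda>y. h x y) y r / r\<^sup>2) \<le> 2 * r\<^sup>2 / d^4"
      using eventually_at_right_real[OF d(1)]
    proof eventually_elim
      case (elim r)
      have "\<bar>stencil (\<lambda>y. h x y) y r\<bar> / r\<^sup>2 \<le> 2 * r^4 / d^4 / r\<^sup>2"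
        using bound[of r] elim by (intro divide_right_mono) auto
      also have "\<dots> = 2 * r\<^sup>2 / d^4" using elim by (simp add: power4_eq_xxxx power2_eq_square)
      finally show ?case by simp
    qed
  qed
qed

lemma continuous_h_snd: "x \<in> D \<Longrightarrow> continuous_on D (\<lambda>y. h x y)"
  using continuous_on_compose2[OF continuous_h, of D "\<lambda>y. (x, y)"]
  by (simp add: continuous_on_Pair image_subset_iff)

text \<open>The behaviour of \<open>G x y\<close> as \<open>y\<close> approaches the boundary is not known a priori, but \<open>G \<ge> 0\<close>
  bounds it on the side which the maximum principle needs.\<close>

lemma h_sym_le:
  assumes x: "x \<in> D" and y: "y \<in> D"
  shows "h x y \<le> h y x"
proof -
  have "h x y - h y x \<le> 0"
  proof (rule stencil_max_principle[where u = "\<lambda>y. h x y - h y x", OF open_D bounded_D _ _ _ y])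
    show "continuous_on D (\<lambda>y. h x y - h y x)"
      by (intro continuous_on_diff continuous_h_fst continuous_h_snd x)
    show "stencil_harmonic (\<lambda>y. h x y - h y x) y" if "y \<in> D" for y
      by (intro stencil_harmonic_diff stencil_harmonic_h_fst stencil_harmonic_h_snd x that)
    fix p e assume p: "p \<in> frontier D" and e: "(e::real) > 0"
    have "\<forall>\<^sub>F y in at p within D. G y x < e"
      using G_boundary[OF x p] e by (rule order_tendstoD)
    moreover have "\<forall>\<^sub>F y in at p within D. y \<in> D" by (simp add: eventually_at_filter)
    moreover have "\<forall>\<^sub>F y in at p within D. y \<noteq> x"
      by (rule tendsto_imp_eventually_ne[OF tendsto_ident_at]) (use frontier_not_in_D[OF p] x in auto)
    ultimately show "\<forall>\<^sub>F y in at p within D. h x y - h y x \<le> 0 + e"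
    proof eventually_elim
      case (elim y)
      have "h x y - h y x = G y x - G x y"
        using elim x by (simp add: G_eq norm_minus_commute[of x y])
      then show ?case using elim G_nonneg[of x y] x by auto
    qed
  qed
  then show ?thesis by simp
qed

lemma h_sym: "x \<in> D \<Longrightarrow> y \<in> D \<Longrightarrow> h x y = h y x"
  by (intro antisym h_sym_le)

lemma G_sym: "x \<in> D \<Longrightarrow> y \<in> D \<Longrightarrow> G x y = G y x"
  by (cases "x = y") (simp_all add: G_eq norm_minus_commute[of x y] h_sym[of x y])

end

section \<open>Potentials and the energy form\<close>

text \<open>The part of the logarithmic singularity below the scale \<open>eps\<close>; beyond it
  \<open>G\<close> costs only the constant \<open>ln (R / eps)\<close>.\<close>

definition ln_pole :: "real \<Rightarrow> real^2 \<Rightarrow> real^2 \<Rightarrow> real" where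
  "ln_pole eps x y = max 0 (ln (eps / norm (x - y)))"

lemma ln_pole_nonneg: "0 \<le> ln_pole eps x y"
  by (simp add: ln_pole_def)

lemma ln_pole_measurable [measurable]: "ln_pole eps x \<in> borel_measurable borel"
  unfolding ln_pole_def[abs_def] by measurable

text \<open>Layer-cake bound: \<open>ln\<^sup>+ (eps / |x - y|)\<close> is at most the number of balls \<open>B(x, eps exp (-k))\<close>
  containing \<open>y\<close>.\<close>

lemma nn_integral_ln_pole:
  assumes "eps > 0"
  shows "(\<integral>\<^sup>+ y. ennreal (ln_pole eps x y) \<partial>lebesgue) \<le> ennreal (2 * pi * eps\<^sup>2)"
proof -
  define B where "B k = ball x (eps * exp (- real k))" for k :: nat
  have pw: "ennreal (ln_pole eps x y) \<le> (\<Sum>k. indicator (B k) y)" for y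
  proof (cases "ln_pole eps x y = 0")
    case False
    define s where "s = ln (eps / norm (x - y))"
    have s: "ln_pole eps x y = s" "s > 0" using False by (auto simp: ln_pole_def s_def max_def split: if_splits)
    have xy: "norm (x - y) > 0" using s(2) by (auto simp: s_def)
    have es: "exp s = eps / norm (x - y)" using xy assms by (simp add: s_def)
    define n where "n = nat \<lceil>s\<rceil>"
    have inB: "y \<in> B k" if "k < n" for k
    proof -
      have "real k < s" using that s(2) unfolding n_def by linarith
      then have "exp (real k) < eps / norm (x - y)" unfolding es[symmetric] by simp
      then have "norm (x - y) * exp (real k) < eps" using xy by (simp add: field_simps)
      then have "norm (x - y) < eps / exp (real k)" by (simp add: field_simps)
      then show ?thesis by (simp add: B_def dist_norm exp_minus field_simps)
    qed
    have "ennreal s \<le> of_nat n"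
      using s(2) unfolding n_def by (metis ennreal_leI ennreal_of_nat_eq_real_of_nat real_nat_ceiling_ge)
    also have "of_nat n = (\<Sum>k<n. indicator (B k) y :: ennreal)" using inB by simp
    also have "\<dots> \<le> (\<Sum>k. indicator (B k) y)" by (rule sum_le_suminf) auto
    finally show ?thesis by (simp add: s(1))
  qed simp
  have em: "emeasure lebesgue (B k) = ennreal (pi * eps\<^sup>2 * (exp (- 2)) ^ k)" for k
  proof -
    have "emeasure lebesgue (B k) = emeasure lborel (B k)" by (simp add: B_def)
    also have "\<dots> = ennreal (pi * (eps * exp (- real k))\<^sup>2)"
      using assms unfolding B_def by (subst emeasure_ball) (auto simp: unit_ball_vol_2)
    also have "(eps * exp (- real k))\<^sup>2 = eps\<^sup>2 * (exp (- 2)) ^ k"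
      by (simp add: power_mult_distrib exp_of_nat_mult[symmetric] flip: exp_double)
    finally show ?thesis by (simp add: mult.assoc)
  qed
  \<comment> \<open>The areas of the balls form a geometric series with this ratio, so the sum is at
    most twice the area of the largest ball; this is the constant
    \<open>2 * pi * eps^2\<close>.\<close>
  have e2: "exp (- 2 :: real) \<le> 1/2"
  proof -
    have "(2::real) \<le> exp 2" using exp_ge_add_one_self[of 2] by linarith
    then show ?thesis by (simp add: exp_minus field_simps)
  qed
  have sm: "summable (\<lambda>k. pi * eps\<^sup>2 * (exp (- 2)) ^ k)"
    by (intro summable_mult summable_geometric) simp
  have "(\<integral>\<^sup>+ y. ennreal (ln_pole eps x y) \<partial>lebesgue) \<le> (\<integral>\<^sup>+ y. (\<Sum>k. indicator (B k) y) \<partial>lebesgue)"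
    by (intro nn_integral_mono pw)
  also have "\<dots> = (\<Sum>k. \<integral>\<^sup>+ y. indicator (B k) y \<partial>lebesgue)"
    by (rule nn_integral_suminf) (auto simp: B_def intro!: borel_measurable_indicator)
  also have "\<dots> = (\<Sum>k. ennreal (pi * eps\<^sup>2 * (exp (- 2)) ^ k))"
    by (simp add: em[symmetric] B_def)
  also have "\<dots> = ennreal (\<Sum>k. pi * eps\<^sup>2 * (exp (- 2)) ^ k)"
    by (rule suminf_ennreal2) (use sm in auto)
  also have "(\<Sum>k. pi * eps\<^sup>2 * (exp (- 2)) ^ k) = pi * eps\<^sup>2 * (1 / (1 - exp (- 2)))"
    by (subst suminf_mult) (auto intro!: summable_geometric simp: suminf_geometric)
  also have "\<dots> \<le> pi * eps\<^sup>2 * 2"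
    using e2 by (intro mult_left_mono) (auto simp: field_simps)
  finally show ?thesis by (simp add: ennreal_leI mult_ac)
qed

context green_domain
begin

section \<open>Size and measurability of the kernel\<close>

abbreviation M where "M \<equiv> lebesgue_on D"

abbreviation SF where "SF \<equiv> stream_function D G"

text \<open>The summand 1 gives \<open>R \<ge> 1\<close>: then \<open>ln R\<close> is nonnegative,
  and 1 is always an admissible value of the scale \<open>eps\<close> in the estimates
  below.\<close>

definition R where "R = diameter (closure D) + 1"

lemma R_ge1: "R \<ge> 1"
  using diameter_ge_0[of "closure D"] bounded_closure[OF bounded_D] by (simp add: R_def)

lemma dist_le_R: "p \<in> closure D \<Longrightarrow> q \<in> closure D \<Longrightarrow> dist p q \<le> R"
  using diameter_bounded_bound[of "closure D" p q] bounded_closure[OF bounded_D] by (simp add: R_def)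

lemma D_lebesgue [measurable]: "D \<in> sets lebesgue"
  using open_D by auto

lemma D_lmeasurable: "D \<in> lmeasurable"
  using open_D bounded_D by (simp add: lmeasurable_open)

lemma superlevel_lebesgue:
  fixes a :: real
  assumes "u \<in> borel_measurable M"
  shows "{x\<in>D. u x > a} \<in> sets lebesgue"
proof -
  have "{x \<in> space M. a < u x} \<in> sets M" by (intro borel_measurable_less assms) simp
  then show ?thesis by (simp add: sets_restrict_space_iff)
qed

lemma finite_measure_M: "finite_measure M"
  using D_lmeasurable by (rule finite_measure_lebesgue_on)

lemma sigma_finite_M: "sigma_finite_measure M"
  using finite_measure_M finite_measure.axioms(1) by blast

text \<open>The values \<open>G x x\<close> are arbitrary, which would spoil positivity and joint
  measurability. This version is 0 on the diagonal and gives the same integrals, a point being a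
  null set.\<close>

definition G0 where "G0 x y = (if x = y then 0 else G x y)"

lemma G0_nonneg: "x \<in> D \<Longrightarrow> y \<in> D \<Longrightarrow> 0 \<le> G0 x y"
  by (simp add: G0_def G_nonneg)

lemma G0_sym: "x \<in> D \<Longrightarrow> y \<in> D \<Longrightarrow> G0 x y = G0 y x"
  by (auto simp: G0_def G_sym)

lemma G_le_ln:
  assumes "x \<in> D" "y \<in> D" "x \<noteq> y"
  shows "G x y \<le> ln (R / norm (x - y)) / (2 * pi)"
proof -
  have "- ln R / (2 * pi) \<le> h x y" using assms dist_le_R by (intro h_lower) auto
  moreover have "ln (R / norm (x - y)) = ln R - ln (norm (x - y))"
    using assms R_ge1 by (simp add: ln_div)
  ultimately show ?thesis using G_eq[OF assms] by (simp add: diff_divide_distrib)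
qed

text \<open>Splits the kernel at the scale \<open>eps\<close> into a constant and a singular part of
  small integral.\<close>

lemma G0_le_ln_pole:
  assumes "x \<in> D" "y \<in> D" "0 < eps" "eps \<le> R"
  shows "G0 x y \<le> (ln (R / eps) + ln_pole eps x y) / (2 * pi)"
proof (cases "x = y")
  case True
  then show ?thesis using assms ln_pole_nonneg[of eps x y] by (auto simp: G0_def)
next
  case False
  have "ln (R / norm (x - y)) = ln (R / eps) + ln (eps / norm (x - y))"
    using assms False R_ge1 by (simp add: ln_div)
  also have "\<dots> \<le> ln (R / eps) + ln_pole eps x y" by (simp add: ln_pole_def)
  finally have "ln (R / norm (x - y)) / (2 * pi) \<le> (ln (R / eps) + ln_pole eps x y) / (2 * pi)"
    by (intro divide_right_mono) auto
  then show ?thesis using G_le_ln[OF assms(1,2) False] False by (simp add: G0_def)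
qed

text \<open>Extended by 0 from the open set \<open>D \<times> D\<close>, the continuous function
  \<open>h\<close> is Borel; the explicit formula for \<open>G\<close> then transfers measurability
  to the product of the restricted Lebesgue measures.\<close>

lemma G0_measurable: "(\<lambda>z. G0 (fst z) (snd z)) \<in> borel_measurable (M \<Otimes>\<^sub>M M)"
proof -
  define H where "H z = indicator (D \<times> D) z *\<^sub>R h (fst z) (snd z)" for z
  have H [measurable]: "H \<in> borel_measurable borel"
    unfolding H_def using open_D
    by (intro borel_measurable_continuous_on_indicator continuous_h) (auto intro: borel_open open_Times)
  have id [measurable]: "(\<lambda>x. x) \<in> M \<rightarrow>\<^sub>M borel"
    by (intro measurable_restrict_space1 measurable_completion) simp
  have f [measurable]: "(\<lambda>z. fst z) \<in> M \<Otimes>\<^sub>M M \<rightarrow>\<^sub>M borel" "(\<lambda>z. snd z) \<in> M \<Otimes>\<^sub>M M \<rightarrow>\<^sub>M borel"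
    using measurable_compose[OF measurable_fst id, of M] measurable_compose[OF measurable_snd id, of M] by auto
  have "(\<lambda>z. (fst z, snd z)) \<in> M \<Otimes>\<^sub>M M \<rightarrow>\<^sub>M borel \<Otimes>\<^sub>M (borel :: (real^2) measure)"
    by (intro measurable_Pair f)
  then have "(\<lambda>z. (fst z, snd z)) \<in> M \<Otimes>\<^sub>M M \<rightarrow>\<^sub>M (borel :: ((real^2) \<times> (real^2)) measure)"
    by (simp only: borel_prod)
  then have [measurable]: "(\<lambda>z. H (fst z, snd z)) \<in> borel_measurable (M \<Otimes>\<^sub>M M)"
    using H by (rule measurable_compose)
  have "(\<lambda>z. if fst z = snd z then 0 else - ln (norm (fst z - snd z)) / (2 * pi) - H (fst z, snd z))
      \<in> borel_measurable (M \<Otimes>\<^sub>M M)"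
    by measurable
  also have "?this \<longleftrightarrow> ?thesis"
    by (intro measurable_cong) (auto simp: space_pair_measure G0_def G_eq H_def)
  finally show ?thesis .
qed

lemma G0_measurable_snd: "x \<in> D \<Longrightarrow> G0 x \<in> borel_measurable M"
  using measurable_compose[OF measurable_Pair1' G0_measurable, of x] by simp

lemma AE_neq: "AE y in M. y \<noteq> x"
proof -
  have "AE y in lebesgue. y \<noteq> x"
    using negligible_sing[of x] by (auto simp: negligible_iff_null_sets eventually_ae_filter)
  then have "AE y in lebesgue. y \<in> D \<longrightarrow> y \<noteq> x" by eventually_elim simp
  then show ?thesis by (simp add: AE_restrict_space_iff)
qed

lemma G_eq_G0_AE: "AE y in M. G x y = G0 x y"
  using AE_neq[of x] by eventually_elim (auto simp: G0_def)

lemma G_measurable: assumes "x \<in> D" shows "G x \<in> borel_measurable M"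
proof -
  have id [measurable]: "(\<lambda>x. x) \<in> M \<rightarrow>\<^sub>M borel"
    by (intro measurable_restrict_space1 measurable_completion) simp
  have [measurable]: "G0 x \<in> borel_measurable M" by (rule G0_measurable_snd[OF assms])
  have "(\<lambda>y. if y = x then G x x else G0 x y) \<in> borel_measurable M" by measurable
  moreover have "(\<lambda>y. if y = x then G x x else G0 x y) = G x" by (auto simp: G0_def)
  ultimately show ?thesis by simp
qed

lemma SF_eq_G0:
  assumes "x \<in> D" "f \<in> borel_measurable M"
  shows "SF f x = (LINT y|M. G0 x y * f y)"
  unfolding stream_function_def
proof (rule integral_cong_AE)
  have [measurable]: "G x \<in> borel_measurable M" "G0 x \<in> borel_measurable M" "f \<in> borel_measurable M"
    using assms G_measurable G0_measurable_snd by auto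
  show "(\<lambda>y. G x y * f y) \<in> borel_measurable M" "(\<lambda>y. G0 x y * f y) \<in> borel_measurable M" by measurable
  show "AE y in M. G x y * f y = G0 x y * f y" using G_eq_G0_AE[of x] by eventually_elim simp
qed

lemma ln_pole_integrable:
  assumes "eps > 0"
  shows "integrable M (ln_pole eps x)" and "(LINT y|M. ln_pole eps x y) \<le> 2 * pi * eps\<^sup>2"
proof -
  have m [measurable]: "ln_pole eps x \<in> borel_measurable M"
    by (intro measurable_restrict_space1 measurable_completion) simp
  have "(\<integral>\<^sup>+ y. ennreal (ln_pole eps x y) \<partial>M) \<le> (\<integral>\<^sup>+ y. ennreal (ln_pole eps x y) \<partial>lebesgue)"
    by (subst nn_integral_restrict_space) (auto intro!: nn_integral_mono simp: indicator_def)
  also note nn_integral_ln_pole[OF assms]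
  finally have b: "(\<integral>\<^sup>+ y. ennreal (ln_pole eps x y) \<partial>M) \<le> ennreal (2 * pi * eps\<^sup>2)" .
  then show I: "integrable M (ln_pole eps x)"
    using order.strict_trans1[OF b ennreal_less_top] by (intro integrableI_nonneg m) (simp_all add: ln_pole_nonneg)
  show "(LINT y|M. ln_pole eps x y) \<le> 2 * pi * eps\<^sup>2"
    using b nn_integral_eq_integral[OF I] by (simp add: ln_pole_nonneg)
qed

section \<open>Essentially bounded functions and their stream functions\<close>

lemma LinftyI: "f \<in> borel_measurable M \<Longrightarrow> AE x in M. \<bar>f x\<bar> \<le> C \<Longrightarrow> f \<in> Linfty D"
  unfolding Linfty_def by (intro CollectI conjI exI)

lemma Linfty_measurable: "f \<in> Linfty D \<Longrightarrow> f \<in> borel_measurable M"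
  unfolding Linfty_def by simp

lemma LinftyE:
  assumes "f \<in> Linfty D"
  obtains C where "C \<ge> 0" "AE x in M. \<bar>f x\<bar> \<le> C"
proof -
  obtain C where "AE x in M. \<bar>f x\<bar> \<le> C"
    using assms unfolding Linfty_def mem_Collect_eq by (elim conjE exE)
  then have "AE x in M. \<bar>f x\<bar> \<le> max 0 C" by eventually_elim simp
  then show ?thesis using that[of "max 0 C"] by simp
qed

lemma Linfty_add:
  assumes "f \<in> Linfty D" "g \<in> Linfty D" shows "(\<lambda>x. f x + g x) \<in> Linfty D"
proof -
  obtain C1 where C1: "AE x in M. \<bar>f x\<bar> \<le> C1" by (rule LinftyE[OF assms(1)])
  obtain C2 where "AE x in M. \<bar>g x\<bar> \<le> C2" by (rule LinftyE[OF assms(2)])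
  with C1 have "AE x in M. \<bar>f x + g x\<bar> \<le> C1 + C2" by eventually_elim linarith
  then show ?thesis
    by (rule LinftyI[rotated]) (intro borel_measurable_add Linfty_measurable assms)
qed

lemma Linfty_mult:
  assumes "f \<in> Linfty D" "g \<in> Linfty D" shows "(\<lambda>x. f x * g x) \<in> Linfty D"
proof -
  obtain C1 where C1: "AE x in M. \<bar>f x\<bar> \<le> C1" "C1 \<ge> 0" by (rule LinftyE[OF assms(1)])
  obtain C2 where C2: "AE x in M. \<bar>g x\<bar> \<le> C2" by (rule LinftyE[OF assms(2)])
  have "AE x in M. \<bar>f x * g x\<bar> \<le> C1 * C2"
    using C1(1) C2 by eventually_elim (simp add: abs_mult mult_mono C1(2))
  then show ?thesis
    by (rule LinftyI[rotated]) (intro borel_measurable_times Linfty_measurable assms)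
qed

lemma Linfty_abs:
  assumes "f \<in> Linfty D" shows "(\<lambda>x. \<bar>f x\<bar>) \<in> Linfty D"
proof -
  obtain C where "AE x in M. \<bar>f x\<bar> \<le> C" by (rule LinftyE[OF assms])
  then show ?thesis
    by (intro LinftyI[of _ C] borel_measurable_abs Linfty_measurable[OF assms]) simp
qed

lemma Linfty_const: "(\<lambda>x. c) \<in> Linfty D"
  by (rule LinftyI[of _ "\<bar>c\<bar>"]) simp_all

lemma Linfty_minus: "f \<in> Linfty D \<Longrightarrow> (\<lambda>x. - f x) \<in> Linfty D"
  using Linfty_mult[OF Linfty_const[of "-1"]] by simp

lemma Linfty_diff: "f \<in> Linfty D \<Longrightarrow> g \<in> Linfty D \<Longrightarrow> (\<lambda>x. f x - g x) \<in> Linfty D"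
  using Linfty_add[OF _ Linfty_minus, of f g] by simp

lemma Linfty_bounded:
  "f \<in> borel_measurable M \<Longrightarrow> (\<And>x. x \<in> D \<Longrightarrow> \<bar>f x\<bar> \<le> C) \<Longrightarrow> f \<in> Linfty D"
  by (rule LinftyI[of _ C, OF _ AE_I2]) simp_all

lemma Linfty_integrable:
  assumes "f \<in> Linfty D" shows "integrable M f"
proof -
  obtain C where "AE x in M. norm (f x) \<le> C" using LinftyE[OF assms] by auto
  then show ?thesis
    by (rule finite_measure.integrable_const_bound[OF finite_measure_M _ Linfty_measurable[OF assms]])
qed

text \<open>The constant part of the kernel is paired with the L1 norm of \<open>f\<close>, the
  singular part with its sup norm \<open>C\<close>. The free scale \<open>eps\<close> trades one
  against the other: it is the core radius for vortex patches, and small relative to the sup bound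
  when \<open>f\<close> is only small in L1.\<close>

lemma SF_integrand_bound:
  assumes f: "f \<in> borel_measurable M" and C: "AE x in M. \<bar>f x\<bar> \<le> C" "C \<ge> 0"
    and x: "x \<in> D" and eps: "0 < eps" "eps \<le> R"
  shows "integrable M (\<lambda>y. G0 x y * f y)"
    and "(LINT y|M. \<bar>G0 x y * f y\<bar>) \<le> (ln (R / eps) * (LINT y|M. \<bar>f y\<bar>) + C * (2 * pi * eps\<^sup>2)) / (2 * pi)"
proof -
  have fL: "f \<in> Linfty D" using f C(1) by (rule LinftyI)
  have [measurable]: "G0 x \<in> borel_measurable M" "f \<in> borel_measurable M"
    using f x G0_measurable_snd by auto
  define b where "b y = (ln (R / eps) * \<bar>f y\<bar> + C * ln_pole eps x y) / (2 * pi)" for y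
  have bi: "integrable M b" unfolding b_def
    using Linfty_integrable[OF fL] ln_pole_integrable(1)[OF eps(1), of x] by auto
  have le: "AE y in M. norm (G0 x y * f y) \<le> b y"
    using C(1) AE_space
  proof eventually_elim
    case (elim y)
    have y: "y \<in> D" using elim by simp
    have "norm (G0 x y * f y) = G0 x y * \<bar>f y\<bar>" using G0_nonneg[OF x y] by (simp add: abs_mult)
    also have "\<dots> \<le> (ln (R / eps) + ln_pole eps x y) / (2 * pi) * \<bar>f y\<bar>"
      by (intro mult_right_mono G0_le_ln_pole x y eps) simp
    also have "\<dots> = (ln (R / eps) * \<bar>f y\<bar> + \<bar>f y\<bar> * ln_pole eps x y) / (2 * pi)" by (simp add: algebra_simps)
    also have "\<dots> \<le> b y" unfolding b_def
      using elim ln_pole_nonneg[of eps x y] by (intro divide_right_mono add_mono mult_right_mono) auto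
    finally show ?case .
  qed
  then show I: "integrable M (\<lambda>y. G0 x y * f y)"
  proof (intro Bochner_Integration.integrable_bound[OF bi])
    show "AE y in M. norm (G0 x y * f y) \<le> norm (b y)" using le by eventually_elim auto
  qed auto
  have "(LINT y|M. \<bar>G0 x y * f y\<bar>) \<le> (LINT y|M. b y)"
    using le by (intro integral_mono_AE bi integrable_abs I) auto
  also have "\<dots> = (ln (R / eps) * (LINT y|M. \<bar>f y\<bar>) + C * (LINT y|M. ln_pole eps x y)) / (2 * pi)"
    unfolding b_def using Linfty_integrable[OF fL] ln_pole_integrable(1)[OF eps(1), of x] by simp
  also have "\<dots> \<le> (ln (R / eps) * (LINT y|M. \<bar>f y\<bar>) + C * (2 * pi * eps\<^sup>2)) / (2 * pi)"
    using ln_pole_integrable(2)[OF eps(1), of x] C(2) by (intro divide_right_mono add_left_mono mult_left_mono) auto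
  finally show "(LINT y|M. \<bar>G0 x y * f y\<bar>) \<le> (ln (R / eps) * (LINT y|M. \<bar>f y\<bar>) + C * (2 * pi * eps\<^sup>2)) / (2 * pi)" .
qed

lemma SF_bound:
  assumes "f \<in> borel_measurable M" and "AE x in M. \<bar>f x\<bar> \<le> C" "C \<ge> 0"
    and "x \<in> D" and "0 < eps" "eps \<le> R"
  shows "\<bar>SF f x\<bar> \<le> (ln (R / eps) * (LINT y|M. \<bar>f y\<bar>) + C * (2 * pi * eps\<^sup>2)) / (2 * pi)"
  using SF_integrand_bound(2)[OF assms] SF_eq_G0[OF assms(4,1)]
    integral_abs_bound[of M "\<lambda>y. G0 x y * f y"] by linarith

lemma SF_integrable:
  assumes f: "f \<in> Linfty D" and x: "x \<in> D"
  shows "integrable M (\<lambda>y. G0 x y * f y)"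
proof -
  obtain C where C: "AE x in M. \<bar>f x\<bar> \<le> C" "C \<ge> 0" by (rule LinftyE[OF f])
  show ?thesis by (rule SF_integrand_bound(1)[OF Linfty_measurable[OF f] C x zero_less_one R_ge1])
qed

lemma SF_cong_AE:
  assumes "f \<in> borel_measurable M" "g \<in> borel_measurable M" "AE x in M. f x = g x" "x \<in> D"
  shows "SF f x = SF g x"
proof -
  have [measurable]: "G0 x \<in> borel_measurable M" "f \<in> borel_measurable M" "g \<in> borel_measurable M"
    using assms G0_measurable_snd by auto
  show ?thesis unfolding SF_eq_G0[OF assms(4,1)] SF_eq_G0[OF assms(4,2)]
  proof (rule integral_cong_AE)
    show "AE y in M. G0 x y * f y = G0 x y * g y" using assms(3) by eventually_elim simp
  qed measurable
qed

lemma SF_diff: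
  assumes "f \<in> Linfty D" "g \<in> Linfty D" "x \<in> D"
  shows "SF (\<lambda>y. f y - g y) x = SF f x - SF g x"
  using assms SF_integrable Linfty_measurable Linfty_diff[OF assms(1,2)] by (simp add: SF_eq_G0 right_diff_distrib)

lemma SF_measurable:
  assumes f: "f \<in> Linfty D" shows "SF f \<in> borel_measurable M"
proof -
  interpret sigma_finite_measure M by (rule sigma_finite_M)
  have [measurable]: "f \<in> borel_measurable M" using f by (rule Linfty_measurable)
  have [measurable]: "(\<lambda>z. G0 (fst z) (snd z)) \<in> borel_measurable (M \<Otimes>\<^sub>M M)" by (rule G0_measurable)
  have "(\<lambda>x. LINT y|M. G0 x y * f y) \<in> borel_measurable M"
    by (rule borel_measurable_lebesgue_integral) (simp add: case_prod_beta)
  also have "?this \<longleftrightarrow> ?thesis"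
    by (rule measurable_cong) (simp add: SF_eq_G0 Linfty_measurable[OF f])
  finally show ?thesis .
qed

lemma SF_Linfty:
  assumes f: "f \<in> Linfty D" shows "SF f \<in> Linfty D"
proof -
  obtain C where C: "AE x in M. \<bar>f x\<bar> \<le> C" "C \<ge> 0" by (rule LinftyE[OF f])
  show ?thesis
    by (rule Linfty_bounded[OF SF_measurable[OF f]])
      (rule SF_bound[OF Linfty_measurable[OF f] C _ zero_less_one R_ge1])
qed

section \<open>The symmetric bilinear form of the energy\<close>

definition Q where "Q f g = (LINT x|M. f x * SF g x)"

lemma Q_integrable: "f \<in> Linfty D \<Longrightarrow> g \<in> Linfty D \<Longrightarrow> integrable M (\<lambda>x. f x * SF g x)"
  by (intro Linfty_integrable Linfty_mult SF_Linfty)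

lemma energy_eq_Q: "energy D G f = 1 / 2 * Q f f"
proof -
  have "(LINT y|M. G x y * f x * f y) = f x * SF f x" for x
    unfolding stream_function_def by (subst integral_mult_right_zero[symmetric]) (simp add: mult_ac)
  then show ?thesis by (simp add: energy_def Q_def)
qed

lemma Q_cong_AE:
  assumes "f \<in> Linfty D" "g \<in> Linfty D" "AE x in M. f x = f' x" "f' \<in> Linfty D"
    "AE x in M. g x = g' x" "g' \<in> Linfty D"
  shows "Q f g = Q f' g'"
  unfolding Q_def
proof (rule integral_cong_AE)
  show "AE x in M. f x * SF g x = f' x * SF g' x"
    using assms(3) AE_space
  proof eventually_elim
    case (elim x)
    then have "x \<in> D" by simp
    then have "SF g x = SF g' x"
      by (intro SF_cong_AE assms(5) Linfty_measurable assms(2,6))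
    then show ?case using elim by simp
  qed
qed (intro borel_measurable_integrable Q_integrable assms)+

lemma Q_add_left: "f \<in> Linfty D \<Longrightarrow> f' \<in> Linfty D \<Longrightarrow> g \<in> Linfty D \<Longrightarrow> Q (\<lambda>x. f x + f' x) g = Q f g + Q f' g"
  unfolding Q_def by (simp add: distrib_right Q_integrable)

lemma Q_diff_left: "f \<in> Linfty D \<Longrightarrow> f' \<in> Linfty D \<Longrightarrow> g \<in> Linfty D \<Longrightarrow> Q (\<lambda>x. f x - f' x) g = Q f g - Q f' g"
  unfolding Q_def by (simp add: left_diff_distrib Q_integrable)

text \<open>Fubini and the symmetry of \<open>G0\<close>. Absolute integrability holds because the
  inner integral of \<open>|G0 x y * g y|\<close> is bounded in \<open>x\<close>.\<close>

lemma Q_sym: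
  assumes f: "f \<in> Linfty D" and g: "g \<in> Linfty D"
  shows "Q f g = Q g f"
proof -
  interpret pair_sigma_finite M M
    using sigma_finite_M by (simp add: pair_sigma_finite_def)
  have [measurable]: "f \<in> borel_measurable M" "g \<in> borel_measurable M" using f g Linfty_measurable by auto
  have [measurable]: "(\<lambda>z. G0 (fst z) (snd z)) \<in> borel_measurable (M \<Otimes>\<^sub>M M)" by (rule G0_measurable)
  define F where "F x y = f x * (G0 x y * g y)" for x y
  have Fm [measurable]: "case_prod F \<in> borel_measurable (M \<Otimes>\<^sub>M M)"
    unfolding F_def by (simp add: case_prod_beta)
  obtain C where C: "AE x in M. \<bar>g x\<bar> \<le> C" "C \<ge> 0" by (rule LinftyE[OF g])
  have I: "integrable (M \<Otimes>\<^sub>M M) (case_prod F)"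
  proof (rule Fubini_integrable[OF Fm])
    have "(\<lambda>x. LINT y|M. \<bar>G0 x y * g y\<bar>) \<in> borel_measurable M"
      by (rule sigma_finite_measure.borel_measurable_lebesgue_integral[OF sigma_finite_M]) (simp add: case_prod_beta)
    then have "(\<lambda>x. LINT y|M. \<bar>G0 x y * g y\<bar>) \<in> Linfty D"
      using SF_integrand_bound(2)[OF Linfty_measurable[OF g] C _ zero_less_one R_ge1]
      by (intro Linfty_bounded) (auto simp: abs_of_nonneg)
    moreover have "(\<lambda>x. \<bar>f x\<bar>) \<in> Linfty D" by (rule Linfty_abs[OF f])
    ultimately have "integrable M (\<lambda>x. \<bar>f x\<bar> * (LINT y|M. \<bar>G0 x y * g y\<bar>))"
      by (intro Linfty_integrable Linfty_mult)
    then show "integrable M (\<lambda>x. LINT y|M. norm (case (x, y) of (x, y) \<Rightarrow> F x y))"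
      by (simp add: F_def abs_mult)
    show "AE x in M. integrable M (\<lambda>y. case (x, y) of (x, y) \<Rightarrow> F x y)"
      using SF_integrable[OF g] by (intro AE_I2) (auto simp: F_def)
  qed
  have "Q f g = (LINT x|M. LINT y|M. F x y)"
    unfolding Q_def F_def using Linfty_measurable[OF g]
    by (intro Bochner_Integration.integral_cong) (auto simp: SF_eq_G0)
  also have "\<dots> = (LINT y|M. LINT x|M. F x y)" using Fubini_integral[OF I] by simp
  also have "\<dots> = (LINT y|M. g y * (LINT x|M. G0 y x * f x))"
  proof (intro Bochner_Integration.integral_cong refl)
    fix y assume "y \<in> space M"
    then have "(LINT x|M. F x y) = (LINT x|M. g y * (G0 y x * f x))"
      unfolding F_def by (intro Bochner_Integration.integral_cong) (auto simp: G0_sym)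
    then show "(LINT x|M. F x y) = g y * (LINT x|M. G0 y x * f x)" by simp
  qed
  also have "\<dots> = Q g f" unfolding Q_def using Linfty_measurable[OF f]
    by (intro Bochner_Integration.integral_cong) (auto simp: SF_eq_G0)
  finally show ?thesis .
qed

lemma Q_diff_right: "f \<in> Linfty D \<Longrightarrow> g \<in> Linfty D \<Longrightarrow> g' \<in> Linfty D \<Longrightarrow> Q f (\<lambda>x. g x - g' x) = Q f g - Q f g'"
  by (simp add: Q_sym[of f] Q_diff_left Linfty_diff)

lemma Q_add_right: "f \<in> Linfty D \<Longrightarrow> g \<in> Linfty D \<Longrightarrow> g' \<in> Linfty D \<Longrightarrow> Q f (\<lambda>x. g x + g' x) = Q f g + Q f g'"
  by (simp add: Q_sym[of f] Q_add_left Linfty_add)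

lemma energy_diff_eq:
  assumes "f \<in> Linfty D" "g \<in> Linfty D"
  shows "2 * energy D G (\<lambda>x. f x - g x) = Q f f + Q g g - 2 * Q f g"
  using assms by (simp add: energy_eq_Q Q_diff_left Q_diff_right Linfty_diff Q_sym[of g f])

text \<open>Kernels need to be compared only where \<open>g\<close> lives and off the diagonal. The
  bound \<open>c\<close> may depend on \<open>y\<close>, as is needed when near and far points are
  estimated differently.\<close>

lemma SF_ge:
  assumes g: "g \<in> Linfty D" and x: "x \<in> D" and nn: "\<And>y. y \<in> D \<Longrightarrow> 0 \<le> g y"
    and i: "integrable M (\<lambda>y. c y * g y)"
    and le: "\<And>y. y \<in> D \<Longrightarrow> g y \<noteq> 0 \<Longrightarrow> y \<noteq> x \<Longrightarrow> c y \<le> G x y"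
  shows "(LINT y|M. c y * g y) \<le> SF g x"
  unfolding SF_eq_G0[OF x Linfty_measurable[OF g]]
proof (rule integral_mono_AE[OF i SF_integrable[OF g x]])
  show "AE y in M. c y * g y \<le> G0 x y * g y"
    using AE_neq[of x] AE_space
  proof eventually_elim
    case (elim y)
    then show ?case using nn[of y] le[of y] by (cases "g y = 0") (auto simp: G0_def intro!: mult_right_mono)
  qed
qed

lemma SF_le:
  assumes g: "g \<in> Linfty D" and x: "x \<in> D" and nn: "\<And>y. y \<in> D \<Longrightarrow> 0 \<le> g y"
    and i: "integrable M (\<lambda>y. c y * g y)"
    and le: "\<And>y. y \<in> D \<Longrightarrow> g y \<noteq> 0 \<Longrightarrow> y \<noteq> x \<Longrightarrow> G x y \<le> c y"
  shows "SF g x \<le> (LINT y|M. c y * g y)"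
  unfolding SF_eq_G0[OF x Linfty_measurable[OF g]]
proof (rule integral_mono_AE[OF SF_integrable[OF g x] i])
  show "AE y in M. G0 x y * g y \<le> c y * g y"
    using AE_neq[of x] AE_space
  proof eventually_elim
    case (elim y)
    then show ?case using nn[of y] le[of y] by (cases "g y = 0") (auto simp: G0_def intro!: mult_right_mono)
  qed
qed

lemma SF_ge_const:
  assumes "g \<in> Linfty D" "x \<in> D" "\<And>y. y \<in> D \<Longrightarrow> 0 \<le> g y"
    "\<And>y. y \<in> D \<Longrightarrow> g y \<noteq> 0 \<Longrightarrow> y \<noteq> x \<Longrightarrow> c \<le> G x y"
  shows "c * (LINT y|M. g y) \<le> SF g x"
  using SF_ge[OF assms(1-3), of "\<lambda>_. c"] assms(4) Linfty_integrable[OF assms(1)] by simp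

lemma SF_le_const:
  assumes "g \<in> Linfty D" "x \<in> D" "\<And>y. y \<in> D \<Longrightarrow> 0 \<le> g y"
    "\<And>y. y \<in> D \<Longrightarrow> g y \<noteq> 0 \<Longrightarrow> y \<noteq> x \<Longrightarrow> G x y \<le> c"
  shows "SF g x \<le> c * (LINT y|M. g y)"
  using SF_le[OF assms(1-3), of "\<lambda>_. c"] assms(4) Linfty_integrable[OF assms(1)] by simp

lemma SF_nonneg:
  assumes "g \<in> Linfty D" "x \<in> D" "\<And>y. y \<in> D \<Longrightarrow> 0 \<le> g y"
  shows "0 \<le> SF g x"
  using SF_ge_const[OF assms, of 0] G_nonneg assms(2) by auto

lemma Q_ge_const:
  assumes f: "f \<in> Linfty D" "\<And>y. y \<in> D \<Longrightarrow> 0 \<le> f y" and g: "g \<in> Linfty D" "\<And>y. y \<in> D \<Longrightarrow> 0 \<le> g y"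
    and c: "\<And>x y. x \<in> D \<Longrightarrow> y \<in> D \<Longrightarrow> f x \<noteq> 0 \<Longrightarrow> g y \<noteq> 0 \<Longrightarrow> y \<noteq> x \<Longrightarrow> c \<le> G x y"
  shows "c * (LINT y|M. f y) * (LINT y|M. g y) \<le> Q f g"
proof -
  have "(LINT x|M. f x * (c * (LINT y|M. g y))) \<le> Q f g" unfolding Q_def
  proof (rule integral_mono)
    fix x assume "x \<in> space M"
    then show "f x * (c * (LINT y|M. g y)) \<le> f x * SF g x"
      using f(2)[of x] SF_ge_const[OF g(1) _ g(2), of x c] c[of x] by (cases "f x = 0") (auto intro!: mult_left_mono)
  qed (use f g Linfty_integrable Q_integrable in auto)
  then show ?thesis by (simp add: mult_ac)
qed

lemma Q_le_const:
  assumes f: "f \<in> Linfty D" "\<And>y. y \<in> D \<Longrightarrow> 0 \<le> f y" and g: "g \<in> Linfty D" "\<And>y. y \<in> D \<Longrightarrow> 0 \<le> g y"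
    and c: "\<And>x y. x \<in> D \<Longrightarrow> y \<in> D \<Longrightarrow> f x \<noteq> 0 \<Longrightarrow> g y \<noteq> 0 \<Longrightarrow> y \<noteq> x \<Longrightarrow> G x y \<le> c"
  shows "Q f g \<le> c * (LINT y|M. f y) * (LINT y|M. g y)"
proof -
  have "Q f g \<le> (LINT x|M. f x * (c * (LINT y|M. g y)))" unfolding Q_def
  proof (rule integral_mono)
    fix x assume "x \<in> space M"
    then show "f x * SF g x \<le> f x * (c * (LINT y|M. g y))"
      using f(2)[of x] SF_le_const[OF g(1) _ g(2), of x c] c[of x] by (cases "f x = 0") (auto intro!: mult_left_mono)
  qed (use f g Linfty_integrable Q_integrable in auto)
  then show ?thesis by (simp add: mult_ac)
qed

end

section \<open>Concentration of a single vortex core\<close>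

lemma measure_ball_real2: "r \<ge> 0 \<Longrightarrow> measure lebesgue (ball (c::real^2) r) = pi * r\<^sup>2"
  using content_ball[of r c] by (simp add: measure_completion unit_ball_vol_2)

text \<open>Shifting \<open>x\<close> towards the centre by at most \<open>s\<close> makes room for
  a ball of radius \<open>s\<close>, even if \<open>x\<close> is close to the boundary of the large
  ball.\<close>

lemma inner_ball_exists:
  fixes x xb :: "'a::real_normed_vector"
  assumes "x \<in> ball xb d" "0 < s" "s \<le> d"
  obtains c where "ball c s \<subseteq> ball xb d" "ball c s \<subseteq> ball x (2 * s)"
proof -
  define c where "c = x + (s / d) *\<^sub>R (xb - x)"
  have d: "d > 0" and xd: "norm (xb - x) < d" using assms by (auto simp: dist_norm)
  have "norm (c - x) = (s / d) * norm (xb - x)" using assms d by (simp add: c_def)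
  also have "\<dots> \<le> (s / d) * d" using assms d xd by (intro mult_left_mono) auto
  finally have 1: "norm (c - x) \<le> s" using d by simp
  have "xb - c = (1 - s / d) *\<^sub>R (xb - x)" by (simp add: c_def algebra_simps)
  then have "norm (xb - c) = (1 - s / d) * norm (xb - x)" using assms d by simp
  also have "\<dots> \<le> (1 - s / d) * d" using assms d xd by (intro mult_left_mono) auto
  also have "\<dots> = d - s" using d by (simp add: field_simps)
  finally have 2: "norm (xb - c) \<le> d - s" .
  show ?thesis
  proof (rule that[of c])
    show "ball c s \<subseteq> ball xb d"
    proof
      fix y assume "y \<in> ball c s"
      then show "y \<in> ball xb d" using 2 dist_triangle[of xb y c] by (simp add: dist_norm)
    qed
    show "ball c s \<subseteq> ball x (2 * s)"
    proof
      fix y assume "y \<in> ball c s"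
      then show "y \<in> ball x (2 * s)" using 1 dist_triangle[of x y c] by (simp add: dist_norm norm_minus_commute)
    qed
  qed
qed

context green_domain
begin

lemma indicator_measurable_M: "A \<in> sets lebesgue \<Longrightarrow> (indicator A :: real^2 \<Rightarrow> real) \<in> borel_measurable M"
  by (intro measurable_restrict_space1 borel_measurable_indicator)

lemma patch_Linfty: "A \<in> sets lebesgue \<Longrightarrow> (\<lambda>x. l * indicator A x) \<in> Linfty D"
  by (rule Linfty_bounded[of _ "\<bar>l\<bar>"])
    (intro borel_measurable_times borel_measurable_const indicator_measurable_M, assumption,
     simp add: indicator_def abs_mult)

lemma integral_patch:
  assumes "A \<in> sets lebesgue" "A \<subseteq> D"
  shows "(LINT x|M. l * indicator A x) = l * measure lebesgue A"
proof -
  have "A \<inter> D = A" using assms by auto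
  then show ?thesis using assms by (simp add: measure_restrict_space)
qed

text \<open>With \<open>eps\<close> the radius of the disc of the same area as \<open>A\<close>, the
  singular part of the kernel contributes at most \<open>2 * k / (2 * pi)\<close>, whatever the
  shape of \<open>A\<close>. The value is optimal up to a bounded error, which is all that the
  deficit argument needs.\<close>

lemma SF_patch_le:
  assumes A: "A \<in> sets lebesgue" "A \<subseteq> D" "measure lebesgue A = pi * eps\<^sup>2"
    and eps: "0 < eps" "eps \<le> R" and k: "k > 0" and l: "l = k / (pi * eps\<^sup>2)" and x: "x \<in> D"
  shows "SF (\<lambda>x. l * indicator A x) x \<le> k / (2 * pi) * (ln (R / eps) + 2)"
proof -
  have l0: "l > 0" using k eps l by simp
  have b: "AE y in M. \<bar>l * indicator A y\<bar> \<le> l"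
    using l0 by (intro AE_I2) (simp add: indicator_def)
  have "\<bar>SF (\<lambda>x. l * indicator A x) x\<bar> \<le>
      (ln (R / eps) * (LINT y|M. \<bar>l * indicator A y\<bar>) + l * (2 * pi * eps\<^sup>2)) / (2 * pi)"
    using l0 by (intro SF_bound[OF Linfty_measurable[OF patch_Linfty[OF A(1)]] b _ x eps]) simp
  also have "(LINT y|M. \<bar>l * indicator A y\<bar>) = (LINT y|M. l * indicator A y)"
    using l0 by (intro Bochner_Integration.integral_cong) (auto simp: indicator_def)
  also have "\<dots> = k" using eps by (simp add: integral_patch[OF A(1,2)] A(3) l del: integral_mult_right_zero)
  also have "l * (2 * pi * eps\<^sup>2) = 2 * k" using eps by (simp add: l)
  finally have "SF (\<lambda>x. l * indicator A x) x \<le> (ln (R / eps) * k + 2 * k) / (2 * pi)" by linarith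
  also have "\<dots> = k / (2 * pi) * (ln (R / eps) + 2)" by (simp add: field_simps)
  finally show ?thesis .
qed

text \<open>Since the deficit \<open>U - \<psi>\<close> is bounded on average over the core, some point of the core has
  \<open>\<psi> \<ge> U - O(1)\<close>; this propagates to all points at distance \<open>O(eps)\<close>, and those cannot all belong to
  the core. Hence \<open>m \<ge> U - O(1)\<close>, which forces most of the mass of the core to lie within \<open>O(eps)\<close> of
  each of its points.\<close>

lemma vortex_core:
  fixes xb :: "real^2"
  assumes \<delta>: "cball xb \<delta> \<subseteq> D"
    and Ch: "\<And>x y. x \<in> cball xb \<delta> \<Longrightarrow> y \<in> cball xb \<delta> \<Longrightarrow> \<bar>h x y\<bar> \<le> Ch"
    and k: "k > 0" and C': "C' > 0" and Cg: "Cg \<ge> 0"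
    and C2: "C2 = 2 * C' / k + k * (ln 5 + 2) / (2 * pi) + 2 * Ch * k + Cg"
    and eps: "0 < eps" "eps \<le> R" "2 * eps \<le> \<delta>" and l: "l = k / (pi * eps\<^sup>2)"
    and A: "A \<in> sets lebesgue" "A \<subseteq> ball xb \<delta>" "measure lebesgue A = pi * eps\<^sup>2"
    and f: "f = (\<lambda>x. l * indicator A x)"
    and g: "g \<in> Linfty D" "\<And>y. y \<in> D \<Longrightarrow> 0 \<le> g y" "\<And>x. x \<in> ball xb \<delta> \<Longrightarrow> SF g x \<le> Cg"
    and A_iff: "\<And>x. x \<in> ball xb \<delta> \<Longrightarrow> x \<in> A \<longleftrightarrow> m < SF f x - SF g x"
    and U: "U = k / (2 * pi) * (ln (R / eps) + 2)"
    and deficit: "(LINT x|M. f x * (U - (SF f x - SF g x))) \<le> C'"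
  shows "U - C2 \<le> m"
    and "x \<in> A \<Longrightarrow> x' \<in> A \<Longrightarrow> norm (x - x') < 2 * (exp (6 * pi * C2 / k) * eps)"
proof -
  have BD: "ball xb \<delta> \<subseteq> D" using \<delta> ball_subset_cball by blast
  have AD: "A \<subseteq> D" using A(2) BD by blast
  have l0: "l > 0" using k eps l by simp
  have fL: "f \<in> Linfty D" unfolding f by (rule patch_Linfty[OF A(1)])
  have fi: "integrable M f" by (rule Linfty_integrable[OF fL])
  have f0: "0 \<le> f y" for y using l0 by (simp add: f)
  have fk: "(LINT y|M. f y) = k"
    unfolding f integral_patch[OF A(1) AD] using eps by (simp add: A(3) l)
  have Ch0: "Ch \<ge> 0" using Ch[of xb xb] eps by (auto intro: order_trans[OF abs_ge_zero])
  define \<phi> where "\<phi> x = SF f x - SF g x" for x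
  have \<phi>L: "\<phi> \<in> Linfty D" unfolding \<phi>_def by (intro Linfty_diff SF_Linfty fL g(1))
  have lpole: "(LINT y|M. f y * ln_pole eps x y) \<le> 2 * k" for x
  proof -
    have "(LINT y|M. f y * ln_pole eps x y) \<le> (LINT y|M. l * ln_pole eps x y)"
    proof (rule integral_mono_AE')
      show "integrable M (\<lambda>y. l * ln_pole eps x y)" using ln_pole_integrable(1)[OF eps(1)] by simp
      show "AE y in M. f y * ln_pole eps x y \<le> l * ln_pole eps x y"
        using l0 ln_pole_nonneg[of eps x] by (intro AE_I2 mult_right_mono) (simp_all add: f indicator_def)
      show "AE y in M. 0 \<le> l * ln_pole eps x y"
        using l0 ln_pole_nonneg[of eps x] by (intro AE_I2) simp
    qed
    also have "\<dots> = l * (LINT y|M. ln_pole eps x y)" by simp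
    also have "\<dots> \<le> l * (2 * pi * eps\<^sup>2)"
      using ln_pole_integrable(2)[OF eps(1)] l0 by (intro mult_left_mono) auto
    also have "\<dots> = 2 * k" using eps by (simp add: l)
    finally show ?thesis .
  qed
  have lpole_int: "integrable M (\<lambda>y. f y * ln_pole eps x y)" for x
  proof (rule Bochner_Integration.integrable_bound)
    show "integrable M (\<lambda>y. l * ln_pole eps x y)" using ln_pole_integrable(1)[OF eps(1)] by simp
    show "(\<lambda>y. f y * ln_pole eps x y) \<in> borel_measurable M"
      using fi ln_pole_integrable(1)[OF eps(1), of x]
      by (intro borel_measurable_times borel_measurable_integrable)
    show "AE y in M. norm (f y * ln_pole eps x y) \<le> norm (l * ln_pole eps x y)"
      using l0 ln_pole_nonneg[of eps x] by (intro AE_I2) (simp add: f indicator_def)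
  qed
  \<comment> \<open>Averaging: were the deficit larger than \<open>2 * C' / k\<close> on the whole
    core, its integral would be at least \<open>2 * C'\<close>. The factor 2 turns this into a
    contradiction to the bound \<open>C'\<close>.\<close>
  obtain x0 where x0: "x0 \<in> A" "U - \<phi> x0 \<le> 2 * C' / k"
  proof -
    have "\<exists>x0\<in>A. U - \<phi> x0 \<le> 2 * C' / k"
    proof (rule ccontr)
      assume "\<not> ?thesis"
      then have gt: "2 * C' / k \<le> U - \<phi> x" if "x \<in> A" for x using that by force
      have "(LINT x|M. f x * (2 * C' / k)) \<le> (LINT x|M. f x * (U - \<phi> x))"
      proof (rule integral_mono)
        show "integrable M (\<lambda>x. f x * (2 * C' / k))" using fi by simp
        show "integrable M (\<lambda>x. f x * (U - \<phi> x))"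
          by (intro Linfty_integrable Linfty_mult Linfty_diff fL Linfty_const \<phi>L)
        show "f x * (2 * C' / k) \<le> f x * (U - \<phi> x)" for x
        proof (cases "x \<in> A")
          case True
          show ?thesis by (rule mult_left_mono[OF gt[OF True] f0])
        qed (simp add: f)
      qed
      also have "(LINT x|M. f x * (2 * C' / k)) = 2 * C'" using k by (simp add: fk)
      finally show False using deficit C' by (simp add: \<phi>_def)
    qed
    then show ?thesis using that by blast
  qed
  have x0B: "x0 \<in> ball xb \<delta>" and x0D: "x0 \<in> D" using x0(1) A(2) BD by auto
  \<comment> \<open>A Harnack-type estimate. If \<open>y\<close> is at distance
    \<open>t \<ge> eps\<close> from \<open>x0\<close>, then \<open>norm (x - y) \<le> 5 * t\<close>,
    which costs \<open>ln 5\<close>; otherwise \<open>norm (x - y)\<close> is less than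
    \<open>5 * eps\<close>, which costs in addition the pole term, whose integral against
    \<open>f\<close> is at most \<open>2 * k\<close>. The two regular parts cost
    \<open>2 * Ch\<close>.\<close>
  have low: "SF f x0 - k * (ln 5 + 2) / (2 * pi) - 2 * Ch * k \<le> SF f x"
    if x: "x \<in> ball xb \<delta>" "norm (x - x0) < 4 * eps" for x
  proof -
    have xD: "x \<in> D" using x BD by auto
    define c where "c y = G0 x0 y - (ln 5 + ln_pole eps x0 y) / (2 * pi) - 2 * Ch" for y
    have ci1: "integrable M (\<lambda>y. G0 x0 y * f y)" by (rule SF_integrable[OF fL x0D])
    have ceq: "(\<lambda>y. c y * f y) = (\<lambda>y. G0 x0 y * f y - (ln 5 * f y + f y * ln_pole eps x0 y) / (2 * pi) - 2 * Ch * f y)"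
      by (rule ext) (simp add: c_def algebra_simps add_divide_distrib)
    have ci: "integrable M (\<lambda>y. c y * f y)" unfolding ceq
      using ci1 fi lpole_int[of x0] by simp
    have "(LINT y|M. c y * f y) = SF f x0 - (ln 5 * k + (LINT y|M. f y * ln_pole eps x0 y)) / (2 * pi) - 2 * Ch * k"
      unfolding ceq SF_eq_G0[OF x0D Linfty_measurable[OF fL]] using ci1 fi lpole_int[of x0] by (simp add: fk)
    moreover have "(ln 5 * k + (LINT y|M. f y * ln_pole eps x0 y)) / (2 * pi) \<le> (ln 5 * k + 2 * k) / (2 * pi)"
      using lpole[of x0] by (intro divide_right_mono) auto
    moreover have "(LINT y|M. c y * f y) \<le> SF f x"
    proof (rule SF_ge[OF fL xD f0 ci])
      fix y assume y: "y \<in> D" "f y \<noteq> 0" "y \<noteq> x"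
      have yA: "y \<in> A" using y(2) by (auto simp: f indicator_def split: if_splits)
      then have yB: "y \<in> cball xb \<delta>" using A(2) by auto
      have xB: "x \<in> cball xb \<delta>" "x0 \<in> cball xb \<delta>" using x(1) x0B by auto
      have hx: "\<bar>h x y\<bar> \<le> Ch" "\<bar>h x0 y\<bar> \<le> Ch" using Ch xB yB by auto
      have Gxy: "G x y = - ln (norm (x - y)) / (2 * pi) - h x y" using G_eq[OF xD y(1)] y(3) by auto
      define t where "t = norm (x0 - y)"
      have xt: "norm (x - y) \<le> t + 4 * eps"
        using norm_triangle_ineq[of "x - x0" "x0 - y"] x(2) by (simp add: t_def)
      have xy0: "norm (x - y) > 0" using y(3) by simp
      \<comment> \<open>At \<open>y = x0\<close> the kernel \<open>G0\<close> has its default value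
        0, so \<open>c y\<close> is nonpositive and the sign of \<open>G\<close> suffices.\<close>
      show "c y \<le> G x y"
      proof (cases "y = x0")
        case True
        show ?thesis
        proof -
          have "c y = - (ln 5 + ln_pole eps x0 y) / (2 * pi) - 2 * Ch" using True by (simp add: c_def G0_def minus_divide_left)
          also have "\<dots> \<le> 0"
          proof -
            have "0 \<le> (ln 5 + ln_pole eps x0 y) / (2 * pi)" using ln_pole_nonneg[of eps x0 y] by simp
            then show ?thesis using Ch0 unfolding minus_divide_left[symmetric] by linarith
          qed
          also have "\<dots> \<le> G x y" using G_nonneg[OF xD y(1)] y(3) by auto
          finally show ?thesis .
        qed
      next
        case False
        have t0: "t > 0" using False by (simp add: t_def)
        have Gx0: "G0 x0 y = - ln t / (2 * pi) - h x0 y" using G_eq[OF x0D y(1)] False by (auto simp: G0_def t_def)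
        have "ln (norm (x - y)) \<le> ln t + (ln 5 + ln_pole eps x0 y)"
        proof (cases "t \<ge> eps")
          case True
          have "ln (norm (x - y)) \<le> ln (5 * t)" using xt xy0 True by (intro ln_mono) auto
          also have "\<dots> = ln 5 + ln t" using t0 by (intro ln_mult_pos) auto
          finally show ?thesis using ln_pole_nonneg[of eps x0 y] by simp
        next
          case False
          have "ln (norm (x - y)) \<le> ln (5 * eps)" using xt xy0 False by (intro ln_mono) auto
          also have "\<dots> = ln 5 + ln eps" using eps by (intro ln_mult_pos) auto
          also have "ln eps = ln t + ln (eps / t)" using t0 eps by (simp add: ln_div)
          also have "ln (eps / t) \<le> ln_pole eps x0 y" by (simp add: ln_pole_def t_def)
          finally show ?thesis by simp
        qed
        then have "ln (norm (x - y)) / (2 * pi) \<le> (ln t + (ln 5 + ln_pole eps x0 y)) / (2 * pi)"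
          by (intro divide_right_mono) auto
        then show ?thesis using hx unfolding c_def Gxy Gx0
          by (simp add: add_divide_distrib abs_le_iff)
      qed
    qed
    ultimately show ?thesis by (simp add: algebra_simps)
  qed
  \<comment> \<open>The terms of \<open>C2\<close> are the deficit at \<open>x0\<close>, the loss in
    passing from \<open>x0\<close> to a nearby point outside the core, and the bound
    \<open>Cg\<close> for the opposite vortex at that point.\<close>
  show mU: "U - C2 \<le> m"
  proof -
    \<comment> \<open>A disc of radius \<open>2 * eps\<close> has four times the area of the core,
      so it contains a point outside the core; there the level \<open>m\<close> bounds the stream
      function from above.\<close>
    obtain c where c: "ball c (2 * eps) \<subseteq> ball xb \<delta>" "ball c (2 * eps) \<subseteq> ball x0 (2 * (2 * eps))"
      using inner_ball_exists[OF x0B, of "2 * eps"] eps by auto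
    have "\<not> ball c (2 * eps) \<subseteq> A"
    proof
      assume "ball c (2 * eps) \<subseteq> A"
      moreover have "A \<in> lmeasurable" using A(1,2) bounded_ball bounded_subset
        by (metis bounded_set_imp_lmeasurable)
      ultimately have "measure lebesgue (ball c (2 * eps)) \<le> measure lebesgue A"
        by (intro measure_mono_fmeasurable) auto
      then have "pi * (2 * eps)\<^sup>2 \<le> pi * eps\<^sup>2" using measure_ball_real2[of "2 * eps" c] eps unfolding A(3) by linarith
      then show False using eps by (simp add: power_mult_distrib)
    qed
    then obtain x where x: "x \<in> ball c (2 * eps)" "x \<notin> A" by blast
    have xB: "x \<in> ball xb \<delta>" using x c by auto
    have xn: "norm (x - x0) < 4 * eps" using x(1) c(2) by (auto simp: dist_norm norm_minus_commute subset_iff)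
    have "SF f x - SF g x \<le> m" using A_iff[OF xB] x(2) by auto
    moreover have "SF g x \<le> Cg" by (rule g(3)[OF xB])
    moreover have "0 \<le> SF g x0" by (rule SF_nonneg[OF g(1) x0D g(2)])
    ultimately show ?thesis using low[OF xB xn] x0(2) unfolding C2 \<phi>_def by linarith
  qed
  show "norm (x - x') < 2 * (exp (6 * pi * C2 / k) * eps)" if xA: "x \<in> A" "x' \<in> A"
  proof (rule ccontr)
    assume far: "\<not> norm (x - x') < 2 * (exp (6 * pi * C2 / k) * eps)"
    \<comment> \<open>Chosen so that \<open>ln \<rho> / (2 * pi) * (k / 3) = C2\<close>: a point of
      the core can afford at most a third of the mass at distance \<open>\<rho> * eps\<close> or
      more without falling below \<open>U - C2\<close>.\<close>
    define \<rho> where "\<rho> = exp (6 * pi * C2 / k)"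
    have C2pos: "C2 > 0"
    proof -
      have "0 < 2 * C' / k" using C' k by simp
      moreover have "0 \<le> k * (ln 5 + 2) / (2 * pi)" using k by simp
      moreover have "0 \<le> 2 * Ch * k" using Ch0 k by simp
      ultimately show ?thesis using Cg unfolding C2 by linarith
    qed
    have \<rho>: "ln \<rho> = 6 * pi * C2 / k" "\<rho> \<ge> 1" using C2pos k by (auto simp: \<rho>_def)
    define S where "S z = {y. \<rho> * eps \<le> norm (z - y)}" for z :: "real^2"
    have Sm: "S z \<in> sets lebesgue" for z
    proof -
      have "closed (S z)" unfolding S_def by (intro closed_Collect_le continuous_intros)
      then show ?thesis by auto
    qed
    have fSL: "(\<lambda>y. f y * indicator (S z) y) \<in> Linfty D" for z
      using Linfty_mult[OF fL patch_Linfty[OF Sm[of z], of 1]] by simp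
    have mass: "(LINT y|M. f y * indicator (S z) y) \<le> k / 3" if z: "z \<in> A" for z
    proof -
      have zB: "z \<in> ball xb \<delta>" and zD: "z \<in> D" using z A(2) BD by auto
      have "m < SF f z - SF g z" using A_iff[OF zB] z by simp
      moreover have "0 \<le> SF g z" by (rule SF_nonneg[OF g(1) zD g(2)])
      ultimately have ge: "U - C2 \<le> SF f z" using mU by linarith
      define c where "c y = (ln (R / eps) + ln_pole eps z y - ln \<rho> * indicator (S z) y) / (2 * pi)" for y
      have ceq: "(\<lambda>y. c y * f y) = (\<lambda>y. (ln (R / eps) * f y + f y * ln_pole eps z y
          - ln \<rho> * (f y * indicator (S z) y)) / (2 * pi))"
        by (rule ext) (simp add: c_def algebra_simps)
      have ci: "integrable M (\<lambda>y. c y * f y)"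
        unfolding ceq using fi lpole_int[of z] Linfty_integrable[OF fSL[of z]] by simp
      have "SF f z \<le> (LINT y|M. c y * f y)"
      proof (rule SF_le[OF fL zD f0 ci])
        fix y assume y: "y \<in> D" "f y \<noteq> 0" "y \<noteq> z"
        show "G z y \<le> c y"
        proof (cases "y \<in> S z")
          case True
          then have far': "\<rho> * eps \<le> norm (z - y)" by (simp add: S_def)
          have pos: "0 < \<rho> * eps" "0 < norm (z - y)" using \<rho> eps y(3) by auto
          have "ln (R / norm (z - y)) = ln R - ln (norm (z - y))" using pos R_ge1 by (simp add: ln_div)
          moreover have "ln (\<rho> * eps) \<le> ln (norm (z - y))" using far' pos by (intro ln_mono) auto
          moreover have "ln (\<rho> * eps) = ln \<rho> + ln eps" using \<rho> eps by (intro ln_mult_pos) auto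
          moreover have "ln (R / eps) = ln R - ln eps" using R_ge1 eps by (simp add: ln_div)
          ultimately have "ln (R / norm (z - y)) \<le> ln (R / eps) + ln_pole eps z y - ln \<rho>"
            using ln_pole_nonneg[of eps z y] by linarith
          then have "ln (R / norm (z - y)) / (2 * pi) \<le> c y"
            using True unfolding c_def by (intro divide_right_mono) auto
          then show ?thesis using G_le_ln[OF zD y(1)] y(3) by fastforce
        next
          case False
          then show ?thesis using G0_le_ln_pole[OF zD y(1) eps(1,2)] y(3) by (auto simp: c_def G0_def)
        qed
      qed
      also have "\<dots> = (ln (R / eps) * k + (LINT y|M. f y * ln_pole eps z y)
          - ln \<rho> * (LINT y|M. f y * indicator (S z) y)) / (2 * pi)"
        unfolding ceq using fi lpole_int[of z] Linfty_integrable[OF fSL[of z]] by (simp add: fk)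
      also have "\<dots> \<le> (ln (R / eps) * k + 2 * k - ln \<rho> * (LINT y|M. f y * indicator (S z) y)) / (2 * pi)"
        using lpole[of z] by (intro divide_right_mono) auto
      also have "\<dots> = U - ln \<rho> * (LINT y|M. f y * indicator (S z) y) / (2 * pi)"
        unfolding U by (simp add: field_simps)
      finally have "ln \<rho> * (LINT y|M. f y * indicator (S z) y) / (2 * pi) \<le> C2" using ge by linarith
      then have "3 * C2 / k * (LINT y|M. f y * indicator (S z) y) \<le> C2"
        unfolding \<rho>(1) by (simp add: field_simps)
      then show ?thesis using C2pos k by (simp add: field_simps)
    qed
    \<comment> \<open>For two core points farther apart than claimed, every \<open>y\<close> is far
      from at least one of them. The two far masses would then add up to \<open>k\<close>, although
      each is at most \<open>k / 3\<close>.\<close>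
    have cover: "f y \<le> f y * indicator (S x) y + f y * indicator (S x') y" for y
    proof -
      have "y \<in> S x \<or> y \<in> S x'"
      proof (rule ccontr)
        assume "\<not> ?thesis"
        then have "norm (x - y) < \<rho> * eps" "norm (x' - y) < \<rho> * eps" by (auto simp: S_def)
        then have "norm (x - x') < 2 * (\<rho> * eps)"
          using norm_triangle_ineq4[of "x - y" "x' - y"] by simp
        then show False using far by (simp add: \<rho>_def)
      qed
      then show ?thesis using f0[of y] by (auto simp: indicator_def)
    qed
    have "k \<le> (LINT y|M. f y * indicator (S x) y + f y * indicator (S x') y)"
      unfolding fk[symmetric]
      by (rule integral_mono[OF fi _ cover])
        (intro Bochner_Integration.integrable_add Linfty_integrable fSL)
    also have "\<dots> = (LINT y|M. f y * indicator (S x) y) + (LINT y|M. f y * indicator (S x') y)"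
      by (rule Bochner_Integration.integral_add) (intro Linfty_integrable fSL)+
    also have "\<dots> \<le> k / 3 + k / 3" using mass xA by (intro add_mono) auto
    finally show False using k by simp
  qed
qed

end

section \<open>Translation of a vortex core\<close>

lemma lebesgue_distr_translation:
  fixes c :: "'a::euclidean_space"
  shows "distr lebesgue lebesgue (\<lambda>x. c + x) = lebesgue"
proof -
  have T: "(\<lambda>x. c + (\<Sum>j\<in>Basis. (1 * (x \<bullet> j)) *\<^sub>R j)) = (\<lambda>x::'a. c + x)"
    by (simp add: euclidean_representation)
  have "lebesgue = density (distr lebesgue lebesgue (\<lambda>x. c + x)) (\<lambda>_. (\<Prod>j\<in>(Basis::'a set). \<bar>1::real\<bar>))"
    using lebesgue_affine_euclidean[of "\<lambda>_. 1" c] unfolding T by simp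
  then show ?thesis by (simp add: density_1)
qed

lemma translation_measurable: "(\<lambda>x. c + x) \<in> lebesgue \<rightarrow>\<^sub>M (lebesgue :: 'a::euclidean_space measure)"
proof (rule measurableI)
  fix A :: "'a set" assume A: "A \<in> sets lebesgue"
  have "(\<lambda>x. c + x) -` A \<inter> space lebesgue = (+) (- c) ` A"
  proof (rule set_eqI)
    fix x show "x \<in> (\<lambda>x. c + x) -` A \<inter> space lebesgue \<longleftrightarrow> x \<in> (+) (- c) ` A"
      by (auto simp: image_iff intro!: bexI[where x = "c + x"])
  qed
  then show "(\<lambda>x. c + x) -` A \<inter> space lebesgue \<in> sets lebesgue"
    using lebesgue_sets_translation[OF A, of "- c"] by simp
qed simp

context green_domain
begin

text \<open>Values outside \<open>D\<close> are uncontrolled, so the shifted integrand is cut off by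
  the indicator; the hypothesis \<open>z\<close> ensures that the shift moves no part of the support
  out of \<open>D\<close>.\<close>

lemma integral_shift:
  fixes F :: "real^2 \<Rightarrow> real"
  assumes F: "integrable M F" and z: "\<And>z. z \<in> D \<Longrightarrow> F z \<noteq> 0 \<Longrightarrow> z - c \<in> D"
  shows "integrable M (\<lambda>z. indicator D (c + z) * F (c + z))"
    and "(LINT z|M. F z) = (LINT z|M. indicator D (c + z) * F (c + z))"
proof -
  define F' where "F' z = indicator D z * F z" for z
  have eq: "indicator D z *\<^sub>R (indicator D (c + z) * F (c + z)) = F' (c + z)" for z
    using z[of "c + z"] by (cases "z \<in> D"; cases "c + z \<in> D") (auto simp: F'_def)
  have I: "integrable lebesgue F'"
    using F by (simp add: integrable_restrict_space F'_def[abs_def])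
  have "integrable (distr lebesgue lebesgue (\<lambda>x. c + x)) F'"
    using I by (simp add: lebesgue_distr_translation)
  then have I2: "integrable lebesgue (\<lambda>z. F' (c + z))"
    by (rule integrable_distr[OF translation_measurable])
  then show "integrable M (\<lambda>z. indicator D (c + z) * F (c + z))"
    by (simp add: integrable_restrict_space eq[unfolded real_scaleR_def])
  have "(LINT z|M. F z) = (LINT z|lebesgue. F' z)"
    by (simp add: integral_restrict_space F'_def[abs_def])
  also have "\<dots> = (LINT z|distr lebesgue lebesgue (\<lambda>x. c + x). F' z)"
    by (simp add: lebesgue_distr_translation)
  also have "\<dots> = (LINT z|lebesgue. F' (c + z))"
    by (rule integral_distr[OF translation_measurable]) (rule borel_measurable_integrable[OF I])
  also have "\<dots> = (LINT z|M. indicator D (c + z) * F (c + z))"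
    by (simp add: integral_restrict_space eq[unfolded real_scaleR_def])
  finally show "(LINT z|M. F z) = (LINT z|M. indicator D (c + z) * F (c + z))" .
qed

text \<open>The logarithm depends on \<open>x - y\<close> only. A translation therefore changes the
  kernel by \<open>h x y - h (c + x) (c + y)\<close>, which exceeds
  \<open>a - b - 2 * \<eta>\<close> on the core.\<close>

lemma Q_translate_ge:
  assumes A: "A \<in> sets lebesgue" "A \<subseteq> D" "(+) c ` A \<subseteq> D" and l: "l \<ge> 0"
    and h1: "\<And>x y. x \<in> A \<Longrightarrow> y \<in> A \<Longrightarrow> \<bar>h x y - a\<bar> < \<eta>"
    and h2: "\<And>x y. x \<in> A \<Longrightarrow> y \<in> A \<Longrightarrow> \<bar>h (c + x) (c + y) - b\<bar> < \<eta>"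
    and f: "f = (\<lambda>x. l * indicator A x)" and f': "f' = (\<lambda>x. l * indicator ((+) c ` A) x)"
  shows "Q f f + (a - b - 2 * \<eta>) * (LINT x|M. f x)\<^sup>2 \<le> Q f' f'"
proof -
  define \<beta> where "\<beta> = a - b - 2 * \<eta>"
  have A': "(+) c ` A \<in> sets lebesgue" by (rule lebesgue_sets_translation[OF A(1)])
  have fL: "f \<in> Linfty D" unfolding f by (rule patch_Linfty[OF A(1)])
  have fL': "f' \<in> Linfty D" unfolding f' by (rule patch_Linfty[OF A'])
  have fi: "integrable M f" by (rule Linfty_integrable[OF fL])
  have shift: "f' (c + x) = f x" for x by (simp add: f f' indicator_def image_iff)
  have supp: "x - c \<in> D \<and> x - c \<in> A" if "f' x \<noteq> 0" for x
    using that A(2) by (auto simp: f' indicator_def split: if_splits)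
  have fA: "x \<in> A" if "f x \<noteq> 0" for x using that by (auto simp: f indicator_def split: if_splits)
  have inD: "c + x \<in> D" if "x \<in> A" for x using that A(3) by auto
  have f0: "0 \<le> f x" for x using l by (simp add: f)
  have \<beta>: "G x y + \<beta> \<le> G (c + x) (c + y)" if xy: "x \<in> A" "y \<in> A" "x \<noteq> y" for x y
  proof -
    have "x \<in> D" "y \<in> D" using xy A(2) by auto
    then have "G (c + x) (c + y) = G x y + h x y - h (c + x) (c + y)"
      using G_eq[OF inD[OF xy(1)] inD[OF xy(2)]] G_eq[of x y] xy(3) by simp
    then show ?thesis using h1[OF xy(1,2)] h2[OF xy(1,2)] unfolding \<beta>_def by linarith
  qed
  have SF_shift: "SF f x + \<beta> * (LINT y|M. f y) \<le> SF f' (c + x)" if x: "x \<in> A" for x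
  proof -
    have xD: "x \<in> D" using x A(2) by auto
    have cxD: "c + x \<in> D" by (rule inD[OF x])
    have i1: "integrable M (\<lambda>y. G0 (c + x) y * f' y)" by (rule SF_integrable[OF fL' cxD])
    have i2: "integrable M (\<lambda>y. G0 x y * f y)" by (rule SF_integrable[OF fL xD])
    have nz: "z - c \<in> D" if "G0 (c + x) z * f' z \<noteq> 0" for z using supp[of z] that by auto
    have "SF f x + \<beta> * (LINT y|M. f y) = (LINT y|M. G0 x y * f y + \<beta> * f y)"
      unfolding SF_eq_G0[OF xD Linfty_measurable[OF fL]] using i2 fi by simp
    also have "\<dots> \<le> (LINT y|M. indicator D (c + y) * (G0 (c + x) (c + y) * f' (c + y)))"
    proof (rule integral_mono_AE)
      show "integrable M (\<lambda>y. G0 x y * f y + \<beta> * f y)" using i2 fi by simp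
      show "integrable M (\<lambda>y. indicator D (c + y) * (G0 (c + x) (c + y) * f' (c + y)))"
        by (rule integral_shift(1)[OF i1 nz])
      show "AE y in M. G0 x y * f y + \<beta> * f y \<le> indicator D (c + y) * (G0 (c + x) (c + y) * f' (c + y))"
        using AE_neq[of x]
      proof eventually_elim
        case (elim y)
        show ?case
        proof (cases "f y = 0")
          case False
          have yA: "y \<in> A" by (rule fA[OF False])
          have "(G0 x y + \<beta>) * f y \<le> G0 (c + x) (c + y) * f y"
            using \<beta>[OF x yA] elim by (intro mult_right_mono f0) (auto simp: G0_def)
          then show ?thesis using inD[OF yA] by (simp add: shift distrib_right)
        qed (simp add: shift)
      qed
    qed
    also have "\<dots> = (LINT y|M. G0 (c + x) y * f' y)"
      by (rule integral_shift(2)[OF i1 nz, symmetric])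
    also have "\<dots> = SF f' (c + x)"
      by (rule SF_eq_G0[OF cxD Linfty_measurable[OF fL'], symmetric])
    finally show ?thesis .
  qed
  have i3: "integrable M (\<lambda>x. f' x * SF f' x)" by (rule Q_integrable[OF fL' fL'])
  have nz: "z - c \<in> D" if "f' z * SF f' z \<noteq> 0" for z using supp[of z] that by auto
  have "Q f f + \<beta> * (LINT x|M. f x)\<^sup>2 = (LINT x|M. f x * SF f x + f x * (\<beta> * (LINT y|M. f y)))"
    unfolding Q_def using Q_integrable[OF fL fL] fi by (simp add: power2_eq_square)
  also have "\<dots> \<le> (LINT x|M. indicator D (c + x) * (f' (c + x) * SF f' (c + x)))"
  proof (rule integral_mono)
    show "integrable M (\<lambda>x. f x * SF f x + f x * (\<beta> * (LINT y|M. f y)))"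
      using Q_integrable[OF fL fL] fi by simp
    show "integrable M (\<lambda>x. indicator D (c + x) * (f' (c + x) * SF f' (c + x)))"
      by (rule integral_shift(1)[OF i3 nz])
    fix x
    show "f x * SF f x + f x * (\<beta> * (LINT y|M. f y)) \<le> indicator D (c + x) * (f' (c + x) * SF f' (c + x))"
    proof (cases "f x = 0")
      case False
      have xA: "x \<in> A" by (rule fA[OF False])
      have "f x * (SF f x + \<beta> * (LINT y|M. f y)) \<le> f x * SF f' (c + x)"
        by (rule mult_left_mono[OF SF_shift[OF xA] f0])
      then show ?thesis using inD[OF xA] by (simp add: shift distrib_left)
    qed (simp add: shift)
  qed
  also have "\<dots> = Q f' f'" unfolding Q_def by (rule integral_shift(2)[OF i3 nz, symmetric])
  finally show ?thesis unfolding \<beta>_def .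
qed

end

text \<open>Here \<open>k2\<close> is the absolute strength of the negative vortex. Both cores are
  then described by nonnegative densities, the vorticity being their difference, and every
  one-vortex estimate applies to both.\<close>

locale vortex_pair = green_domain +
  fixes k1 k2 \<delta> :: real and x1 x2 :: "real^2"
  assumes k1: "k1 > 0" and k2: "k2 > 0" and \<delta>: "\<delta> > 0"
    and cb1: "cball x1 \<delta> \<subseteq> D" and cb2: "cball x2 \<delta> \<subseteq> D"
    and disj: "cball x1 \<delta> \<inter> cball x2 \<delta> = {}"
    and min: "unique_min_on (cball x1 \<delta> \<times> cball x2 \<delta>) (kirchhoff_routh G h k1 (- k2)) (x1, x2)"
begin

abbreviation K where "K \<equiv> admissible_class D (ball x1 \<delta>) (ball x2 \<delta>) k1 (- k2)"

lemma ball_subsets: "ball x1 \<delta> \<subseteq> D" "ball x2 \<delta> \<subseteq> D" "ball x1 \<delta> \<inter> ball x2 \<delta> = {}"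
  using cb1 cb2 disj ball_subset_cball[of x1 \<delta>] ball_subset_cball[of x2 \<delta>] by blast+

lemma admissibleI:
  assumes f1: "f1 \<in> Linfty D" "\<And>x. x \<in> D \<Longrightarrow> 0 \<le> f1 x \<and> f1 x \<le> l"
      "\<And>x. x \<in> D \<Longrightarrow> x \<notin> ball x1 \<delta> \<Longrightarrow> f1 x = 0" "(LINT x|M. f1 x) = k1"
    and f2: "f2 \<in> Linfty D" "\<And>x. x \<in> D \<Longrightarrow> 0 \<le> f2 x \<and> f2 x \<le> l"
      "\<And>x. x \<in> D \<Longrightarrow> x \<notin> ball x2 \<delta> \<Longrightarrow> f2 x = 0" "(LINT x|M. f2 x) = k2"
  shows "(\<lambda>x. f1 x - f2 x) \<in> K l"
proof -
  have "f1 \<in> component_class D (ball x1 \<delta>) k1 l"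
    unfolding component_class_def mem_Collect_eq
  proof (intro conjI f1(1) f1(4))
    show "AE x in M. 0 \<le> sgn k1 * f1 x \<and> sgn k1 * f1 x \<le> l" using f1(2) k1 by (intro AE_I2) simp
    show "AE x in M. x \<notin> ball x1 \<delta> \<longrightarrow> f1 x = 0" using f1(3) by (intro AE_I2) simp
  qed
  moreover have "(\<lambda>x. - f2 x) \<in> component_class D (ball x2 \<delta>) (- k2) l"
    unfolding component_class_def mem_Collect_eq
  proof (intro conjI)
    show "(\<lambda>x. - f2 x) \<in> Linfty D" by (rule Linfty_minus[OF f2(1)])
    show "(LINT x|M. - f2 x) = - k2" by (simp add: f2(4))
    show "AE x in M. 0 \<le> sgn (- k2) * - f2 x \<and> sgn (- k2) * - f2 x \<le> l"
      using f2(2) k2 by (intro AE_I2) simp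
    show "AE x in M. x \<notin> ball x2 \<delta> \<longrightarrow> - f2 x = 0" using f2(3) by (intro AE_I2) simp
  qed
  ultimately show ?thesis unfolding admissible_class_def by force
qed

text \<open>The two components of an admissible vorticity are only known to exist. Disjointness of
  the balls identifies them with its restrictions, so the patch levels describe them explicitly and
  each patch inherits its total mass.\<close>

lemma patch_decomposition:
  assumes \<omega>: "\<omega> \<in> K l" and l: "l > 0"
    and p1: "patch_level D G (ball x1 \<delta>) k1 l \<omega> \<mu>1" and p2: "patch_level D G (ball x2 \<delta>) (- k2) l \<omega> \<mu>2"
    and A1: "A1 = {x \<in> ball x1 \<delta>. SF \<omega> x > \<mu>1}" and A2: "A2 = {x \<in> ball x2 \<delta>. - SF \<omega> x > \<mu>2}"
  shows "\<omega> \<in> Linfty D" and "A1 \<in> sets lebesgue" and "A2 \<in> sets lebesgue"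
    and "AE x in M. \<omega> x = l * indicator A1 x - l * indicator A2 x"
    and "(LINT x|M. l * indicator A1 x) = k1" and "(LINT x|M. l * indicator A2 x) = k2"
proof -
  obtain \<omega>1 \<omega>2 where w1: "\<omega>1 \<in> component_class D (ball x1 \<delta>) k1 l"
    and w2: "\<omega>2 \<in> component_class D (ball x2 \<delta>) (- k2) l"
    and sum: "\<And>x. x \<in> D \<Longrightarrow> \<omega> x = \<omega>1 x + \<omega>2 x"
    using \<omega> unfolding admissible_class_def by auto
  have L: "\<omega>1 \<in> Linfty D" "\<omega>2 \<in> Linfty D" using w1 w2 by (simp_all add: component_class_def)
  have z1: "AE x in M. x \<notin> ball x1 \<delta> \<longrightarrow> \<omega>1 x = 0" and z2: "AE x in M. x \<notin> ball x2 \<delta> \<longrightarrow> \<omega>2 x = 0"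
    using w1 w2 unfolding component_class_def by blast+
  have i: "(LINT x|M. \<omega>1 x) = k1" "(LINT x|M. \<omega>2 x) = - k2"
    using w1 w2 by (simp_all add: component_class_def)
  have L12: "(\<lambda>x. \<omega>1 x + \<omega>2 x) \<in> Linfty D" by (rule Linfty_add[OF L])
  show \<omega>L: "\<omega> \<in> Linfty D"
  proof -
    obtain C where C: "AE x in M. \<bar>\<omega>1 x + \<omega>2 x\<bar> \<le> C" by (rule LinftyE[OF L12])
    have "\<omega> \<in> borel_measurable M \<longleftrightarrow> (\<lambda>x. \<omega>1 x + \<omega>2 x) \<in> borel_measurable M"
      by (rule measurable_cong) (simp add: sum)
    then have m: "\<omega> \<in> borel_measurable M" using Linfty_measurable[OF L12] by simp
    have "AE x in M. \<bar>\<omega> x\<bar> \<le> C" using C AE_space by eventually_elim (simp add: sum)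
    then show ?thesis by (rule LinftyI[OF m])
  qed
  have SFm: "SF \<omega> \<in> borel_measurable M" by (rule SF_measurable[OF \<omega>L])
  show A1m: "A1 \<in> sets lebesgue"
  proof -
    have "{x \<in> D. \<mu>1 < SF \<omega> x} \<in> sets lebesgue" by (rule superlevel_lebesgue[OF SFm])
    then have "ball x1 \<delta> \<inter> {x \<in> D. \<mu>1 < SF \<omega> x} \<in> sets lebesgue" by (intro sets.Int) auto
    moreover have "ball x1 \<delta> \<inter> {x \<in> D. \<mu>1 < SF \<omega> x} = A1" using ball_subsets by (auto simp: A1)
    ultimately show ?thesis by simp
  qed
  show A2m: "A2 \<in> sets lebesgue"
  proof -
    have "{x \<in> D. \<mu>2 < - SF \<omega> x} \<in> sets lebesgue"
      by (rule superlevel_lebesgue[OF borel_measurable_uminus[OF SFm]])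
    then have "ball x2 \<delta> \<inter> {x \<in> D. \<mu>2 < - SF \<omega> x} \<in> sets lebesgue" by (intro sets.Int) auto
    moreover have "ball x2 \<delta> \<inter> {x \<in> D. \<mu>2 < - SF \<omega> x} = A2" using ball_subsets by (auto simp: A2)
    ultimately show ?thesis by simp
  qed
  have B: "x \<notin> ball x2 \<delta>" if "x \<in> ball x1 \<delta>" for x using that ball_subsets(3) by blast
  have e1: "AE x in M. \<omega> x * indicator (ball x1 \<delta>) x = l * indicator A1 x"
  proof -
    have "{z. sgn k1 * stream_function D G \<omega> z > \<mu>1} \<inter> ball x1 \<delta> = A1" using k1 by (auto simp: A1)
    then show ?thesis using p1 k1 unfolding patch_level_def by simp
  qed
  have e2: "AE x in M. \<omega> x * indicator (ball x2 \<delta>) x = - l * indicator A2 x"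
  proof -
    have "{z. sgn (- k2) * stream_function D G \<omega> z > \<mu>2} \<inter> ball x2 \<delta> = A2" using k2 by (auto simp: A2)
    then show ?thesis using p2 k2 unfolding patch_level_def by simp
  qed
  have f1: "AE x in M. \<omega>1 x = l * indicator A1 x"
    using e1 z1 z2 AE_space
  proof eventually_elim
    case (elim x)
    show ?case
    proof (cases "x \<in> ball x1 \<delta>")
      case True
      then have "\<omega>2 x = 0" using elim(3) B[OF True] by blast
      then show ?thesis using elim(1,4) True sum[of x] by (simp add: indicator_def)
    next
      case False
      then have "x \<notin> A1" by (simp add: A1)
      then show ?thesis using elim(2) False by simp
    qed
  qed
  have f2: "AE x in M. \<omega>2 x = - l * indicator A2 x"
    using e2 z1 z2 AE_space
  proof eventually_elim
    case (elim x)
    show ?case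
    proof (cases "x \<in> ball x2 \<delta>")
      case True
      then have "\<omega>1 x = 0" using elim(2) B[of x] by blast
      then show ?thesis using elim(1,4) True sum[of x] by (simp add: indicator_def)
    next
      case False
      then have "x \<notin> A2" by (simp add: A2)
      then show ?thesis using elim(3) False by simp
    qed
  qed
  show "AE x in M. \<omega> x = l * indicator A1 x - l * indicator A2 x"
    using f1 f2 AE_space by eventually_elim (simp add: sum)
  have "(LINT x|M. l * indicator A1 x) = (LINT x|M. \<omega>1 x)"
    by (rule integral_cong_AE[OF Linfty_measurable[OF patch_Linfty[OF A1m]] Linfty_measurable[OF L(1)]])
      (use f1 in eventually_elim, simp)
  then show "(LINT x|M. l * indicator A1 x) = k1" using i(1) by (rule trans)
  have "(LINT x|M. - l * indicator A2 x) = (LINT x|M. \<omega>2 x)"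
    by (rule integral_cong_AE[OF Linfty_measurable[OF patch_Linfty[OF A2m]] Linfty_measurable[OF L(2)]])
      (use f2 in eventually_elim, simp)
  then have "(LINT x|M. - l * indicator A2 x) = - k2" using i(2) by (rule trans)
  then show "(LINT x|M. l * indicator A2 x) = k2" by simp
qed

end

section \<open>Localization of maximizers\<close>

context vortex_pair
begin

definition core_radius :: "real \<Rightarrow> real \<Rightarrow> real" where
  "core_radius k l = sqrt (k / (pi * l))"

text \<open>Packages both conclusions of \<open>vortex_core\<close> with one constant, so that it
  can be chosen independently of \<open>l\<close> and of the maximizer.\<close>

definition core_bound :: "real \<Rightarrow> real \<Rightarrow> real \<Rightarrow> (real^2) set \<Rightarrow> real \<Rightarrow> bool" where
  "core_bound C k l A \<mu> \<longleftrightarrow> k / (2 * pi) * (ln (R / core_radius k l) + 2) - C \<le> \<mu> \<and>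
     (\<forall>x\<in>A. \<forall>y\<in>A. norm (x - y) < C * core_radius k l)"

definition max_patches ::
  "real \<Rightarrow> (real^2 \<Rightarrow> real) \<Rightarrow> (real^2) set \<Rightarrow> (real^2) set \<Rightarrow> real \<Rightarrow> real \<Rightarrow> bool" where
  "max_patches l \<omega> A1 A2 \<mu>1 \<mu>2 \<longleftrightarrow> l > 0 \<and> is_maximizer (energy D G) (K l) \<omega> \<and>
     patch_level D G (ball x1 \<delta>) k1 l \<omega> \<mu>1 \<and> patch_level D G (ball x2 \<delta>) (- k2) l \<omega> \<mu>2 \<and>
     A1 = {x \<in> ball x1 \<delta>. SF \<omega> x > \<mu>1} \<and> A2 = {x \<in> ball x2 \<delta>. - SF \<omega> x > \<mu>2}"

lemma core_radius_pos: "k > 0 \<Longrightarrow> l > 0 \<Longrightarrow> core_radius k l > 0"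
  by (simp add: core_radius_def)

lemma core_radius_sq: "k > 0 \<Longrightarrow> l > 0 \<Longrightarrow> pi * (core_radius k l)\<^sup>2 = k / l"
  by (simp add: core_radius_def)

lemma strength_eq: "k > 0 \<Longrightarrow> l > 0 \<Longrightarrow> l = k / (pi * (core_radius k l)\<^sup>2)"
  by (simp add: core_radius_sq)

lemma max_patchesD:
  assumes c: "max_patches l \<omega> A1 A2 \<mu>1 \<mu>2"
  shows "l > 0" and "\<omega> \<in> Linfty D" and "A1 \<in> sets lebesgue" "A2 \<in> sets lebesgue"
    and "A1 \<subseteq> ball x1 \<delta>" "A2 \<subseteq> ball x2 \<delta>"
    and "AE x in M. \<omega> x = l * indicator A1 x - l * indicator A2 x"
    and "(LINT x|M. l * indicator A1 x) = k1" "(LINT x|M. l * indicator A2 x) = k2"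
    and "measure lebesgue A1 = pi * (core_radius k1 l)\<^sup>2" "measure lebesgue A2 = pi * (core_radius k2 l)\<^sup>2"
    and "\<And>x. x \<in> D \<Longrightarrow> SF \<omega> x = SF (\<lambda>x. l * indicator A1 x) x - SF (\<lambda>x. l * indicator A2 x) x"
    and "energy D G \<omega> = energy D G (\<lambda>x. l * indicator A1 x - l * indicator A2 x)"
    and "\<And>v. v \<in> K l \<Longrightarrow> energy D G v \<le> energy D G \<omega>"
    and "A1 = {x \<in> ball x1 \<delta>. SF \<omega> x > \<mu>1}" "A2 = {x \<in> ball x2 \<delta>. - SF \<omega> x > \<mu>2}"
proof -
  have c': "l > 0" "\<omega> \<in> K l" "\<And>v. v \<in> K l \<Longrightarrow> energy D G v \<le> energy D G \<omega>"
    "patch_level D G (ball x1 \<delta>) k1 l \<omega> \<mu>1" "patch_level D G (ball x2 \<delta>) (- k2) l \<omega> \<mu>2"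
    "A1 = {x \<in> ball x1 \<delta>. SF \<omega> x > \<mu>1}" "A2 = {x \<in> ball x2 \<delta>. - SF \<omega> x > \<mu>2}"
    using c unfolding max_patches_def is_maximizer_def by blast+
  note pd = patch_decomposition[OF c'(2,1,4-7)]
  show "l > 0" "\<omega> \<in> Linfty D" "A1 \<in> sets lebesgue" "A2 \<in> sets lebesgue"
    "AE x in M. \<omega> x = l * indicator A1 x - l * indicator A2 x"
    "(LINT x|M. l * indicator A1 x) = k1" "(LINT x|M. l * indicator A2 x) = k2"
    "\<And>v. v \<in> K l \<Longrightarrow> energy D G v \<le> energy D G \<omega>"
    "A1 = {x \<in> ball x1 \<delta>. SF \<omega> x > \<mu>1}" "A2 = {x \<in> ball x2 \<delta>. - SF \<omega> x > \<mu>2}"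
    using c'(1,3,6,7) pd by blast+
  show s: "A1 \<subseteq> ball x1 \<delta>" "A2 \<subseteq> ball x2 \<delta>" unfolding c'(6,7) by blast+
  have sD: "A1 \<subseteq> D" "A2 \<subseteq> D" using s ball_subsets by blast+
  have "l * measure lebesgue A1 = k1" using pd(5) unfolding integral_patch[OF pd(2) sD(1)] .
  then show "measure lebesgue A1 = pi * (core_radius k1 l)\<^sup>2"
    using c'(1) k1 by (simp add: core_radius_sq field_simps)
  have "l * measure lebesgue A2 = k2" using pd(6) unfolding integral_patch[OF pd(3) sD(2)] .
  then show "measure lebesgue A2 = pi * (core_radius k2 l)\<^sup>2"
    using c'(1) k2 by (simp add: core_radius_sq field_simps)
  have L: "(\<lambda>x. l * indicator A1 x) \<in> Linfty D" "(\<lambda>x. l * indicator A2 x) \<in> Linfty D"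
    by (rule patch_Linfty[OF pd(2)], rule patch_Linfty[OF pd(3)])
  have LD: "(\<lambda>x. l * indicator A1 x - l * indicator A2 x) \<in> Linfty D" by (rule Linfty_diff[OF L])
  show "SF \<omega> x = SF (\<lambda>x. l * indicator A1 x) x - SF (\<lambda>x. l * indicator A2 x) x" if "x \<in> D" for x
    using SF_cong_AE[OF Linfty_measurable[OF pd(1)] Linfty_measurable[OF LD] pd(4) that]
      SF_diff[OF L that] by simp
  show "energy D G \<omega> = energy D G (\<lambda>x. l * indicator A1 x - l * indicator A2 x)"
    unfolding energy_eq_Q Q_cong_AE[OF pd(1,1,4) LD pd(4) LD] ..
qed

lemma continuous_G_pair: "continuous_on (cball x1 \<delta> \<times> cball x2 \<delta>) (\<lambda>z. G (fst z) (snd z))"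
proof -
  have ne: "fst z \<noteq> snd z" if "z \<in> cball x1 \<delta> \<times> cball x2 \<delta>" for z using that disj by auto
  have "continuous_on (cball x1 \<delta> \<times> cball x2 \<delta>)
      (\<lambda>z. - ln (norm (fst z - snd z)) / (2 * pi) - h (fst z) (snd z))"
    using cb1 cb2 ne
    by (intro continuous_intros continuous_on_subset[OF continuous_h]) auto
  then show ?thesis
  proof (rule continuous_on_eq)
    fix z assume z: "z \<in> cball x1 \<delta> \<times> cball x2 \<delta>"
    show "- ln (norm (fst z - snd z)) / (2 * pi) - h (fst z) (snd z) = G (fst z) (snd z)"
      by (rule G_eq[symmetric]) (use z cb1 cb2 ne[OF z] in auto)
  qed
qed

lemma h_bounded_on:
  assumes "cball x \<delta> \<subseteq> D"
  obtains C where "C \<ge> 0" "\<And>a b. a \<in> cball x \<delta> \<Longrightarrow> b \<in> cball x \<delta> \<Longrightarrow> \<bar>h a b\<bar> \<le> C"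
proof -
  have "compact ((\<lambda>z. h (fst z) (snd z)) ` (cball x \<delta> \<times> cball x \<delta>))"
    using assms by (intro compact_continuous_image continuous_on_subset[OF continuous_h] compact_Times) auto
  then obtain C where C: "\<And>z. z \<in> cball x \<delta> \<times> cball x \<delta> \<Longrightarrow> norm (h (fst z) (snd z)) \<le> C" "C > 0"
    by (fastforce dest: compact_imp_bounded simp: bounded_pos)
  show ?thesis by (rule that[of C]) (use C in force)+
qed

lemma G_bounded_on_pair:
  obtains C where "C \<ge> 0" "\<And>a b. a \<in> cball x1 \<delta> \<Longrightarrow> b \<in> cball x2 \<delta> \<Longrightarrow> G a b \<le> C"
    "\<And>a b. a \<in> cball x1 \<delta> \<Longrightarrow> b \<in> cball x2 \<delta> \<Longrightarrow> G b a \<le> C"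
proof -
  have "compact ((\<lambda>z. G (fst z) (snd z)) ` (cball x1 \<delta> \<times> cball x2 \<delta>))"
    by (intro compact_continuous_image continuous_G_pair compact_Times) auto
  then obtain C where C: "\<And>z. z \<in> cball x1 \<delta> \<times> cball x2 \<delta> \<Longrightarrow> norm (G (fst z) (snd z)) \<le> C" "C > 0"
    by (fastforce dest: compact_imp_bounded simp: bounded_pos)
  have C1: "G a b \<le> C" if "a \<in> cball x1 \<delta>" "b \<in> cball x2 \<delta>" for a b
    using C(1)[of "(a, b)"] that by simp
  have sym: "G b a = G a b" if "a \<in> cball x1 \<delta>" "b \<in> cball x2 \<delta>" for a b
    using that cb1 cb2 by (intro G_sym) auto
  show ?thesis by (rule that[of C]) (use C(2) C1 sym in auto)
qed

text \<open>Inside a disc of radius \<open>r\<close> all distances are at most \<open>2 * r\<close>,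
  so the kernel is at least \<open>- ln (2 * r) / (2 * pi) - Ch\<close>. This crude bound for the
  competitor loses only a constant.\<close>

lemma maximizer_energy_ge:
  assumes c: "max_patches l \<omega> A1 A2 \<mu>1 \<mu>2"
    and e1: "2 * core_radius k1 l \<le> \<delta>" and e2: "2 * core_radius k2 l \<le> \<delta>"
    and Ch1: "\<And>a b. a \<in> cball x1 \<delta> \<Longrightarrow> b \<in> cball x1 \<delta> \<Longrightarrow> \<bar>h a b\<bar> \<le> Ch1"
    and Ch2: "\<And>a b. a \<in> cball x2 \<delta> \<Longrightarrow> b \<in> cball x2 \<delta> \<Longrightarrow> \<bar>h a b\<bar> \<le> Ch2"
    and CG: "\<And>a b. a \<in> cball x1 \<delta> \<Longrightarrow> b \<in> cball x2 \<delta> \<Longrightarrow> G a b \<le> CG"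
  shows "k1\<^sup>2 * (- ln (2 * core_radius k1 l) / (2 * pi) - Ch1) + k2\<^sup>2 * (- ln (2 * core_radius k2 l) / (2 * pi) - Ch2)
     - 2 * CG * k1 * k2 \<le> 2 * energy D G \<omega>"
proof -
  have l: "l > 0" by (rule max_patchesD(1)[OF c])
  define r1 r2 where "r1 = core_radius k1 l" and "r2 = core_radius k2 l"
  have r: "r1 > 0" "r2 > 0" using core_radius_pos k1 k2 l by (auto simp: r1_def r2_def)
  have rd: "r1 \<le> \<delta>" "r2 \<le> \<delta>" using e1 e2 r by (auto simp: r1_def r2_def)
  have T1: "ball x1 r1 \<subseteq> ball x1 \<delta>" "ball x1 r1 \<subseteq> D" and T2: "ball x2 r2 \<subseteq> ball x2 \<delta>" "ball x2 r2 \<subseteq> D"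
    using rd ball_subsets subset_ball[of r1 \<delta> x1] subset_ball[of r2 \<delta> x2] by blast+
  define t1 t2 where "t1 = (\<lambda>x. l * indicator (ball x1 r1) x :: real)"
    and "t2 = (\<lambda>x. l * indicator (ball x2 r2) x :: real)"
  have L: "t1 \<in> Linfty D" "t2 \<in> Linfty D" unfolding t1_def t2_def by (intro patch_Linfty; simp)+
  have nn: "0 \<le> t1 x" "0 \<le> t2 x" for x using l by (auto simp: t1_def t2_def)
  have i1: "(LINT x|M. t1 x) = k1" unfolding t1_def
    using measure_ball_real2[of r1 x1] r l core_radius_sq[OF k1 l]
    by (subst integral_patch[OF _ T1(2)]) (simp_all add: r1_def[symmetric] del: measure_completion content_ball)
  have i2: "(LINT x|M. t2 x) = k2" unfolding t2_def
    using measure_ball_real2[of r2 x2] r l core_radius_sq[OF k2 l]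
    by (subst integral_patch[OF _ T2(2)]) (simp_all add: r2_def[symmetric] del: measure_completion content_ball)
  have "(\<lambda>x. t1 x - t2 x) \<in> K l"
  proof (rule admissibleI[OF L(1) _ _ i1 L(2) _ _ i2])
    show "0 \<le> t1 x \<and> t1 x \<le> l" "0 \<le> t2 x \<and> t2 x \<le> l" for x
      using l by (auto simp: t1_def t2_def indicator_def)
    show "t1 x = 0" if "x \<notin> ball x1 \<delta>" for x using that T1 by (auto simp: t1_def indicator_def)
    show "t2 x = 0" if "x \<notin> ball x2 \<delta>" for x using that T2 by (auto simp: t2_def indicator_def)
  qed
  then have "2 * energy D G (\<lambda>x. t1 x - t2 x) \<le> 2 * energy D G \<omega>" using max_patchesD(14)[OF c] by simp
  then have E: "Q t1 t1 + Q t2 t2 - 2 * Q t1 t2 \<le> 2 * energy D G \<omega>" by (simp add: energy_diff_eq[OF L])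
  have low: "- ln (2 * r) / (2 * pi) - Ch \<le> G x y"
    if "x \<in> ball z r" "y \<in> ball z r" "x \<noteq> y" "r > 0" "r \<le> \<delta>" "cball z \<delta> \<subseteq> D"
      "\<And>a b. a \<in> cball z \<delta> \<Longrightarrow> b \<in> cball z \<delta> \<Longrightarrow> \<bar>h a b\<bar> \<le> Ch" for x y z :: "real^2" and r Ch
  proof -
    have xc: "x \<in> cball z \<delta>" "y \<in> cball z \<delta>" using that(1,2,5) by auto
    then have xyD: "x \<in> D" "y \<in> D" using that(6) by auto
    have "norm (x - y) \<le> 2 * r"
      using that(1,2) dist_triangle2[of x y z] by (simp add: dist_norm norm_minus_commute)
    then have "ln (norm (x - y)) \<le> ln (2 * r)" using that(3) by (intro ln_mono) auto
    then have "- ln (2 * r) / (2 * pi) \<le> - ln (norm (x - y)) / (2 * pi)" by (intro divide_right_mono) auto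
    moreover have "h x y \<le> Ch" using that(7)[OF xc] by simp
    ultimately show ?thesis using G_eq[OF xyD that(3)] by linarith
  qed
  have s1: "x \<in> ball x1 r1" if "t1 x \<noteq> 0" for x using that by (auto simp: t1_def indicator_def split: if_splits)
  have s2: "x \<in> ball x2 r2" if "t2 x \<noteq> 0" for x using that by (auto simp: t2_def indicator_def split: if_splits)
  have q1: "(- ln (2 * r1) / (2 * pi) - Ch1) * (LINT x|M. t1 x) * (LINT x|M. t1 x) \<le> Q t1 t1"
    by (rule Q_ge_const[OF L(1) nn(1) L(1) nn(1)]) (use low[OF s1 s1 _ r(1) rd(1) cb1 Ch1] in auto)
  have q2: "(- ln (2 * r2) / (2 * pi) - Ch2) * (LINT x|M. t2 x) * (LINT x|M. t2 x) \<le> Q t2 t2"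
    by (rule Q_ge_const[OF L(2) nn(2) L(2) nn(2)]) (use low[OF s2 s2 _ r(2) rd(2) cb2 Ch2] in auto)
  have q3: "Q t1 t2 \<le> CG * (LINT x|M. t1 x) * (LINT x|M. t2 x)"
  proof (rule Q_le_const[OF L(1) nn(1) L(2) nn(2)])
    fix x y assume "t1 x \<noteq> 0" "t2 y \<noteq> 0"
    then have "x \<in> cball x1 \<delta>" "y \<in> cball x2 \<delta>" using s1 s2 T1 T2 ball_subset_cball by blast+
    then show "G x y \<le> CG" by (rule CG)
  qed
  show ?thesis using q1 q2 q3 E unfolding i1 i2 r1_def[symmetric] r2_def[symmetric]
    by (simp add: power2_eq_square mult_ac)
qed

text \<open>The two integrated deficits add up to \<open>U1 * k1 + U2 * k2\<close> minus twice the
  energy, because each of them contains the interaction term once. Comparison with the discs bounds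
  this sum independently of \<open>l\<close>.\<close>

lemma core_estimates:
  obtains C where "C > 0"
    and "\<And>l \<omega> A1 A2 \<mu>1 \<mu>2. max_patches l \<omega> A1 A2 \<mu>1 \<mu>2 \<Longrightarrow> core_radius k1 l \<le> R \<Longrightarrow> core_radius k2 l \<le> R \<Longrightarrow>
      2 * core_radius k1 l \<le> \<delta> \<Longrightarrow> 2 * core_radius k2 l \<le> \<delta> \<Longrightarrow>
      core_bound C k1 l A1 \<mu>1 \<and> core_bound C k2 l A2 \<mu>2"
proof -
  obtain Ch1 where Ch1: "Ch1 \<ge> 0" "\<And>a b. a \<in> cball x1 \<delta> \<Longrightarrow> b \<in> cball x1 \<delta> \<Longrightarrow> \<bar>h a b\<bar> \<le> Ch1"
    using h_bounded_on[OF cb1] by metis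
  obtain Ch2 where Ch2: "Ch2 \<ge> 0" "\<And>a b. a \<in> cball x2 \<delta> \<Longrightarrow> b \<in> cball x2 \<delta> \<Longrightarrow> \<bar>h a b\<bar> \<le> Ch2"
    using h_bounded_on[OF cb2] by metis
  obtain CG where CG: "CG \<ge> 0" "\<And>a b. a \<in> cball x1 \<delta> \<Longrightarrow> b \<in> cball x2 \<delta> \<Longrightarrow> G a b \<le> CG"
    "\<And>a b. a \<in> cball x1 \<delta> \<Longrightarrow> b \<in> cball x2 \<delta> \<Longrightarrow> G b a \<le> CG"
    using G_bounded_on_pair by metis
  \<comment> \<open>What remains of \<open>U1 * k1 + U2 * k2\<close> minus the lower bound for twice
    the energy after the logarithms of the core radii have cancelled.\<close>
  define C' where "C' = k1\<^sup>2 * ((ln R + 2 + ln 2) / (2 * pi) + Ch1) + k2\<^sup>2 * ((ln R + 2 + ln 2) / (2 * pi) + Ch2)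
    + 2 * CG * k1 * k2"
  have lnR: "ln R \<ge> 0" using R_ge1 by simp
  have C': "C' > 0"
  proof -
    have a: "0 < (ln R + 2 + ln 2) / (2 * pi)"
      using lnR by (intro divide_pos_pos add_nonneg_pos add_pos_pos add_nonneg_nonneg) auto
    have "0 < k1\<^sup>2 * ((ln R + 2 + ln 2) / (2 * pi) + Ch1)" "0 < k2\<^sup>2 * ((ln R + 2 + ln 2) / (2 * pi) + Ch2)"
      using a Ch1(1) Ch2(1) k1 k2 by (intro mult_pos_pos add_pos_nonneg; simp)+
    moreover have "0 \<le> 2 * CG * k1 * k2" using CG(1) k1 k2 by simp
    ultimately show ?thesis by (simp add: C'_def)
  qed
  define c1 where "c1 = 2 * C' / k1 + k1 * (ln 5 + 2) / (2 * pi) + 2 * Ch1 * k1 + CG * k2"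
  define c2 where "c2 = 2 * C' / k2 + k2 * (ln 5 + 2) / (2 * pi) + 2 * Ch2 * k2 + CG * k1"
  define C where "C = max (max c1 c2) (max (2 * exp (6 * pi * c1 / k1)) (2 * exp (6 * pi * c2 / k2)))"
  have C: "C \<ge> c1" "C \<ge> c2" "C \<ge> 2 * exp (6 * pi * c1 / k1)" "C \<ge> 2 * exp (6 * pi * c2 / k2)"
    by (simp_all add: C_def)
  have Cpos: "C > 0" using C(3) exp_gt_zero[of "6 * pi * c1 / k1"] by linarith
  show ?thesis
  proof (rule that[OF Cpos])
    fix l \<omega> A1 A2 \<mu>1 \<mu>2
    assume c: "max_patches l \<omega> A1 A2 \<mu>1 \<mu>2" and eR: "core_radius k1 l \<le> R" "core_radius k2 l \<le> R"
      and ed: "2 * core_radius k1 l \<le> \<delta>" "2 * core_radius k2 l \<le> \<delta>"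
    note cD = max_patchesD[OF c]
    define e1 e2 where "e1 = core_radius k1 l" and "e2 = core_radius k2 l"
    have e: "0 < e1" "0 < e2" using core_radius_pos k1 k2 cD(1) by (auto simp: e1_def e2_def)
    have l1: "l = k1 / (pi * e1\<^sup>2)" and l2: "l = k2 / (pi * e2\<^sup>2)"
      unfolding e1_def e2_def by (intro strength_eq k1 k2 cD(1))+
    define f1 f2 where "f1 = (\<lambda>x. l * indicator A1 x :: real)" and "f2 = (\<lambda>x. l * indicator A2 x :: real)"
    have L: "f1 \<in> Linfty D" "f2 \<in> Linfty D" unfolding f1_def f2_def by (rule patch_Linfty[OF cD(3)], rule patch_Linfty[OF cD(4)])
    have nn: "0 \<le> f1 x" "0 \<le> f2 x" for x using cD(1) by (auto simp: f1_def f2_def)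
    have i: "(LINT x|M. f1 x) = k1" "(LINT x|M. f2 x) = k2" unfolding f1_def f2_def by (rule cD(8), rule cD(9))
    have AD: "A1 \<subseteq> D" "A2 \<subseteq> D" using cD(5,6) ball_subsets by blast+
    have psi: "SF \<omega> x = SF f1 x - SF f2 x" if "x \<in> D" for x using cD(12)[OF that] by (simp add: f1_def f2_def)
    define U1 U2 where "U1 = k1 / (2 * pi) * (ln (R / e1) + 2)" and "U2 = k2 / (2 * pi) * (ln (R / e2) + 2)"
    have U1: "SF f1 x \<le> U1" if "x \<in> D" for x
      unfolding U1_def f1_def
      by (rule SF_patch_le[OF cD(3) AD(1) cD(10)[folded e1_def] e(1) eR(1)[folded e1_def] k1 l1 that])
    have U2: "SF f2 x \<le> U2" if "x \<in> D" for x
      unfolding U2_def f2_def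
      by (rule SF_patch_le[OF cD(4) AD(2) cD(11)[folded e2_def] e(2) eR(2)[folded e2_def] k2 l2 that])
    have pos: "0 \<le> SF f1 x" "0 \<le> SF f2 x" if "x \<in> D" for x
      by (rule SF_nonneg[OF L(1) that nn(1)], rule SF_nonneg[OF L(2) that nn(2)])
    define d1 d2 where "d1 = (LINT x|M. f1 x * (U1 - (SF f1 x - SF f2 x)))"
      and "d2 = (LINT x|M. f2 x * (U2 - (SF f2 x - SF f1 x)))"
    have d_eq: "(LINT x|M. f x * (U - (SF f x - SF g x))) = U * (LINT x|M. f x) - Q f f + Q f g"
      if "f \<in> Linfty D" "g \<in> Linfty D" for f g U
    proof -
      have "(LINT x|M. f x * (U - (SF f x - SF g x))) = (LINT x|M. U * f x - f x * SF f x + f x * SF g x)"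
        by (simp add: algebra_simps)
      then show ?thesis unfolding Q_def
        using Linfty_integrable[OF that(1)] Q_integrable[OF that(1,1)] Q_integrable[OF that] by simp
    qed
    have d1: "d1 = U1 * k1 - Q f1 f1 + Q f1 f2" and d2: "d2 = U2 * k2 - Q f2 f2 + Q f2 f1"
      unfolding d1_def d2_def d_eq[OF L] d_eq[OF L(2,1)] i by (rule refl)+
    \<comment> \<open>The opposite vortex only lowers the signed stream function, so neither deficit
      is negative and the bound for their sum holds for each of them.\<close>
    have d_nn: "d1 \<ge> 0" "d2 \<ge> 0"
      unfolding d1_def d2_def
      by (intro integral_nonneg_AE AE_I2 mult_nonneg_nonneg nn; use U1 U2 pos in fastforce)+
    have E: "2 * energy D G \<omega> = Q f1 f1 + Q f2 f2 - 2 * Q f1 f2"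
      using energy_diff_eq[OF L] cD(13) by (simp add: f1_def f2_def)
    have low: "k1\<^sup>2 * (- ln (2 * e1) / (2 * pi) - Ch1) + k2\<^sup>2 * (- ln (2 * e2) / (2 * pi) - Ch2)
       - 2 * CG * k1 * k2 \<le> 2 * energy D G \<omega>"
      unfolding e1_def e2_def by (rule maximizer_energy_ge[OF c ed Ch1(2) Ch2(2) CG(2)])
    have u: "k / (2 * pi) * (ln (R / e) + 2) * k + k\<^sup>2 * (ln (2 * e) / (2 * pi) + c) = k\<^sup>2 * ((ln R + 2 + ln 2) / (2 * pi) + c)"
      if "e > 0" for k e c :: real
    proof -
      have eq: "ln (R / e) = ln R - ln e" "ln (2 * e) = ln 2 + ln e"
        using R_ge1 that by (simp_all add: ln_div ln_mult)
      show ?thesis unfolding eq by (simp add: power2_eq_square field_simps)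
    qed
    note u1 = u[OF e(1), of k1 Ch1, folded U1_def] and u2 = u[OF e(2), of k2 Ch2, folded U2_def]
    have "d1 + d2 = U1 * k1 + U2 * k2 - 2 * energy D G \<omega>"
      unfolding d1 d2 E Q_sym[OF L(2) L(1)] by simp
    also have "\<dots> \<le> C'"
      using low u1 u2 unfolding C'_def by (simp add: algebra_simps)
    finally have d: "d1 \<le> C'" "d2 \<le> C'" using d_nn by linarith+
    have g2: "SF f2 x \<le> CG * k2" if x: "x \<in> ball x1 \<delta>" for x
      unfolding i(2)[symmetric]
    proof (rule SF_le_const[OF L(2) _ nn(2)])
      show "x \<in> D" using x ball_subsets by blast
      fix y assume "f2 y \<noteq> 0"
      then have "y \<in> A2" by (auto simp: f2_def indicator_def split: if_splits)
      then show "G x y \<le> CG" using x cD(6) ball_subset_cball by (intro CG(2)) blast+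
    qed
    have g1: "SF f1 x \<le> CG * k1" if x: "x \<in> ball x2 \<delta>" for x
      unfolding i(1)[symmetric]
    proof (rule SF_le_const[OF L(1) _ nn(1)])
      show "x \<in> D" using x ball_subsets by blast
      fix y assume "f1 y \<noteq> 0"
      then have "y \<in> A1" by (auto simp: f1_def indicator_def split: if_splits)
      then show "G x y \<le> CG" using x cD(5) ball_subset_cball by (intro CG(3)) blast+
    qed
    have Cg0: "0 \<le> CG * k2" "0 \<le> CG * k1" using CG(1) k1 k2 by auto
    have A1iff: "x \<in> A1 \<longleftrightarrow> \<mu>1 < SF f1 x - SF f2 x" if x: "x \<in> ball x1 \<delta>" for x
    proof -
      have "x \<in> D" using x ball_subsets by blast
      then show ?thesis using x psi by (subst cD(15)) simp
    qed
    have A2iff: "x \<in> A2 \<longleftrightarrow> \<mu>2 < SF f2 x - SF f1 x" if x: "x \<in> ball x2 \<delta>" for x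
    proof -
      have "x \<in> D" using x ball_subsets by blast
      then show ?thesis using x psi by (subst cD(16)) simp
    qed
    note core1 = vortex_core[OF cb1 Ch1(2) k1 C' Cg0(1) c1_def e(1) eR(1)[folded e1_def] ed(1)[folded e1_def] l1
        cD(3,5) cD(10)[folded e1_def] f1_def L(2) nn(2) g2 A1iff U1_def d(1)[unfolded d1_def]]
    note core2 = vortex_core[OF cb2 Ch2(2) k2 C' Cg0(2) c2_def e(2) eR(2)[folded e2_def] ed(2)[folded e2_def] l2
        cD(4,6) cD(11)[folded e2_def] f2_def L(1) nn(1) g1 A2iff U2_def d(2)[unfolded d2_def]]
    have m1: "U1 - c1 \<le> \<mu>1" by (rule core1(1))
    have m2: "U2 - c2 \<le> \<mu>2" by (rule core2(1))
    have D1: "norm (x - y) < C * e1" if "x \<in> A1" "y \<in> A1" for x y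
    proof -
      have "norm (x - y) < 2 * (exp (6 * pi * c1 / k1) * e1)" by (rule core1(2)[OF _ _ _ _ that])
      also have "\<dots> = (2 * exp (6 * pi * c1 / k1)) * e1" by simp
      also have "\<dots> \<le> C * e1" using C(3) e by (intro mult_right_mono) auto
      finally show ?thesis .
    qed
    have D2: "norm (x - y) < C * e2" if "x \<in> A2" "y \<in> A2" for x y
    proof -
      have "norm (x - y) < 2 * (exp (6 * pi * c2 / k2) * e2)" by (rule core2(2)[OF _ _ _ _ that])
      also have "\<dots> = (2 * exp (6 * pi * c2 / k2)) * e2" by simp
      also have "\<dots> \<le> C * e2" using C(4) e by (intro mult_right_mono) auto
      finally show ?thesis .
    qed
    show "core_bound C k1 l A1 \<mu>1 \<and> core_bound C k2 l A2 \<mu>2"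
      using m1 m2 C(1,2) D1 D2 unfolding core_bound_def U1_def U2_def e1_def e2_def by auto
  qed
qed

text \<open>Translating both cores to \<open>x1\<close>, \<open>x2\<close> preserves the logarithmic self-energies, so maximality gives
  \<open>H X1 X2 \<le> H x1 x2 + o(1)\<close> for points \<open>X1\<close>, \<open>X2\<close> of the cores.\<close>

lemma core_location:
  obtains r where "r > 0" "r \<le> \<delta> / 4"
    and "\<And>l \<omega> A1 A2 \<mu>1 \<mu>2. max_patches l \<omega> A1 A2 \<mu>1 \<mu>2 \<Longrightarrow>
      (\<And>x y. x \<in> A1 \<Longrightarrow> y \<in> A1 \<Longrightarrow> norm (x - y) < r) \<Longrightarrow>
      (\<And>x y. x \<in> A2 \<Longrightarrow> y \<in> A2 \<Longrightarrow> norm (x - y) < r) \<Longrightarrow>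
      A1 \<subseteq> ball x1 (\<delta> / 2) \<and> A2 \<subseteq> ball x2 (\<delta> / 2)"
proof -
  define H where "H = kirchhoff_routh G h k1 (- k2)"
  have H: "H (a, b) = 2 * k1 * k2 * G a b + (k1\<^sup>2 * h a a + k2\<^sup>2 * h b b)" for a b
    by (simp add: H_def kirchhoff_routh_def)
  have diag: "continuous_on (cball x1 \<delta> \<times> cball x2 \<delta>) (\<lambda>z. h (fst z) (fst z))"
    "continuous_on (cball x1 \<delta> \<times> cball x2 \<delta>) (\<lambda>z. h (snd z) (snd z))"
  proof -
    have "continuous_on D (\<lambda>x. h x x)"
      using continuous_on_compose2[OF continuous_h, of D "\<lambda>x. (x, x)"]
      by (simp add: continuous_on_Pair image_subset_iff)
    note hd = continuous_on_compose2[OF this]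
    show "continuous_on (cball x1 \<delta> \<times> cball x2 \<delta>) (\<lambda>z. h (fst z) (fst z))"
      by (rule hd) (use cb1 in \<open>auto intro!: continuous_intros\<close>)
    show "continuous_on (cball x1 \<delta> \<times> cball x2 \<delta>) (\<lambda>z. h (snd z) (snd z))"
      by (rule hd) (use cb2 in \<open>auto intro!: continuous_intros\<close>)
  qed
  have Hc: "continuous_on (cball x1 \<delta> \<times> cball x2 \<delta>) H"
  proof -
    have "continuous_on (cball x1 \<delta> \<times> cball x2 \<delta>)
       (\<lambda>z. 2 * k1 * k2 * G (fst z) (snd z) + (k1\<^sup>2 * h (fst z) (fst z) + k2\<^sup>2 * h (snd z) (snd z)))"
      by (intro continuous_on_add continuous_on_mult continuous_on_const continuous_G_pair diag)
    then show ?thesis by (rule continuous_on_eq) (metis H prod.collapse)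
  qed
  \<comment> \<open>On this compact set of pairs away from \<open>(x1, x2)\<close> uniqueness of the
    minimum leaves a positive gap \<open>\<eta>\<close> above the minimal value.\<close>
  define S where "S = {z \<in> cball x1 \<delta> \<times> cball x2 \<delta>. \<delta> / 4 \<le> dist (fst z) x1 \<or> \<delta> / 4 \<le> dist (snd z) x2}"
  have SS: "S \<subseteq> cball x1 \<delta> \<times> cball x2 \<delta>" by (auto simp: S_def)
  have "closed {z :: (real^2) \<times> (real^2). \<delta> / 4 \<le> dist (fst z) x1 \<or> \<delta> / 4 \<le> dist (snd z) x2}"
    by (intro closed_Collect_disj closed_Collect_le continuous_intros)
  then have "compact ((cball x1 \<delta> \<times> cball x2 \<delta>) \<inter> {z. \<delta> / 4 \<le> dist (fst z) x1 \<or> \<delta> / 4 \<le> dist (snd z) x2})"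
    by (intro compact_Int_closed compact_Times compact_cball)
  also have "(cball x1 \<delta> \<times> cball x2 \<delta>) \<inter> {z. \<delta> / 4 \<le> dist (fst z) x1 \<or> \<delta> / 4 \<le> dist (snd z) x2} = S"
    by (auto simp: S_def)
  finally have S: "compact S" .
  obtain \<eta> where \<eta>: "\<eta> > 0" "\<And>z. z \<in> S \<Longrightarrow> H (x1, x2) + \<eta> \<le> H z"
  proof (cases "S = {}")
    case True
    then show ?thesis using that[of 1] by simp
  next
    case False
    obtain w where w: "w \<in> S" "\<And>z. z \<in> S \<Longrightarrow> H w \<le> H z"
      using continuous_attains_inf[OF S False continuous_on_subset[OF Hc SS]] by blast
    have "w \<noteq> (x1, x2)" using w(1) \<delta> by (auto simp: S_def)
    then have "H (x1, x2) < H w" using min w(1) SS unfolding unique_min_on_def H_def by blast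
    then show ?thesis using that[of "H w - H (x1, x2)"] w(2) by simp
  qed
  \<comment> \<open>The self-interactions produce errors \<open>2 * \<eta>' * k1^2\<close> and
    \<open>2 * \<eta>' * k2^2\<close>, the two mutual interactions
    \<open>4 * \<eta>' * k1 * k2\<close> together. The total is
    \<open>2 * \<eta>' * (k1 + k2)^2 = \<eta> / 2\<close>, less than the gap.\<close>
  define \<eta>' where "\<eta>' = \<eta> / (4 * (k1 + k2)\<^sup>2)"
  have \<eta>': "\<eta>' > 0" using \<eta>(1) k1 k2 by (simp add: \<eta>'_def)
  have unif: "\<exists>d>0. \<forall>a\<in>X. \<forall>b\<in>Y. \<forall>a'\<in>X. \<forall>b'\<in>Y. norm (a - a') < d \<longrightarrow> norm (b - b') < d \<longrightarrow> \<bar>F a b - F a' b'\<bar> < \<eta>'"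
    if "compact X" "compact Y" "continuous_on (X \<times> Y) (\<lambda>z. F (fst z) (snd z))"
    for X Y :: "(real^2) set" and F :: "real^2 \<Rightarrow> real^2 \<Rightarrow> real"
  proof -
    have "uniformly_continuous_on (X \<times> Y) (\<lambda>z. F (fst z) (snd z))"
      by (rule compact_uniformly_continuous[OF that(3) compact_Times[OF that(1,2)]])
    then obtain d where d: "d > 0" "\<And>z z'. z \<in> X \<times> Y \<Longrightarrow> z' \<in> X \<times> Y \<Longrightarrow> dist z' z < d \<Longrightarrow>
        dist (F (fst z') (snd z')) (F (fst z) (snd z)) < \<eta>'"
      unfolding uniformly_continuous_on_def using \<eta>' by blast
    have "\<bar>F a b - F a' b'\<bar> < \<eta>'"
      if "a \<in> X" "b \<in> Y" "a' \<in> X" "b' \<in> Y" "norm (a - a') < d / 2" "norm (b - b') < d / 2" for a b a' b'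
    proof -
      have "dist (a, b) (a', b') \<le> dist a a' + dist b b'"
        unfolding dist_Pair_Pair by (rule sqrt_sum_squares_le_sum) auto
      then have "dist (a, b) (a', b') < d" using that by (simp add: dist_norm)
      then show ?thesis using d(2)[of "(a', b')" "(a, b)"] that by (simp add: dist_real_def)
    qed
    then show ?thesis using d(1) by (intro exI[of _ "d / 2"]) simp
  qed
  have hc: "continuous_on (cball x \<delta> \<times> cball x \<delta>) (\<lambda>z. h (fst z) (snd z))" if "cball x \<delta> \<subseteq> D" for x
    using that by (intro continuous_on_subset[OF continuous_h]) auto
  obtain d1 where d1: "d1 > 0" "\<And>a b a' b'. a \<in> cball x1 \<delta> \<Longrightarrow> b \<in> cball x1 \<delta> \<Longrightarrow> a' \<in> cball x1 \<delta> \<Longrightarrow> b' \<in> cball x1 \<delta> \<Longrightarrow>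
      norm (a - a') < d1 \<Longrightarrow> norm (b - b') < d1 \<Longrightarrow> \<bar>h a b - h a' b'\<bar> < \<eta>'"
    using unif[OF compact_cball compact_cball hc[OF cb1]] by blast
  obtain d2 where d2: "d2 > 0" "\<And>a b a' b'. a \<in> cball x2 \<delta> \<Longrightarrow> b \<in> cball x2 \<delta> \<Longrightarrow> a' \<in> cball x2 \<delta> \<Longrightarrow> b' \<in> cball x2 \<delta> \<Longrightarrow>
      norm (a - a') < d2 \<Longrightarrow> norm (b - b') < d2 \<Longrightarrow> \<bar>h a b - h a' b'\<bar> < \<eta>'"
    using unif[OF compact_cball compact_cball hc[OF cb2]] by blast
  obtain d3 where d3: "d3 > 0" "\<And>a b a' b'. a \<in> cball x1 \<delta> \<Longrightarrow> b \<in> cball x2 \<delta> \<Longrightarrow> a' \<in> cball x1 \<delta> \<Longrightarrow> b' \<in> cball x2 \<delta> \<Longrightarrow>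
      norm (a - a') < d3 \<Longrightarrow> norm (b - b') < d3 \<Longrightarrow> \<bar>G a b - G a' b'\<bar> < \<eta>'"
    using unif[OF compact_cball compact_cball continuous_G_pair] by blast
  \<comment> \<open>The moduli \<open>d1\<close>, \<open>d2\<close>, \<open>d3\<close> make all
    kernel errors smaller than \<open>\<eta>'\<close>. The entry \<open>\<delta> / 4\<close> keeps
    the translated cores in the balls and gives
    \<open>\<delta> / 4 + \<delta> / 4 = \<delta> / 2\<close> at the end.\<close>
  define r where "r = Min {d1, d2, d3, \<delta> / 4}"
  have r: "r > 0" "r \<le> d1" "r \<le> d2" "r \<le> d3" "r \<le> \<delta> / 4" using d1 d2 d3 \<delta> by (simp_all add: r_def)
  show ?thesis
  proof (rule that[OF r(1,5)])
    fix l \<omega> A1 A2 \<mu>1 \<mu>2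
    assume c: "max_patches l \<omega> A1 A2 \<mu>1 \<mu>2"
      and s1: "\<And>x y. x \<in> A1 \<Longrightarrow> y \<in> A1 \<Longrightarrow> norm (x - y) < r"
      and s2: "\<And>x y. x \<in> A2 \<Longrightarrow> y \<in> A2 \<Longrightarrow> norm (x - y) < r"
    note cD = max_patchesD[OF c]
    have "A1 \<noteq> {}" using cD(8) k1 by auto
    then obtain X1 where X1: "X1 \<in> A1" by blast
    have "A2 \<noteq> {}" using cD(9) k2 by auto
    then obtain X2 where X2: "X2 \<in> A2" by blast
    have A1c: "x \<in> cball x1 \<delta>" if "x \<in> A1" for x using that cD(5) by auto
    have A2c: "x \<in> cball x2 \<delta>" if "x \<in> A2" for x using that cD(6) by auto
    have xc: "x1 \<in> cball x1 \<delta>" "x2 \<in> cball x2 \<delta>" using \<delta> by auto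
    have "(X1, X2) \<notin> S"
    proof
      assume XS: "(X1, X2) \<in> S"
      define c1 c2 where "c1 = x1 - X1" and "c2 = x2 - X2"
      define B1 B2 where "B1 = (+) c1 ` A1" and "B2 = (+) c2 ` A2"
      have near1: "norm (c1 + x - x1) < r" if "x \<in> A1" for x
        using s1[OF that X1] by (simp add: c1_def algebra_simps)
      have near2: "norm (c2 + x - x2) < r" if "x \<in> A2" for x
        using s2[OF that X2] by (simp add: c2_def algebra_simps)
      have B1b: "B1 \<subseteq> ball x1 \<delta>" and B2b: "B2 \<subseteq> ball x2 \<delta>"
        using near1 near2 r(5) \<delta> by (force simp: B1_def B2_def dist_norm norm_minus_commute)+
      have B1D: "B1 \<subseteq> D" and B2D: "B2 \<subseteq> D" using B1b B2b ball_subsets by blast+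
      have A1D: "A1 \<subseteq> D" and A2D: "A2 \<subseteq> D" using cD(5,6) ball_subsets by blast+
      have Bm: "B1 \<in> sets lebesgue" "B2 \<in> sets lebesgue"
        unfolding B1_def B2_def by (rule lebesgue_sets_translation[OF cD(3)], rule lebesgue_sets_translation[OF cD(4)])
      define f1 f2 where "f1 = (\<lambda>x. l * indicator A1 x :: real)" and "f2 = (\<lambda>x. l * indicator A2 x :: real)"
      define g1 g2 where "g1 = (\<lambda>x. l * indicator B1 x :: real)" and "g2 = (\<lambda>x. l * indicator B2 x :: real)"
      have fL: "f1 \<in> Linfty D" "f2 \<in> Linfty D" "g1 \<in> Linfty D" "g2 \<in> Linfty D"
        unfolding f1_def f2_def g1_def g2_def
        by (rule patch_Linfty[OF cD(3)], rule patch_Linfty[OF cD(4)], rule patch_Linfty[OF Bm(1)], rule patch_Linfty[OF Bm(2)])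
      have fi: "(LINT x|M. f1 x) = k1" "(LINT x|M. f2 x) = k2" unfolding f1_def f2_def by (rule cD(8), rule cD(9))
      have mB: "measure lebesgue B1 = measure lebesgue A1" "measure lebesgue B2 = measure lebesgue A2"
        unfolding B1_def B2_def by (rule measure_translation)+
      have gi: "(LINT x|M. g1 x) = k1" "(LINT x|M. g2 x) = k2"
        unfolding g1_def g2_def integral_patch[OF Bm(1) B1D] integral_patch[OF Bm(2) B2D] mB
        using cD(8,9) unfolding integral_patch[OF cD(3) A1D] integral_patch[OF cD(4) A2D] .
      have nn: "0 \<le> f1 x" "0 \<le> f2 x" "0 \<le> g1 x" "0 \<le> g2 x" for x
        using cD(1) by (auto simp: f1_def f2_def g1_def g2_def)
      have "(\<lambda>x. g1 x - g2 x) \<in> K l"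
      proof (rule admissibleI[OF fL(3) _ _ gi(1) fL(4) _ _ gi(2)])
        show "0 \<le> g1 x \<and> g1 x \<le> l" "0 \<le> g2 x \<and> g2 x \<le> l" for x
          using cD(1) by (auto simp: g1_def g2_def indicator_def)
        show "g1 x = 0" if "x \<notin> ball x1 \<delta>" for x using that B1b by (auto simp: g1_def indicator_def)
        show "g2 x = 0" if "x \<notin> ball x2 \<delta>" for x using that B2b by (auto simp: g2_def indicator_def)
      qed
      then have "2 * energy D G (\<lambda>x. g1 x - g2 x) \<le> 2 * energy D G (\<lambda>x. f1 x - f2 x)"
        using cD(14) unfolding cD(13) f1_def f2_def by simp
      then have E: "Q g1 g1 + Q g2 g2 - 2 * Q g1 g2 \<le> Q f1 f1 + Q f2 f2 - 2 * Q f1 f2"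
        by (simp add: energy_diff_eq fL)
      have q1: "Q f1 f1 + (h X1 X1 - h x1 x1 - 2 * \<eta>') * (LINT x|M. f1 x)\<^sup>2 \<le> Q g1 g1"
      proof (rule Q_translate_ge[OF cD(3) A1D B1D[unfolded B1_def] _ _ _ f1_def g1_def[unfolded B1_def]])
        fix x y assume xy: "x \<in> A1" "y \<in> A1"
        show "\<bar>h x y - h X1 X1\<bar> < \<eta>'"
          using s1[OF xy(1) X1] s1[OF xy(2) X1] r(2) by (intro d1(2) A1c xy X1) auto
        have "c1 + x \<in> B1" "c1 + y \<in> B1" using xy by (auto simp: B1_def)
        then have "c1 + x \<in> cball x1 \<delta>" "c1 + y \<in> cball x1 \<delta>" using B1b ball_subset_cball by blast+
        then show "\<bar>h (c1 + x) (c1 + y) - h x1 x1\<bar> < \<eta>'"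
          using near1[OF xy(1)] near1[OF xy(2)] r(2) by (intro d1(2) xc) auto
      qed (use cD(1) in simp)
      have q2: "Q f2 f2 + (h X2 X2 - h x2 x2 - 2 * \<eta>') * (LINT x|M. f2 x)\<^sup>2 \<le> Q g2 g2"
      proof (rule Q_translate_ge[OF cD(4) A2D B2D[unfolded B2_def] _ _ _ f2_def g2_def[unfolded B2_def]])
        fix x y assume xy: "x \<in> A2" "y \<in> A2"
        show "\<bar>h x y - h X2 X2\<bar> < \<eta>'"
          using s2[OF xy(1) X2] s2[OF xy(2) X2] r(3) by (intro d2(2) A2c xy X2) auto
        have "c2 + x \<in> B2" "c2 + y \<in> B2" using xy by (auto simp: B2_def)
        then have "c2 + x \<in> cball x2 \<delta>" "c2 + y \<in> cball x2 \<delta>" using B2b ball_subset_cball by blast+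
        then show "\<bar>h (c2 + x) (c2 + y) - h x2 x2\<bar> < \<eta>'"
          using near2[OF xy(1)] near2[OF xy(2)] r(3) by (intro d2(2) xc) auto
      qed (use cD(1) in simp)
      have q3: "Q g1 g2 \<le> (G x1 x2 + \<eta>') * (LINT x|M. g1 x) * (LINT x|M. g2 x)"
      proof (rule Q_le_const[OF fL(3) nn(3) fL(4) nn(4)])
        fix x y assume "g1 x \<noteq> 0" "g2 y \<noteq> 0"
        then have xy: "x \<in> B1" "y \<in> B2" by (auto simp: g1_def g2_def indicator_def split: if_splits)
        have "norm (x - x1) < d3" "norm (y - x2) < d3"
          using xy near1 near2 r(4) by (auto simp: B1_def B2_def intro: less_le_trans)
        moreover have "x \<in> cball x1 \<delta>" "y \<in> cball x2 \<delta>" using xy B1b B2b ball_subset_cball by blast+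
        ultimately have "\<bar>G x y - G x1 x2\<bar> < \<eta>'" by (intro d3(2) xc)
        then show "G x y \<le> G x1 x2 + \<eta>'" by linarith
      qed
      have q4: "(G X1 X2 - \<eta>') * (LINT x|M. f1 x) * (LINT x|M. f2 x) \<le> Q f1 f2"
      proof (rule Q_ge_const[OF fL(1) nn(1) fL(2) nn(2)])
        fix x y assume "f1 x \<noteq> 0" "f2 y \<noteq> 0"
        then have xy: "x \<in> A1" "y \<in> A2" by (auto simp: f1_def f2_def indicator_def split: if_splits)
        have "\<bar>G x y - G X1 X2\<bar> < \<eta>'"
          using s1[OF xy(1) X1] s2[OF xy(2) X2] r(4) by (intro d3(2) A1c A2c xy X1 X2) auto
        then show "G X1 X2 - \<eta>' \<le> G x y" by linarith
      qed
      have "(h X1 X1 - h x1 x1 - 2 * \<eta>') * k1\<^sup>2 + (h X2 X2 - h x2 x2 - 2 * \<eta>') * k2\<^sup>2 + 2 * (G X1 X2 - \<eta>') * k1 * k2 \<le> 2 * (G x1 x2 + \<eta>') * k1 * k2"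
        using q1 q2 q3 q4 E unfolding fi gi by linarith
      then have "H (X1, X2) - H (x1, x2) \<le> 2 * \<eta>' * (k1 + k2)\<^sup>2"
        unfolding H by (simp add: power2_eq_square algebra_simps)
      also have "\<dots> = \<eta> / 2" using k1 k2 by (simp add: \<eta>'_def)
      finally show False using \<eta>(2)[OF XS] \<eta>(1) by linarith
    qed
    then have X: "dist X1 x1 < \<delta> / 4" "dist X2 x2 < \<delta> / 4"
      using A1c[OF X1] A2c[OF X2] by (auto simp: S_def)
    show "A1 \<subseteq> ball x1 (\<delta> / 2) \<and> A2 \<subseteq> ball x2 (\<delta> / 2)"
    proof (intro conjI subsetI)
      fix x assume "x \<in> A1"
      then have "dist x X1 < \<delta> / 4" using s1[OF _ X1] r(5) by (force simp: dist_norm)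
      then show "x \<in> ball x1 (\<delta> / 2)" using X(1) dist_triangle[of x x1 X1] by (simp add: dist_commute)
    next
      fix x assume "x \<in> A2"
      then have "dist x X2 < \<delta> / 4" using s2[OF _ X2] r(5) by (force simp: dist_norm)
      then show "x \<in> ball x2 (\<delta> / 2)" using X(2) dist_triangle[of x x2 X2] by (simp add: dist_commute)
    qed
  qed
qed

lemma core_radius_tendsto: "k > 0 \<Longrightarrow> (core_radius k \<longlongrightarrow> 0) at_top"
proof -
  assume k: "k > 0"
  have "((\<lambda>l. k / pi / l) \<longlongrightarrow> 0) at_top"
    by (rule tendsto_divide_0[OF tendsto_const]) (rule filterlim_at_top_imp_at_infinity[OF filterlim_ident])
  then have "((\<lambda>l. sqrt (k / pi / l)) \<longlongrightarrow> sqrt 0) at_top" by (rule tendsto_real_sqrt)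
  then show ?thesis by (simp add: core_radius_def[abs_def])
qed

text \<open>The term \<open>k / (2 * pi) * ln (2 * R / \<delta>)\<close> is the largest value that a
  core inside the half-size ball can produce outside its ball; the summand 1 is the margin used when
  mass is moved into the core.\<close>

lemma localization:
  "\<forall>\<^sub>F l in at_top. \<forall>\<omega> A1 A2 \<mu>1 \<mu>2. max_patches l \<omega> A1 A2 \<mu>1 \<mu>2 \<longrightarrow>
     A1 \<subseteq> ball x1 (\<delta> / 2) \<and> A2 \<subseteq> ball x2 (\<delta> / 2) \<and>
     k1 / (2 * pi) * ln (2 * R / \<delta>) + 1 \<le> \<mu>1 \<and> k2 / (2 * pi) * ln (2 * R / \<delta>) + 1 \<le> \<mu>2"
proof -
  obtain C where C: "C > 0" "\<And>l \<omega> A1 A2 \<mu>1 \<mu>2. max_patches l \<omega> A1 A2 \<mu>1 \<mu>2 \<Longrightarrow> core_radius k1 l \<le> R \<Longrightarrow> core_radius k2 l \<le> R \<Longrightarrow>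
      2 * core_radius k1 l \<le> \<delta> \<Longrightarrow> 2 * core_radius k2 l \<le> \<delta> \<Longrightarrow>
      core_bound C k1 l A1 \<mu>1 \<and> core_bound C k2 l A2 \<mu>2"
    using core_estimates by blast
  obtain r where r: "r > 0" "r \<le> \<delta> / 4" "\<And>l \<omega> A1 A2 \<mu>1 \<mu>2. max_patches l \<omega> A1 A2 \<mu>1 \<mu>2 \<Longrightarrow>
      (\<And>x y. x \<in> A1 \<Longrightarrow> y \<in> A1 \<Longrightarrow> norm (x - y) < r) \<Longrightarrow>
      (\<And>x y. x \<in> A2 \<Longrightarrow> y \<in> A2 \<Longrightarrow> norm (x - y) < r) \<Longrightarrow>
      A1 \<subseteq> ball x1 (\<delta> / 2) \<and> A2 \<subseteq> ball x2 (\<delta> / 2)"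
    using core_location by blast
  have small: "\<forall>\<^sub>F l in at_top. core_radius k l < e" if "k > 0" "e > 0" for k e
    using core_radius_tendsto[OF that(1)] that(2) by (rule order_tendstoD)
  \<comment> \<open>The entries provide, in this order, the kernel bounds at scale
    \<open>eps\<close>, room for a disc of twice the core radius, core diameters below
    \<open>r\<close>, and levels above the threshold. The last one solves
    \<open>k / (2 * pi) * ln (R / eps) = N\<close>, where \<open>N\<close> is the threshold plus
    \<open>C\<close>.\<close>
  define e where "e k = Min {R, \<delta> / 2, r / C, R / exp (2 * pi / k * (k / (2 * pi) * ln (2 * R / \<delta>) + 1 + C))}" for k
  have e0: "e k > 0" for k
    using R_ge1 \<delta> r(1) C(1) by (simp add: e_def)
  have e: "e k \<le> R" "e k \<le> \<delta> / 2" "e k \<le> r / C"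
    "e k \<le> R / exp (2 * pi / k * (k / (2 * pi) * ln (2 * R / \<delta>) + 1 + C))" for k
    unfolding e_def by (rule Min_le; simp)+
  have big: "k / (2 * pi) * ln (2 * R / \<delta>) + 1 \<le> k / (2 * pi) * (ln (R / eps) + 2) - C"
    if "k > 0" "0 < eps" "eps < e k" for k eps
  proof -
    define N where "N = k / (2 * pi) * ln (2 * R / \<delta>) + 1 + C"
    have "eps \<le> R / exp (2 * pi / k * N)" using e(4)[of k] that(3) by (simp add: N_def)
    then have "eps * exp (2 * pi / k * N) \<le> R" by (simp add: pos_le_divide_eq)
    then have "exp (2 * pi / k * N) \<le> R / eps" using that(2) by (simp add: pos_le_divide_eq mult.commute)
    then have "2 * pi / k * N \<le> ln (R / eps)"
      using that(2) R_ge1 by (subst ln_ge_iff) auto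
    then have "2 * pi / k * N \<le> ln (R / eps) + 2" by simp
    then have "k / (2 * pi) * (2 * pi / k * N) \<le> k / (2 * pi) * (ln (R / eps) + 2)"
      using that(1) by (intro mult_left_mono) auto
    moreover have "k / (2 * pi) * (2 * pi / k * N) = N" using that(1) by simp
    ultimately show ?thesis unfolding N_def by linarith
  qed
  have "\<forall>\<^sub>F l in at_top. core_radius k1 l < e k1" "\<forall>\<^sub>F l in at_top. core_radius k2 l < e k2"
    by (intro small k1 k2 e0)+
  then show ?thesis
  proof eventually_elim
    case (elim l)
    show ?case
    proof (intro allI impI)
      fix \<omega> A1 A2 \<mu>1 \<mu>2 assume c: "max_patches l \<omega> A1 A2 \<mu>1 \<mu>2"
      have l: "l > 0" by (rule max_patchesD(1)[OF c])
      have c1: "core_radius k1 l \<le> R" "2 * core_radius k1 l \<le> \<delta>" "C * core_radius k1 l \<le> r"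
      proof -
        have le: "core_radius k1 l \<le> e k1" using elim(1) by simp
        then show "core_radius k1 l \<le> R" "2 * core_radius k1 l \<le> \<delta>" using e(1,2)[of k1] by linarith+
        have "core_radius k1 l \<le> r / C" using le e(3)[of k1] by linarith
        then show "C * core_radius k1 l \<le> r" using C(1) by (simp add: pos_le_divide_eq mult.commute)
      qed
      have c2: "core_radius k2 l \<le> R" "2 * core_radius k2 l \<le> \<delta>" "C * core_radius k2 l \<le> r"
      proof -
        have le: "core_radius k2 l \<le> e k2" using elim(2) by simp
        then show "core_radius k2 l \<le> R" "2 * core_radius k2 l \<le> \<delta>" using e(1,2)[of k2] by linarith+
        have "core_radius k2 l \<le> r / C" using le e(3)[of k2] by linarith
        then show "C * core_radius k2 l \<le> r" using C(1) by (simp add: pos_le_divide_eq mult.commute)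
      qed
      note est = C(2)[OF c c1(1) c2(1) c1(2) c2(2), unfolded core_bound_def]
      have "A1 \<subseteq> ball x1 (\<delta> / 2) \<and> A2 \<subseteq> ball x2 (\<delta> / 2)"
      proof (rule r(3)[OF c])
        show "norm (x - y) < r" if "x \<in> A1" "y \<in> A1" for x y
          using est that c1(3) by (blast intro: less_le_trans)
        show "norm (x - y) < r" if "x \<in> A2" "y \<in> A2" for x y
          using est that c2(3) by (blast intro: less_le_trans)
      qed
      moreover note big[OF k1 core_radius_pos[OF k1 l] elim(1)] big[OF k2 core_radius_pos[OF k2 l] elim(2)]
      ultimately show "A1 \<subseteq> ball x1 (\<delta> / 2) \<and> A2 \<subseteq> ball x2 (\<delta> / 2) \<and>
          k1 / (2 * pi) * ln (2 * R / \<delta>) + 1 \<le> \<mu>1 \<and> k2 / (2 * pi) * ln (2 * R / \<delta>) + 1 \<le> \<mu>2"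
        using est by linarith
    qed
  qed
qed

end

section \<open>Rearrangements of vortex patches\<close>

text \<open>The part \<open>W = V - B\<close> of \<open>V\<close> outside \<open>B\<close> is replaced by the constant fraction
  \<open>|W| / |A - V|\<close> of \<open>A - V\<close>; such fractional values are admissible, which avoids choosing a subset
  of \<open>A - V\<close> of prescribed measure.\<close>

locale mass_transfer = green_domain +
  fixes A V B :: "(real^2) set" and l :: real and g e :: "real^2 \<Rightarrow> real"
  assumes g_Linfty: "g \<in> Linfty D" and e_Linfty: "e \<in> Linfty D"
    and g_eq: "g x = l * indicator V x + e x" and g_range: "0 \<le> g x \<and> g x \<le> l"
    and g_supp: "x \<notin> B \<Longrightarrow> g x = 0" and g_integral: "(LINT x|lebesgue_on D. g x) = l * measure lebesgue A"
    and e_bound: "\<bar>e x\<bar> \<le> l"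
    and e_L1: "(LINT x|lebesgue_on D. \<bar>e x\<bar>) \<le> 2 * (l * measure lebesgue (V - B))"
    and e_gain: "\<psi> \<in> Linfty D \<Longrightarrow> (\<And>x. x \<in> A \<Longrightarrow> m \<le> \<psi> x) \<Longrightarrow>
      (\<And>x. x \<in> V - B \<Longrightarrow> \<psi> x \<le> m - 1) \<Longrightarrow>
      l * measure lebesgue (V - B) \<le> (LINT x|lebesgue_on D. e x * \<psi> x)"

context green_domain
begin

lemma sets_lmeasurable: "A \<in> sets lebesgue \<Longrightarrow> A \<subseteq> D \<Longrightarrow> A \<in> lmeasurable"
  using bounded_D bounded_subset bounded_set_imp_lmeasurable by blast

text \<open>Since \<open>A \<subseteq> B\<close>, the set \<open>W\<close> lies in
  \<open>V - A\<close>, which has the same measure as \<open>A - V\<close>. Hence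
  \<open>|W| \<le> |A - V|\<close>, and the fraction keeps \<open>g\<close> between 0 and
  \<open>l\<close>.\<close>

lemma mass_transfer_exists:
  assumes A: "A \<in> sets lebesgue" "A \<subseteq> D" and V: "V \<in> sets lebesgue" "V \<subseteq> D"
    and B: "B \<in> sets lebesgue" "A \<subseteq> B" and AV: "measure lebesgue V = measure lebesgue A" and l: "l > 0"
  shows "\<exists>g e. mass_transfer D G h A V B l g e"
proof -
  define W P where "W = V - B" and "P = A - V"
  have WP: "W \<in> sets lebesgue" "P \<in> sets lebesgue" "W \<subseteq> D" "P \<subseteq> D"
    using sets.Diff[OF V(1) B(1)] sets.Diff[OF A(1) V(1)] A(2) V(2) by (simp_all add: W_def P_def Diff_subset subset_trans[OF Diff_subset])
  have lm: "A \<in> lmeasurable" "V \<in> lmeasurable" "W \<in> lmeasurable" "P \<in> lmeasurable" "V \<inter> A \<in> lmeasurable" "V - A \<in> lmeasurable"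
  proof -
    have "V \<inter> A \<in> sets lebesgue" "V - A \<in> sets lebesgue"
      by (rule sets.Int[OF V(1) A(1)], rule sets.Diff[OF V(1) A(1)])
    moreover have "V \<inter> A \<subseteq> D" "V - A \<subseteq> D" using V(2) by auto
    ultimately show "A \<in> lmeasurable" "V \<in> lmeasurable" "W \<in> lmeasurable" "P \<in> lmeasurable"
      "V \<inter> A \<in> lmeasurable" "V - A \<in> lmeasurable"
      using A V WP by (simp_all add: sets_lmeasurable)
  qed
  define p w where "p = measure lebesgue P" and "w = measure lebesgue W"
  have "V \<inter> A \<union> P = A" "P - V \<inter> A = P" by (auto simp: P_def)
  then have "measure lebesgue A = measure lebesgue (V \<inter> A) + p"
    using measure_Un2[OF lm(5,4)] by (simp add: p_def)
  moreover have "V \<inter> A \<union> (V - A) = V" "(V - A) - V \<inter> A = V - A" by auto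
  then have "measure lebesgue V = measure lebesgue (V \<inter> A) + measure lebesgue (V - A)"
    using measure_Un2[OF lm(5,6)] by simp
  moreover have "w \<le> measure lebesgue (V - A)" unfolding w_def
    using lm B(2) by (intro measure_mono_fmeasurable) (auto simp: W_def)
  ultimately have wp: "w \<le> p" using AV by linarith
  have w0: "w \<ge> 0" by (simp add: w_def)
  \<comment> \<open>If \<open>p = 0\<close> then \<open>w = 0\<close> as well, because
    \<open>w \<le> p\<close>, and division by zero gives \<open>\<theta> = 0\<close>; so
    \<open>\<theta> * p = w\<close> holds in every case.\<close>
  define \<theta> where "\<theta> = w / p"
  have \<theta>: "0 \<le> \<theta>" "\<theta> \<le> 1" "\<theta> * p = w"
    using wp w0 by (auto simp: \<theta>_def divide_le_eq_1)
  define e where "e x = l * \<theta> * indicator P x - l * indicator W x" for x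
  define g where "g x = l * indicator V x + e x" for x
  have eL: "e \<in> Linfty D" unfolding e_def
    by (rule Linfty_diff[OF patch_Linfty[OF WP(2)] patch_Linfty[OF WP(1)]])
  have gL: "g \<in> Linfty D" unfolding g_def by (rule Linfty_add[OF patch_Linfty[OF V(1)] eL])
  have iP: "(LINT x|M. l * \<theta> * indicator P x) = l * w"
    unfolding integral_patch[OF WP(2,4)] using \<theta>(3) by (simp add: p_def)
  have iW: "(LINT x|M. l * indicator W x) = l * w"
    unfolding integral_patch[OF WP(1,3)] by (simp add: w_def)
  have intP: "integrable M (\<lambda>x. c * indicator P x)" for c :: real by (rule Linfty_integrable[OF patch_Linfty[OF WP(2)]])
  have intW: "integrable M (\<lambda>x. c * indicator W x)" for c :: real by (rule Linfty_integrable[OF patch_Linfty[OF WP(1)]])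
  have ie: "(LINT x|M. e x) = 0" unfolding e_def
    using Bochner_Integration.integral_diff[OF intP intW, of "l * \<theta>" l] iP iW by linarith
  have gi: "(LINT x|M. g x) = l * measure lebesgue A" unfolding g_def
    unfolding Bochner_Integration.integral_add[OF Linfty_integrable[OF patch_Linfty[OF V(1)]] Linfty_integrable[OF eL]]
      ie integral_patch[OF V] AV by simp
  have lt: "0 \<le> l * \<theta>" "l * \<theta> \<le> l" using l \<theta> by (simp_all add: mult_left_le)
  have eb: "\<bar>e x\<bar> \<le> l" for x
    using lt l by (auto simp: e_def indicator_def W_def P_def)
  have gb: "0 \<le> g x \<and> g x \<le> l" for x
    using lt l by (auto simp: g_def e_def indicator_def W_def P_def)
  have gB: "g x = 0" if "x \<notin> B" for x
    using that B(2) by (auto simp: g_def e_def indicator_def W_def P_def)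
  have "(LINT x|M. \<bar>e x\<bar>) \<le> (LINT x|M. l * \<theta> * indicator P x + l * indicator W x)"
  proof (rule integral_mono)
    show "integrable M (\<lambda>x. \<bar>e x\<bar>)" by (rule integrable_abs[OF Linfty_integrable[OF eL]])
    show "integrable M (\<lambda>x. l * \<theta> * indicator P x + l * indicator W x)"
      by (rule Bochner_Integration.integrable_add[OF intP intW])
    show "\<bar>e x\<bar> \<le> l * \<theta> * indicator P x + l * indicator W x" for x
      using lt l by (simp add: e_def indicator_def)
  qed
  also have "\<dots> = 2 * (l * w)"
    using Bochner_Integration.integral_add[OF intP intW, of "l * \<theta>" l] iP iW by linarith
  finally have eabs: "(LINT x|M. \<bar>e x\<bar>) \<le> 2 * (l * measure lebesgue (V - B))" by (simp add: w_def W_def)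
  have gain: "l * measure lebesgue (V - B) \<le> (LINT x|M. e x * \<psi> x)"
    if \<psi>: "\<psi> \<in> Linfty D" "\<And>x. x \<in> A \<Longrightarrow> m \<le> \<psi> x" "\<And>x. x \<in> V - B \<Longrightarrow> \<psi> x \<le> m - 1" for \<psi> m
  proof -
    \<comment> \<open>The mass \<open>l * w\<close> arrives where \<open>\<psi>\<close> is at least
      \<open>m\<close> and leaves from where it is at most \<open>m - 1\<close>.\<close>
    have "l * measure lebesgue (V - B) = m * (l * w) - (m - 1) * (l * w)" by (simp add: w_def W_def algebra_simps)
    also have "\<dots> = (LINT x|M. m * (l * \<theta> * indicator P x) - (m - 1) * (l * indicator W x))"
    proof -
      have "(LINT x|M. m * (l * \<theta> * indicator P x) - (m - 1) * (l * indicator W x)) =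
        (LINT x|M. m * (l * \<theta> * indicator P x)) - (LINT x|M. (m - 1) * (l * indicator W x))"
        by (intro Bochner_Integration.integral_diff integrable_mult_right intP intW)
      also have "\<dots> = m * (LINT x|M. l * \<theta> * indicator P x) - (m - 1) * (LINT x|M. l * indicator W x)"
        by (simp only: integral_mult_right_zero)
      finally show ?thesis unfolding iP iW by simp
    qed
    also have "\<dots> \<le> (LINT x|M. e x * \<psi> x)"
    proof (rule integral_mono)
      show "integrable M (\<lambda>x. m * (l * \<theta> * indicator P x) - (m - 1) * (l * indicator W x))"
        by (intro Bochner_Integration.integrable_diff integrable_mult_right intP intW)
      show "integrable M (\<lambda>x. e x * \<psi> x)" by (rule Linfty_integrable[OF Linfty_mult[OF eL \<psi>(1)]])
      fix x
      consider "x \<in> P" "x \<notin> W" | "x \<in> W" "x \<notin> P" | "x \<notin> P" "x \<notin> W" by (auto simp: W_def P_def)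
      then show "m * (l * \<theta> * indicator P x) - (m - 1) * (l * indicator W x) \<le> e x * \<psi> x"
      proof cases
        case 1
        then have "m \<le> \<psi> x" by (intro \<psi>(2)) (simp add: P_def)
        then have "l * \<theta> * m \<le> l * \<theta> * \<psi> x" using lt by (intro mult_left_mono)
        then show ?thesis using 1 by (simp add: e_def mult_ac)
      next
        case 2
        then have "\<psi> x \<le> m - 1" by (intro \<psi>(3)) (simp add: W_def)
        then have "l * \<psi> x \<le> l * (m - 1)" using l by (intro mult_left_mono) auto
        then show ?thesis using 2 by (simp add: e_def mult_ac)
      next
        case 3
        then show ?thesis by (simp add: e_def)
      qed
    qed
    finally show ?thesis .
  qed
  have "mass_transfer D G h A V B l g e"
    by (intro mass_transfer.intro mass_transfer_axioms.intro green_domain_axioms gL eL g_def gb gB gi eb eabs gain)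
  then show ?thesis by blast
qed

section \<open>Functions equimeasurable with a difference of two patches\<close>

lemma AE_nested:
  assumes "S \<in> sets lebesgue" "T \<in> sets lebesgue" "S \<subseteq> T" "T \<subseteq> D" "emeasure lebesgue S = emeasure lebesgue T"
  shows "AE x in M. x \<in> T \<longrightarrow> x \<in> S"
proof -
  have "emeasure lebesgue S \<noteq> \<infinity>"
    using fmeasurableD2[OF sets_lmeasurable[OF assms(1)]] assms(3,4) by simp
  then have "emeasure lebesgue (T - S) = 0"
    using emeasure_Diff[OF _ assms(2,1,3)] assms(5) by (simp add: diff_eq_0_ennreal less_top)
  then have "T - S \<in> null_sets lebesgue" using assms(1,2) by (auto simp: null_sets_def)
  then have "AE x in lebesgue. x \<notin> T - S" by (rule AE_not_in)
  then have "AE x in lebesgue. x \<in> D \<longrightarrow> x \<in> T \<longrightarrow> x \<in> S" by eventually_elim blast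
  then show ?thesis by (simp add: AE_restrict_space_iff)
qed

text \<open>The measure of the superlevel sets of \<open>w\<close> can jump only at
  \<open>- l\<close>, 0 and \<open>l\<close>. Superlevel sets of \<open>v\<close> for two levels
  between consecutive jumps are nested with equal finite measure, so \<open>v\<close> takes no value
  in between up to a null set.\<close>

lemma rearrangement_patch:
  assumes A: "A1 \<in> sets lebesgue" "A2 \<in> sets lebesgue" "A1 \<subseteq> D" "A2 \<subseteq> D" "A1 \<inter> A2 = {}" and l: "l > 0"
    and \<omega>m: "\<omega> \<in> borel_measurable M" and \<omega>: "AE x in M. \<omega> x = l * indicator A1 x - l * indicator A2 x"
    and v: "v \<in> rearrangement_class D \<omega>"
  obtains V1 V2 where "V1 \<in> sets lebesgue" "V2 \<in> sets lebesgue" "V1 \<subseteq> D" "V2 \<subseteq> D" "V1 \<inter> V2 = {}"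
    "measure lebesgue V1 = measure lebesgue A1" "measure lebesgue V2 = measure lebesgue A2"
    "AE x in M. v x = l * indicator V1 x - l * indicator V2 x" "v \<in> borel_measurable M"
proof -
  define w where "w x = l * indicator A1 x - l * indicator A2 x" for x :: "real^2"
  have vm: "v \<in> borel_measurable M"
    and vw: "\<And>a. emeasure lebesgue {x\<in>D. v x > a} = emeasure lebesgue {x\<in>D. \<omega> x > a}"
    using v unfolding rearrangement_class_def by blast+
  have wL: "w \<in> Linfty D" unfolding w_def by (rule Linfty_diff[OF patch_Linfty[OF A(1)] patch_Linfty[OF A(2)]])
  note lev = superlevel_lebesgue
  have eq: "emeasure lebesgue {x\<in>D. v x > a} = emeasure lebesgue {x\<in>D. w x > a}" for a
  proof -
    have "AE x in lebesgue. x \<in> D \<longrightarrow> \<omega> x = w x"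
      using \<omega> by (simp add: AE_restrict_space_iff w_def)
    then have "emeasure lebesgue {x\<in>D. \<omega> x > a} = emeasure lebesgue {x\<in>D. w x > a}"
      by (intro emeasure_eq_AE lev \<omega>m Linfty_measurable[OF wL]) (elim eventually_mono, auto)
    then show ?thesis using vw by simp
  qed
  have nest: "AE x in M. v x > a \<longrightarrow> v x > b" if "a \<le> b" "{x\<in>D. w x > a} = {x\<in>D. w x > b}" for a b
  proof -
    have "emeasure lebesgue {x\<in>D. v x > b} = emeasure lebesgue {x\<in>D. v x > a}" using eq[of a] eq[of b] that(2) by simp
    then have "AE x in M. x \<in> {x\<in>D. v x > a} \<longrightarrow> x \<in> {x\<in>D. v x > b}"
      using that(1) by (intro AE_nested lev vm) auto
    then show ?thesis using AE_space by eventually_elim simp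
  qed
  have wA: "w x = l" if "x \<in> A1" for x
  proof -
    have "x \<notin> A2" using that A(5) by blast
    then show ?thesis using that by (simp add: w_def)
  qed
  have wB: "w x = - l" if "x \<in> A2" for x
  proof -
    have "x \<notin> A1" using that A(5) by blast
    then show ?thesis using that by (simp add: w_def)
  qed
  have w0: "w x = 0" if "x \<notin> A1" "x \<notin> A2" for x using that by (simp add: w_def)
  have upper: "AE x in M. \<not> v x > l"
  proof -
    have "{x\<in>D. w x > l} = {}" using l by (auto simp: w_def indicator_def)
    then have e: "emeasure lebesgue ({} :: (real^2) set) = emeasure lebesgue {x\<in>D. v x > l}"
      unfolding eq by (simp only:)
    have "AE x in M. x \<in> {x\<in>D. v x > l} \<longrightarrow> x \<in> {}"
      by (rule AE_nested[OF sets.empty_sets lev[OF vm] _ _ e]) auto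
    then show ?thesis using AE_space by eventually_elim simp
  qed
  \<comment> \<open>A sequence decreasing to 0 reaches the jump levels through countably many null
    sets. The summand 2 gives \<open>q n < l\<close> already for \<open>n = 0\<close>.\<close>
  define q where "q n = l / (real n + 2)" for n :: nat
  have q: "0 < q n" "q n < l" for n
  proof -
    show "0 < q n" using l by (simp add: q_def)
    have "l * 1 < l * (real n + 2)" using l by (intro mult_strict_left_mono) auto
    then show "q n < l" by (simp add: q_def pos_divide_less_eq)
  qed
  have q0: "q \<longlonglongrightarrow> 0"
  proof -
    have "q = (\<lambda>n. l / real (n + 2))" by (rule ext) (simp add: q_def)
    then show ?thesis by (simp only: LIMSEQ_ignore_initial_segment[OF lim_const_over_n])
  qed
  have dis: "x \<notin> A1" if "x \<in> A2" for x using that A(5) by blast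
  have w_gt: "a < w x \<longleftrightarrow> (if x \<in> A1 then a < l else if x \<in> A2 then a < - l else a < 0)" for x a
    using wA[of x] wB[of x] w0[of x] by simp
  have W_pos: "{x\<in>D. w x > a} = A1" if "0 \<le> a" "a < l" for a
  proof (rule set_eqI)
    fix x show "x \<in> {x\<in>D. w x > a} \<longleftrightarrow> x \<in> A1"
      using that l A(3) w_gt[of a x] by (cases "x \<in> A1"; cases "x \<in> A2") auto
  qed
  have W_neg: "{x\<in>D. w x > a} = D - A2" if "- l \<le> a" "a < 0" for a
  proof (rule set_eqI)
    fix x show "x \<in> {x\<in>D. w x > a} \<longleftrightarrow> x \<in> D - A2"
      using that l dis[of x] w_gt[of a x] by (cases "x \<in> A1"; cases "x \<in> A2") auto
  qed
  have W_all: "{x\<in>D. w x > a} = D" if "a < - l" for a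
  proof (rule set_eqI)
    fix x show "x \<in> {x\<in>D. w x > a} \<longleftrightarrow> x \<in> D"
      using that l w_gt[of a x] by (cases "x \<in> A1"; cases "x \<in> A2") auto
  qed
  have pos: "AE x in M. \<forall>n. v x > 0 \<longrightarrow> v x > l - q n"
    unfolding AE_all_countable
  proof (intro allI nest)
    fix n
    show "0 \<le> l - q n" using q[of n] by simp
    show "{x\<in>D. w x > 0} = {x\<in>D. w x > l - q n}" using W_pos[of 0] W_pos[of "l - q n"] q[of n] l by simp
  qed
  have neg: "AE x in M. \<forall>n. v x > - l \<longrightarrow> v x > - q n"
    unfolding AE_all_countable
  proof (intro allI nest)
    fix n
    show "- l \<le> - q n" using q(2)[of n] by simp
    show "{x\<in>D. w x > - l} = {x\<in>D. w x > - q n}" using W_neg[of "- l"] W_neg[of "- q n"] q[of n] l by simp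
  qed
  have lower: "AE x in M. \<forall>n. v x > - l - q n"
    unfolding AE_all_countable
  proof
    fix n
    have "emeasure lebesgue {x\<in>D. v x > - l - q n} = emeasure lebesgue D"
      using eq[of "- l - q n"] W_all[of "- l - q n"] q[of n] by simp
    then have "AE x in M. x \<in> D \<longrightarrow> x \<in> {x\<in>D. v x > - l - q n}"
      using D_lebesgue by (intro AE_nested lev vm) auto
    then show "AE x in M. v x > - l - q n" using AE_space by eventually_elim simp
  qed
  define V1 where "V1 = {x\<in>D. v x > 0}"
  \<comment> \<open>The rearrangement class only speaks of strict superlevel sets, so the negative
    patch is obtained as a complement in \<open>D\<close>.\<close>
  define V2 where "V2 = D - {x\<in>D. v x > - l}"
  have Vm: "V1 \<in> sets lebesgue" "V2 \<in> sets lebesgue"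
    unfolding V1_def V2_def by (intro lev vm, intro sets.Diff D_lebesgue lev vm)
  have "emeasure lebesgue V1 = emeasure lebesgue A1" unfolding V1_def eq using W_pos[of 0] l by simp
  then have m1: "measure lebesgue V1 = measure lebesgue A1" by (simp add: measure_def)
  have m2: "measure lebesgue V2 = measure lebesgue A2"
  proof -
    have "emeasure lebesgue {x\<in>D. v x > - l} = emeasure lebesgue (D - A2)" unfolding eq using W_neg[of "- l"] l by simp
    then have e: "measure lebesgue {x\<in>D. v x > - l} = measure lebesgue (D - A2)" by (simp add: measure_def)
    have "measure lebesgue V2 = measure lebesgue D - measure lebesgue {x\<in>D. v x > - l}" unfolding V2_def
      by (rule measurable_measure_Diff[OF D_lmeasurable lev[OF vm]]) blast
    moreover have "measure lebesgue (D - A2) = measure lebesgue D - measure lebesgue A2"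
      by (rule measurable_measure_Diff[OF D_lmeasurable A(2,4)])
    ultimately show ?thesis using e by simp
  qed
  have AE_v: "AE x in M. v x = l * indicator V1 x - l * indicator V2 x"
    using upper pos neg lower AE_space
  proof eventually_elim
    case (elim x)
    have xD: "x \<in> D" using elim by simp
    have lim: "(\<lambda>n. c - q n) \<longlonglongrightarrow> c" for c using tendsto_diff[OF tendsto_const q0, of c] by simp
    consider "v x > 0" | "v x \<le> 0" "v x > - l" | "v x \<le> - l" by linarith
    then show ?case
    proof cases
      case 1
      have "l - q n \<le> v x" for n using spec[OF elim(2), of n] 1 by linarith
      then have "l \<le> v x" by (intro LIMSEQ_le_const2[OF lim]) auto
      then have "v x = l" using elim(1) by simp
      then show ?thesis using 1 xD l by (simp add: V1_def V2_def)
    next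
      case 2
      have "0 - q n \<le> v x" for n using spec[OF elim(3), of n] 2 by linarith
      then have "0 \<le> v x" by (intro LIMSEQ_le_const2[OF lim]) auto
      then show ?thesis using 2 xD by (simp add: V1_def V2_def)
    next
      case 3
      have "- l - q n \<le> v x" for n using spec[OF elim(4), of n] by linarith
      then have "- l \<le> v x" by (intro LIMSEQ_le_const2[OF lim]) auto
      then have "v x = - l" using 3 by simp
      then show ?thesis using 3 xD l by (simp add: V1_def V2_def)
    qed
  qed
  have "V1 \<subseteq> D" "V2 \<subseteq> D" by (auto simp: V1_def V2_def)
  moreover have "V1 \<inter> V2 = {}" using l by (auto simp: V1_def V2_def)
  ultimately show ?thesis using m1 m2 AE_v vm by (rule that[OF Vm])
qed

end

context vortex_pair
begin

text \<open>A point outside the ball has distance at least \<open>\<delta> / 2\<close> from a core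
  in the half-size ball, so the logarithmic bound for \<open>G\<close> becomes a constant.\<close>

lemma SF_outside_le:
  assumes A: "A \<in> sets lebesgue" "A \<subseteq> ball z (\<delta> / 2)" "A \<subseteq> D" and l: "l > 0"
    and x: "x \<in> D" "x \<notin> ball z \<delta>"
  shows "SF (\<lambda>x. l * indicator A x) x \<le> (LINT x|M. l * indicator A x) / (2 * pi) * ln (2 * R / \<delta>)"
proof -
  have "SF (\<lambda>x. l * indicator A x) x \<le> ln (2 * R / \<delta>) / (2 * pi) * (LINT x|M. l * indicator A x)"
  proof (rule SF_le_const[OF patch_Linfty[OF A(1)] x(1)])
    show "0 \<le> l * indicator A y" for y :: "real^2" using l by simp
    fix y assume y: "y \<in> D" "l * indicator A y \<noteq> 0" "y \<noteq> x"
    then have "y \<in> A" by (auto simp: indicator_def split: if_splits)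
    then have "dist z y < \<delta> / 2" using A(2) by auto
    then have far: "\<delta> / 2 \<le> norm (x - y)"
      using x(2) dist_triangle[of z x y] by (simp add: dist_norm norm_minus_commute)
    have "R / norm (x - y) \<le> R / (\<delta> / 2)" using far \<delta> R_ge1 y(3) by (intro divide_left_mono mult_pos_pos) auto
    then have "ln (R / norm (x - y)) \<le> ln (2 * R / \<delta>)"
      using y(3) R_ge1 by (intro ln_mono) (auto simp: mult.commute)
    then have "ln (R / norm (x - y)) / (2 * pi) \<le> ln (2 * R / \<delta>) / (2 * pi)" by (intro divide_right_mono) auto
    then show "G x y \<le> ln (2 * R / \<delta>) / (2 * pi)" using G_le_ln[OF x(1) y(1)] y(3) by force
  qed
  also have "\<dots> = (LINT x|M. l * indicator A x) / (2 * pi) * ln (2 * R / \<delta>)" by (simp del: integral_mult_right_zero)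
  finally show ?thesis .
qed

text \<open>Moving the mass of \<open>v\<close> outside the balls into the cores gains at least \<open>S\<close>, the amount of mass
  moved, because \<open>sgn \<psi>\<close> exceeds \<open>\<mu>\<close> on the core and is at most \<open>\<mu> - 1\<close> outside the ball; the
  second-order error is controlled by \<open>S\<close> times the sup norm of the stream function of an
  \<open>L\<^sup>1\<close>-small perturbation.\<close>

lemma local_maximizer:
  assumes c: "max_patches l \<omega> A1 A2 \<mu>1 \<mu>2"
    and loc: "A1 \<subseteq> ball x1 (\<delta> / 2)" "A2 \<subseteq> ball x2 (\<delta> / 2)"
    and \<mu>: "k1 / (2 * pi) * ln (2 * R / \<delta>) + 1 \<le> \<mu>1" "k2 / (2 * pi) * ln (2 * R / \<delta>) + 1 \<le> \<mu>2"
  shows "\<exists>\<delta>0>0. \<forall>v\<in>rearrangement_class D \<omega>. L1_dist D v \<omega> < \<delta>0 \<longrightarrow> energy D G v \<le> energy D G \<omega>"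
proof -
  note cD = max_patchesD[OF c]
  note l = cD(1)
  define f1 f2 where "f1 = (\<lambda>x. l * indicator A1 x :: real)" and "f2 = (\<lambda>x. l * indicator A2 x :: real)"
  have fi: "(LINT x|M. f1 x) = k1" "(LINT x|M. f2 x) = k2" unfolding f1_def f2_def by (rule cD(8), rule cD(9))
  define w where "w x = f1 x - f2 x" for x
  have AD: "A1 \<subseteq> D" "A2 \<subseteq> D" "A1 \<inter> A2 = {}" using cD(5,6) ball_subsets by blast+
  have fL: "f1 \<in> Linfty D" "f2 \<in> Linfty D" unfolding f1_def f2_def by (rule patch_Linfty[OF cD(3)], rule patch_Linfty[OF cD(4)])
  have wL: "w \<in> Linfty D" unfolding w_def by (rule Linfty_diff[OF fL])
  have nn: "0 \<le> f1 x" "0 \<le> f2 x" for x using l by (auto simp: f1_def f2_def)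
  have \<omega>w: "AE x in M. \<omega> x = w x" using cD(7) by (simp add: w_def f1_def f2_def)
  define \<psi> where "\<psi> = SF w"
  have \<psi>L: "\<psi> \<in> Linfty D" unfolding \<psi>_def by (rule SF_Linfty[OF wL])
  have \<psi>\<omega>: "\<psi> x = SF \<omega> x" and \<psi>f: "\<psi> x = SF f1 x - SF f2 x" if "x \<in> D" for x
    using cD(12)[OF that] SF_diff[OF fL that] unfolding \<psi>_def w_def f1_def f2_def by simp_all
  have in1: "\<mu>1 \<le> \<psi> x" if "x \<in> A1" for x
  proof -
    have "x \<in> D" using that AD by blast
    then show ?thesis using that \<psi>\<omega>[of x] by (subst (asm) cD(15)) simp
  qed
  have in2: "\<mu>2 \<le> - \<psi> x" if "x \<in> A2" for x
  proof -
    have "x \<in> D" using that AD by blast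
    then show ?thesis using that \<psi>\<omega>[of x] by (subst (asm) cD(16)) simp
  qed
  \<comment> \<open>The core of the other sign contributes to \<open>\<psi>\<close> with a
    favourable sign and is dropped, also at points inside the other ball.\<close>
  have out1: "\<psi> x \<le> \<mu>1 - 1" if x: "x \<in> D" "x \<notin> ball x1 \<delta>" for x
    using SF_outside_le[OF cD(3) loc(1) AD(1) l x] SF_nonneg[OF fL(2) x(1) nn(2)] \<psi>f[OF x(1)] \<mu>(1)
    unfolding f1_def[symmetric] fi by linarith
  have out2: "- \<psi> x \<le> \<mu>2 - 1" if x: "x \<in> D" "x \<notin> ball x2 \<delta>" for x
    using SF_outside_le[OF cD(4) loc(2) AD(2) l x] SF_nonneg[OF fL(1) x(1) nn(1)] \<psi>f[OF x(1)] \<mu>(2)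
    unfolding f2_def[symmetric] fi by linarith
  \<comment> \<open>The perturbation \<open>F\<close> below is bounded by \<open>6 * l\<close>; at
    this scale the singular part of the kernel contributes at most 1/2 to its stream
    function.\<close>
  define eps where "eps = min 1 (1 / sqrt (12 * l))"
  have eps: "0 < eps" "eps \<le> R" "6 * l * eps\<^sup>2 \<le> 1 / 2"
  proof -
    show "0 < eps" using l by (simp add: eps_def)
    show "eps \<le> R" using R_ge1 by (simp add: eps_def)
    have "eps\<^sup>2 \<le> (1 / sqrt (12 * l))\<^sup>2" using l by (intro power_mono) (auto simp: eps_def)
    also have "\<dots> = 1 / (12 * l)" using l by (simp add: power_divide)
    finally show "6 * l * eps\<^sup>2 \<le> 1 / 2" using l by (simp add: field_simps)
  qed
  \<comment> \<open>Since the L1 norm of \<open>F\<close> is at most four times the distance,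
    \<open>4 * \<delta>0 = \<delta>1\<close> leaves at most 1/2 for the constant part of the kernel.
    The summand 1 keeps the denominator positive when \<open>eps = R\<close>.\<close>
  define \<delta>1 where "\<delta>1 = pi / (ln (R / eps) + 1)"
  define \<delta>0 where "\<delta>0 = \<delta>1 / 4"
  have lnR: "ln (R / eps) \<ge> 0" using eps by (intro ln_ge_zero) simp
  have \<delta>0: "\<delta>0 > 0" using lnR by (simp add: \<delta>0_def \<delta>1_def)
  have "energy D G v \<le> energy D G \<omega>" if v: "v \<in> rearrangement_class D \<omega>" and dist: "L1_dist D v \<omega> < \<delta>0" for v
  proof -
    obtain V1 V2 where V: "V1 \<in> sets lebesgue" "V2 \<in> sets lebesgue" "V1 \<subseteq> D" "V2 \<subseteq> D" "V1 \<inter> V2 = {}"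
      "measure lebesgue V1 = measure lebesgue A1" "measure lebesgue V2 = measure lebesgue A2"
      "AE x in M. v x = l * indicator V1 x - l * indicator V2 x" "v \<in> borel_measurable M"
      by (rule rearrangement_patch[OF cD(3,4) AD l Linfty_measurable[OF cD(2)] cD(7) v])
    define u where "u x = l * indicator V1 x - l * indicator V2 x" for x :: "real^2"
    have uL: "u \<in> Linfty D" unfolding u_def by (rule Linfty_diff[OF patch_Linfty[OF V(1)] patch_Linfty[OF V(2)]])
    have vu: "AE x in M. v x = u x" using V(8) by (simp add: u_def)
    have vL: "v \<in> Linfty D"
    proof (rule LinftyI[OF V(9)])
      show "AE x in M. \<bar>v x\<bar> \<le> l"
        using V(8) by eventually_elim (use l in \<open>auto simp: indicator_def\<close>)
    qed
    have Ev: "energy D G v = energy D G u" unfolding energy_eq_Q Q_cong_AE[OF vL vL vu uL vu uL] ..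
    have E\<omega>: "energy D G \<omega> = energy D G w" unfolding energy_eq_Q Q_cong_AE[OF cD(2,2) \<omega>w wL \<omega>w wL] ..
    define N where "N = (LINT x|M. \<bar>u x - w x\<bar>)"
    have uwL: "(\<lambda>x. u x - w x) \<in> Linfty D" by (rule Linfty_diff[OF uL wL])
    have N: "N < \<delta>0"
    proof -
      have "L1_dist D v \<omega> = N" unfolding L1_dist_def N_def
      proof (rule integral_cong_AE)
        show "AE x in M. \<bar>v x - \<omega> x\<bar> = \<bar>u x - w x\<bar>" using vu \<omega>w by eventually_elim simp
      qed (intro Linfty_measurable Linfty_abs Linfty_diff vL uL wL cD(2))+
      then show ?thesis using dist by simp
    qed
    have bm: "ball x1 \<delta> \<in> sets lebesgue" "ball x2 \<delta> \<in> sets lebesgue" by auto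
    obtain g1 e1 where "mass_transfer D G h A1 V1 (ball x1 \<delta>) l g1 e1"
      using mass_transfer_exists[OF cD(3) AD(1) V(1,3) bm(1) cD(5) V(6) l] by blast
    then interpret t1: mass_transfer D G h A1 V1 "ball x1 \<delta>" l g1 e1 .
    obtain g2 e2 where "mass_transfer D G h A2 V2 (ball x2 \<delta>) l g2 e2"
      using mass_transfer_exists[OF cD(4) AD(2) V(2,4) bm(2) cD(6) V(7) l] by blast
    then interpret t2: mass_transfer D G h A2 V2 "ball x2 \<delta>" l g2 e2 .
    have i1: "(LINT x|M. g1 x) = k1" unfolding t1.g_integral integral_patch[OF cD(3) AD(1), symmetric] by (rule cD(8))
    have i2: "(LINT x|M. g2 x) = k2" unfolding t2.g_integral integral_patch[OF cD(4) AD(2), symmetric] by (rule cD(9))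
    define W1 W2 where "W1 = V1 - ball x1 \<delta>" and "W2 = V2 - ball x2 \<delta>"
    define S where "S = l * measure lebesgue W1 + l * measure lebesgue W2"
    have S0: "S \<ge> 0" using l by (simp add: S_def)
    have Wm: "W1 \<in> sets lebesgue" "W2 \<in> sets lebesgue" "W1 \<subseteq> D" "W2 \<subseteq> D"
      using sets.Diff[OF V(1) bm(1)] sets.Diff[OF V(2) bm(2)] V(3,4) by (auto simp: W1_def W2_def)
    \<comment> \<open>On \<open>W1\<close> the function \<open>u\<close> equals \<open>l\<close>
      while \<open>w\<close> is 0 or \<open>- l\<close>, and symmetrically on \<open>W2\<close>; so
      all misplaced mass is counted in the L1 distance.\<close>
    have SN: "S \<le> N"
    proof -
      have "S = (LINT x|M. l * indicator W1 x + l * indicator W2 x)" unfolding S_def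
        integral_patch[OF Wm(1,3), symmetric] integral_patch[OF Wm(2,4), symmetric]
        by (rule Bochner_Integration.integral_add[symmetric])
          (rule Linfty_integrable[OF patch_Linfty[OF Wm(1)]], rule Linfty_integrable[OF patch_Linfty[OF Wm(2)]])
      also have "\<dots> \<le> N" unfolding N_def
      proof (rule integral_mono)
        show "integrable M (\<lambda>x. l * indicator W1 x + l * indicator W2 x)"
          by (rule Linfty_integrable[OF Linfty_add[OF patch_Linfty[OF Wm(1)] patch_Linfty[OF Wm(2)]]])
        show "integrable M (\<lambda>x. \<bar>u x - w x\<bar>)" by (rule Linfty_integrable[OF Linfty_abs[OF uwL]])
        fix x
        consider "x \<in> W1" "x \<notin> W2" "x \<in> V1" "x \<notin> V2" "x \<notin> A1" | "x \<in> W2" "x \<notin> W1" "x \<in> V2" "x \<notin> V1" "x \<notin> A2"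
          | "x \<notin> W1" "x \<notin> W2"
          using V(5) cD(5,6) unfolding W1_def W2_def by blast
        then show "l * indicator W1 x + l * indicator W2 x \<le> \<bar>u x - w x\<bar>"
          by cases (use l in \<open>auto simp: u_def w_def f1_def f2_def indicator_def\<close>)
      qed
      finally show ?thesis .
    qed
    define d where "d x = e1 x - e2 x" for x
    have dL: "d \<in> Linfty D" unfolding d_def by (rule Linfty_diff[OF t1.e_Linfty t2.e_Linfty])
    have gu: "(\<lambda>x. g1 x - g2 x) = (\<lambda>x. u x + d x)"
      by (rule ext) (simp add: t1.g_eq t2.g_eq u_def d_def)
    have "(\<lambda>x. g1 x - g2 x) \<in> K l"
      by (rule admissibleI[OF t1.g_Linfty t1.g_range t1.g_supp i1 t2.g_Linfty t2.g_range t2.g_supp i2])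
    then have E1: "energy D G (\<lambda>x. u x + d x) \<le> energy D G \<omega>" unfolding gu by (rule cD(14))
    have d_abs: "(LINT x|M. \<bar>d x\<bar>) \<le> 2 * S"
    proof -
      have "(LINT x|M. \<bar>d x\<bar>) \<le> (LINT x|M. \<bar>e1 x\<bar> + \<bar>e2 x\<bar>)"
        by (rule integral_mono[OF Linfty_integrable[OF Linfty_abs[OF dL]]
              Linfty_integrable[OF Linfty_add[OF Linfty_abs[OF t1.e_Linfty] Linfty_abs[OF t2.e_Linfty]]]]) (simp add: d_def)
      also have "\<dots> = (LINT x|M. \<bar>e1 x\<bar>) + (LINT x|M. \<bar>e2 x\<bar>)"
        by (rule Bochner_Integration.integral_add)
          (rule Linfty_integrable[OF Linfty_abs[OF t1.e_Linfty]], rule Linfty_integrable[OF Linfty_abs[OF t2.e_Linfty]])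
      also have "\<dots> \<le> 2 * S" using t1.e_L1 t2.e_L1 unfolding S_def W1_def W2_def by simp
      finally show ?thesis .
    qed
    have gain: "S \<le> (LINT x|M. d x * \<psi> x)"
    proof -
      have "l * measure lebesgue W1 \<le> (LINT x|M. e1 x * \<psi> x)" unfolding W1_def
        by (rule t1.e_gain[OF \<psi>L in1 out1]) (use V(3) in auto)
      moreover have "l * measure lebesgue W2 \<le> (LINT x|M. e2 x * - \<psi> x)" unfolding W2_def
        by (rule t2.e_gain[OF Linfty_minus[OF \<psi>L] in2 out2]) (use V(4) in auto)
      moreover have "(LINT x|M. d x * \<psi> x) = (LINT x|M. e1 x * \<psi> x + e2 x * - \<psi> x)"
        by (simp add: d_def algebra_simps)
      moreover have "(LINT x|M. e1 x * \<psi> x + e2 x * - \<psi> x) = (LINT x|M. e1 x * \<psi> x) + (LINT x|M. e2 x * - \<psi> x)"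
        by (rule Bochner_Integration.integral_add)
          (rule Linfty_integrable[OF Linfty_mult[OF t1.e_Linfty \<psi>L]],
           rule Linfty_integrable[OF Linfty_mult[OF t2.e_Linfty Linfty_minus[OF \<psi>L]]])
      ultimately show ?thesis by (simp add: S_def)
    qed
    \<comment> \<open>Expansion around \<open>w\<close>:
      \<open>Q (u + d) (u + d) = Q u u + 2 * Q d w + Q d F\<close>. The linear term is at least
      \<open>2 * S\<close>. As \<open>d\<close> has L1 norm at most \<open>2 * S\<close>, the bound
      1 for the stream function of \<open>F\<close> makes the remainder at least
      \<open>- 2 * S\<close>.\<close>
    define F where "F x = 2 * (u x - w x) + d x" for x
    have L2: "(\<lambda>x. 2 * (u x - w x)) \<in> Linfty D" by (rule Linfty_mult[OF Linfty_const uwL])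
    have FL: "F \<in> Linfty D" unfolding F_def by (rule Linfty_add[OF L2 dL])
    have F_le: "\<bar>F x\<bar> \<le> 2 * \<bar>u x - w x\<bar> + \<bar>d x\<bar>" for x
    proof -
      have "\<bar>F x\<bar> \<le> \<bar>2 * (u x - w x)\<bar> + \<bar>d x\<bar>" unfolding F_def by (rule abs_triangle_ineq)
      then show ?thesis by (simp only: abs_mult abs_numeral)
    qed
    have Fb: "AE x in M. \<bar>F x\<bar> \<le> 6 * l"
    proof (rule AE_I2)
      fix x
      have "\<bar>u x\<bar> \<le> l" using l V(5) by (auto simp: u_def indicator_def)
      moreover have "\<bar>w x\<bar> \<le> l" using l by (auto simp: w_def f1_def f2_def indicator_def)
      ultimately have uw: "\<bar>u x - w x\<bar> \<le> l + l" by (intro order_trans[OF abs_triangle_ineq4 add_mono])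
      have dx: "\<bar>d x\<bar> \<le> l + l" unfolding d_def
        by (intro order_trans[OF abs_triangle_ineq4 add_mono] t1.e_bound t2.e_bound)
      have "\<bar>F x\<bar> \<le> 2 * (l + l) + (l + l)"
        by (rule order_trans[OF F_le add_mono[OF mult_left_mono[OF uw] dx]]) simp
      then show "\<bar>F x\<bar> \<le> 6 * l" by simp
    qed
    have F1: "(LINT x|M. \<bar>F x\<bar>) \<le> 4 * N"
    proof -
      have "(LINT x|M. \<bar>F x\<bar>) \<le> (LINT x|M. 2 * \<bar>u x - w x\<bar> + \<bar>d x\<bar>)"
        by (rule integral_mono[OF Linfty_integrable[OF Linfty_abs[OF FL]]
              Linfty_integrable[OF Linfty_add[OF Linfty_mult[OF Linfty_const Linfty_abs[OF uwL]] Linfty_abs[OF dL]]]])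
          (rule F_le)
      also have "\<dots> = 2 * N + (LINT x|M. \<bar>d x\<bar>)" unfolding N_def
        using Linfty_integrable[OF Linfty_abs[OF uwL]] Linfty_integrable[OF Linfty_abs[OF dL]] by simp
      also have "\<dots> \<le> 4 * N" using d_abs SN by simp
      finally show ?thesis .
    qed
    have SF_F: "\<bar>SF F x\<bar> \<le> 1" if x: "x \<in> D" for x
    proof -
      have "\<bar>SF F x\<bar> \<le> (ln (R / eps) * (LINT y|M. \<bar>F y\<bar>) + 6 * l * (2 * pi * eps\<^sup>2)) / (2 * pi)"
        using l by (intro SF_bound[OF Linfty_measurable[OF FL] Fb _ x eps(1,2)]) simp
      also have "\<dots> \<le> (ln (R / eps) * (4 * \<delta>0) + 2 * pi * (1 / 2)) / (2 * pi)"
      proof (intro divide_right_mono add_mono mult_left_mono lnR)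
        show "(LINT y|M. \<bar>F y\<bar>) \<le> 4 * \<delta>0" using F1 N by simp
        show "6 * l * (2 * pi * eps\<^sup>2) \<le> 2 * pi * (1 / 2)"
          using mult_left_mono[OF eps(3), of "2 * pi"] by (simp add: mult_ac)
      qed simp
      also have "\<dots> \<le> 1"
      proof -
        have "ln (R / eps) * (4 * \<delta>0) = ln (R / eps) * \<delta>1" by (simp add: \<delta>0_def)
        also have "\<dots> = pi * (ln (R / eps) / (ln (R / eps) + 1))" by (simp add: \<delta>1_def mult.commute)
        also have "\<dots> \<le> pi * 1" using lnR by (intro mult_left_mono) (auto simp: divide_le_eq_1)
        finally show ?thesis by (simp add: field_simps)
      qed
      finally show ?thesis .
    qed
    have "- (2 * S) \<le> - (LINT x|M. \<bar>d x\<bar>)" using d_abs by simp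
    also have "\<dots> = (LINT x|M. - \<bar>d x\<bar>)" by simp
    also have "\<dots> \<le> Q d F" unfolding Q_def
    proof (rule integral_mono[OF Linfty_integrable[OF Linfty_minus[OF Linfty_abs[OF dL]]] Q_integrable[OF dL FL]])
      fix x assume "x \<in> space M"
      then have "\<bar>SF F x\<bar> \<le> 1" by (intro SF_F) simp
      then have "\<bar>d x * SF F x\<bar> \<le> \<bar>d x\<bar> * 1" unfolding abs_mult by (intro mult_left_mono) auto
      then show "- \<bar>d x\<bar> \<le> d x * SF F x" by linarith
    qed
    finally have err: "- (2 * S) \<le> Q d F" .
    have QF: "Q d F = 2 * Q d u - 2 * Q d w + Q d d"
    proof -
      have "Q d F = Q d (\<lambda>x. 2 * (u x - w x)) + Q d d" unfolding F_def by (rule Q_add_right[OF dL L2 dL])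
      moreover have "Q d (\<lambda>x. 2 * (u x - w x)) = Q d (\<lambda>x. (u x - w x) + (u x - w x))" by (simp only: mult_2)
      moreover have "\<dots> = Q d (\<lambda>x. u x - w x) + Q d (\<lambda>x. u x - w x)" by (rule Q_add_right[OF dL uwL uwL])
      moreover have "Q d (\<lambda>x. u x - w x) = Q d u - Q d w" by (rule Q_diff_right[OF dL uL wL])
      ultimately show ?thesis by simp
    qed
    have "2 * energy D G (\<lambda>x. u x + d x) = Q u u + 2 * Q d u + Q d d"
      using Q_sym[OF uL dL]
      by (simp add: energy_eq_Q Q_add_left Q_add_right Linfty_add uL dL)
    moreover have "2 * energy D G u = Q u u" by (simp add: energy_eq_Q)
    moreover have "S \<le> Q d w" using gain unfolding Q_def \<psi>_def .
    ultimately show ?thesis using err QF E1 Ev by linarith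
  qed
  then show ?thesis using \<delta>0 by blast
qed

end

theorem theorem4p8:
  fixes D :: "(real^2) set"
    and G h :: "real^2 \<Rightarrow> real^2 \<Rightarrow> real"
    and \<kappa>1 \<kappa>2 \<delta> :: real
    and x1 x2 :: "real^2"
  assumes "open D" and "connected D" and "bounded D" and "simply_connected D"
    and "smooth_boundary D"
    and "green_function D G h"
    and "\<kappa>1 > 0" and "\<kappa>2 < 0"
    and "strict_local_min_on (off_diagonal D) (kirchhoff_routh G h \<kappa>1 \<kappa>2) (x1, x2)"
    and "\<delta> > 0"
    and "cball x1 \<delta> \<subseteq> D" and "cball x2 \<delta> \<subseteq> D"
    and "cball x1 \<delta> \<inter> cball x2 \<delta> = {}"
    and "unique_min_on (cball x1 \<delta> \<times> cball x2 \<delta>) (kirchhoff_routh G h \<kappa>1 \<kappa>2) (x1, x2)"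
    and "\<forall>\<^sub>F l in at_top. \<forall>\<omega>.
           is_maximizer (energy D G)
             (admissible_class D (ball x1 \<delta>) (ball x2 \<delta>) \<kappa>1 \<kappa>2 l) \<omega> \<longrightarrow>
           (\<exists>\<mu>1>0. patch_level D G (ball x1 \<delta>) \<kappa>1 l \<omega> \<mu>1) \<and>
           (\<exists>\<mu>2>0. patch_level D G (ball x2 \<delta>) \<kappa>2 l \<omega> \<mu>2)"
  shows "\<exists>l0>0. \<forall>l\<ge>l0. \<forall>\<omega>.
           is_maximizer (energy D G)
             (admissible_class D (ball x1 \<delta>) (ball x2 \<delta>) \<kappa>1 \<kappa>2 l) \<omega> \<longrightarrow>
           (\<exists>\<delta>0>0. \<forall>v \<in> rearrangement_class D \<omega>.
              L1_dist D v \<omega> < \<delta>0 \<longrightarrow> energy D G v \<le> energy D G \<omega>)"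
proof -
  interpret vortex_pair D G h \<kappa>1 "- \<kappa>2" \<delta> x1 x2
    by unfold_locales (use assms in auto)
  have "\<forall>\<^sub>F l in at_top. l > 0 \<and> (\<forall>\<omega>. is_maximizer (energy D G)
             (admissible_class D (ball x1 \<delta>) (ball x2 \<delta>) \<kappa>1 \<kappa>2 l) \<omega> \<longrightarrow>
           (\<exists>\<delta>0>0. \<forall>v \<in> rearrangement_class D \<omega>.
              L1_dist D v \<omega> < \<delta>0 \<longrightarrow> energy D G v \<le> energy D G \<omega>))"
    using assms(15) localization eventually_gt_at_top[of 0]
  proof eventually_elim
    case (elim l)
    show ?case
    proof (intro conjI allI impI elim(3))
      fix \<omega> assume max: "is_maximizer (energy D G) (admissible_class D (ball x1 \<delta>) (ball x2 \<delta>) \<kappa>1 \<kappa>2 l) \<omega>"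
      obtain \<mu>1 \<mu>2 where p: "patch_level D G (ball x1 \<delta>) \<kappa>1 l \<omega> \<mu>1" "patch_level D G (ball x2 \<delta>) \<kappa>2 l \<omega> \<mu>2"
        using elim(1) max by blast
      have c: "max_patches l \<omega> {x \<in> ball x1 \<delta>. stream_function D G \<omega> x > \<mu>1}
          {x \<in> ball x2 \<delta>. - stream_function D G \<omega> x > \<mu>2} \<mu>1 \<mu>2"
        unfolding max_patches_def minus_minus by (intro conjI elim(3) max p refl)
      note loc = elim(2)[rule_format, OF c]
      show "\<exists>\<delta>0>0. \<forall>v \<in> rearrangement_class D \<omega>. L1_dist D v \<omega> < \<delta>0 \<longrightarrow> energy D G v \<le> energy D G \<omega>"
        by (rule local_maximizer[OF c]) (use loc in blast)+
    qed
  qed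
  then obtain b where b: "\<And>l. l \<ge> b \<Longrightarrow> l > 0 \<and> (\<forall>\<omega>. is_maximizer (energy D G)
             (admissible_class D (ball x1 \<delta>) (ball x2 \<delta>) \<kappa>1 \<kappa>2 l) \<omega> \<longrightarrow>
           (\<exists>\<delta>0>0. \<forall>v \<in> rearrangement_class D \<omega>.
              L1_dist D v \<omega> < \<delta>0 \<longrightarrow> energy D G v \<le> energy D G \<omega>))"
    unfolding eventually_at_top_linorder by blast
  \<comment> \<open>Positivity of \<open>b\<close> itself is the conjunct \<open>l > 0\<close> at
    \<open>l = b\<close>.\<close>
  then show ?thesis by (intro exI[of _ b]) blast
qed

end
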